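(* Let $\mathcal A,\mathcal B,\mathcal C$ be symmetric monoidal categories. Given any symmetric monoidal functor $F:\mathcal A\to[\mathcal B,\mathcal C]$, the symmetric monoidal functor $\bar F$ is the unique strict symmetric monoidal functor $\mathcal A\otimes\mathcal B\to\mathcal C$ such that $[\mathcal B,\bar F]\circ\eta=F$ in $\mathrm{SMC}$. Given any 2-cell $\sigma:F\to G:\mathcal A\to[\mathcal B,\mathcal C]$ in $\mathrm{SMC}$, $\bar\sigma:\bar F\to\bar G$ is the unique 2-cell $\bar F\to\bar G$ in $\mathrm{SMC}$ such that $[\mathcal B,\bar\sigma]*\eta=\sigma$.
   Context: **Basics.** All symmetric monoidal categories are small, with tensor $\otimes$, unit $I$ and natural isomorphisms $ass_{a,b,c}:a\otimes(b\otimes c)\to(a\otimes b)\otimes c$, $r_a:a\otimes I\to a$, $l_a:I\otimes a\to a$, $s_{a,b}:a\otimes b\to b\otimes a$ satisfying the usual coherence axioms. A symmetric monoidal functor $F:\mathcal A\to\mathcal B$ is a lax one: a functor with an arrow $F^0:I\to F(I)$ and a natural family $F^2_{x,y}:Fx\otimes Fy\to F(x\otimes y)$ satisfying the usual associativity, unit and symmetry axioms; it is strict if $F^0$ and all $F^2_{x,y}$ are identities. $\mathrm{SMC}$ is the 2-category of symmetric monoidal categories, symmetric monoidal functors and monoidal natural transformations. **Internal hom.** $[\mathcal A,\mathcal B]$ is the category $\mathrm{SMC}(\mathcal A,\mathcal B)$ with the pointwise symmetric monoidal structure: $(F\Box G)(a)=Fa\otimes Ga$, $(F\Box G)^0$ is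 $I\cong I\otimes I\xrightarrow{F^0\otimes G^0}F(I)\otimes G(I)$, $(F\Box G)^2_{a,b}$ is the canonical interchange $(Fa\otimes Ga)\otimes(Fb\otimes Gb)\cong(Fa\otimes Fb)\otimes(Ga\otimes Gb)$ followed by $F^2_{a,b}\otimes G^2_{a,b}$; $(\sigma\Box\tau)_a=\sigma_a\otimes\tau_a$; the unit is the constant functor at $I_{\mathcal B}$ (with $I\to I$ the identity and $I\otimes I\to I$ the canonical arrow); $ass,r,l,s$ are pointwise. For $F:\mathcal B\to\mathcal C$, $[\mathcal A,F]:[\mathcal A,\mathcal B]\to[\mathcal A,\mathcal C]$ is $H\mapsto F\circ H$, $\theta\mapsto F*\theta$, with $[\mathcal A,F]^0$ having all components $F^0$ and $[\mathcal A,F]^2_{H,K}$ having component $F^2_{Ha,Ka}$ at $a$; for a 2-cell $\sigma$, $[\mathcal A,\sigma]_H=\sigma*H$. **Tensor.** $\mathcal A\otimes\mathcal B$ is the following symmetric monoidal category. Its objects are the formal words freely generated from a constant $I$ and symbols $a\otimes b$ ($a$ in $\mathcal A$, $b$ in $\mathcal B$) under a formal binary operation $X\otimes Y$. Its arrows are freely generated, under composition and the operations $p\mapsto X\otimes p$, $p\mapsto p\otimes X$ for objects $X$, by formal arrows $ass,r,l$ (with formal inverses) and $s$ for all objects, and by arrows $\alpha_b:I\to I_{\mathcal A}\otimes b$; $\beta_a:I\to a\otimes I_{\mathcal B}$; $\gamma_{a,a',b}:(a\otimes b)\otimes(a'\otimes b)\to(a\otimes a')\otimes b$; $\delta_{a,b,b'}:(a\otimes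 b)\otimes(a\otimes b')\to a\otimes(b\otimes b')$; $a\otimes g:a\otimes b\to a\otimes b'$ for $g:b\to b'$ in $\mathcal B$; $f\otimes b:a\otimes b\to a'\otimes b$ for $f:a\to a'$ in $\mathcal A$; modulo the smallest congruence, compatible with all $X\otimes-$ and $-\otimes X$, such that: (i) $\otimes$ is a bifunctor and $\otimes,I,ass,r,l,s$ form a symmetric monoidal structure; (ii) for each $a$, $b\mapsto a\otimes b$, $g\mapsto a\otimes g$ with structure $\beta_a$, $\delta_{a,-,-}$ is a symmetric monoidal functor $\eta(a):\mathcal B\to\mathcal A\otimes\mathcal B$; (iii) for each $b$, $a\mapsto a\otimes b$, $f\mapsto f\otimes b$ with structure $\alpha_b$, $\gamma_{-,-,b}$ is a symmetric monoidal functor $\mathcal A\to\mathcal A\otimes\mathcal B$; (iv) for each $f:a\to a'$ the family $(f\otimes b)_b$, and for each $g:b\to b'$ the family $(a\otimes g)_a$, is a monoidal natural transformation between the corresponding functors of (ii), resp. (iii); (v) with $c:I\otimes I\to I$ canonical, $\alpha_{b\otimes b'}\circ c=\delta_{I_{\mathcal A},b,b'}\circ(\alpha_b\otimes\alpha_{b'})$, $\beta_{a\otimes a'}\circ c=\gamma_{a,a',I_{\mathcal B}}\circ(\beta_a\otimes\beta_{a'})$, and $\beta_{I_{\mathcal A}}=\alpha_{I_{\mathcal B}}$; (vi) $\gamma_{a,a',b\otimes b'}\circ(\delta_{a,b,b'}\otimes\delta_{a',b,b'})=\delta_{a\otimes a',b,b'}\circ(\gamma_{a,a',b}\otimes\gamma_{a,a',b'})\circ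 m$, where $m$ is the canonical isomorphism exchanging the two middle factors $a\otimes b'$ and $a'\otimes b$. The symmetric monoidal functor $\eta:\mathcal A\to[\mathcal B,\mathcal A\otimes\mathcal B]$ is $a\mapsto\eta(a)$, $\eta(f)_b=f\otimes b$, $(\eta^0)_b=\alpha_b$, $(\eta^2_{a,a'})_b=\gamma_{a,a',b}$. **$\bar F$ and $\bar\sigma$.** For $F:\mathcal A\to[\mathcal B,\mathcal C]$, $\bar F:\mathcal A\otimes\mathcal B\to\mathcal C$ is the strict symmetric monoidal functor with $I\mapsto I$, $a\otimes b\mapsto F(a)(b)$, $X\otimes Y\mapsto\bar F(X)\otimes\bar F(Y)$, canonical arrows to canonical arrows, $X\otimes p\mapsto 1\otimes\bar F(p)$, $p\otimes X\mapsto\bar F(p)\otimes1$, and $\alpha_b\mapsto(F^0)_b$, $\beta_a\mapsto(Fa)^0$, $\gamma_{a,a',b}\mapsto(F^2_{a,a'})_b$, $\delta_{a,b,b'}\mapsto(Fa)^2_{b,b'}$, $f\otimes b\mapsto F(f)_b$, $a\otimes g\mapsto F(a)(g)$. For $\sigma:F\to G$, $\bar\sigma$ has components $\bar\sigma_I=1$, $\bar\sigma_{a\otimes b}=(\sigma_a)_b$, $\bar\sigma_{X\otimes Y}=\bar\sigma_X\otimes\bar\sigma_Y$. *)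

theory Defs
  imports "HOL-Library.FuncSet"
begin

section \<open>Symmetric monoidal categories\<close>

text \<open>A small category lives on a set of objects and a set of arrows; the operations are only
  meaningful on these carriers. The composite \<open>g \<cdot> f\<close> is "g after f".\<close>

record ('o, 'm) cat =
  Obj :: "'o set"
  Arr :: "'m set"
  Dom :: "'m \<Rightarrow> 'o"
  Cod :: "'m \<Rightarrow> 'o"
  ident :: "'o \<Rightarrow> 'm"
  comp :: "'m \<Rightarrow> 'm \<Rightarrow> 'm" (infixr "\<cdot>\<index>" 55)

record ('o, 'm) smcat = "('o, 'm) cat" +
  unit_ob :: "'o" ("\<one>\<index>")
  ten_ob :: "'o \<Rightarrow> 'o \<Rightarrow> 'o" (infixl "\<otimes>\<index>" 65)
  ten_ar :: "'m \<Rightarrow> 'm \<Rightarrow> 'm" (infixl "\<diamondop>\<index>" 65)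
  ass :: "'o \<Rightarrow> 'o \<Rightarrow> 'o \<Rightarrow> 'm"
  runit :: "'o \<Rightarrow> 'm"
  lunit :: "'o \<Rightarrow> 'm"
  swap :: "'o \<Rightarrow> 'o \<Rightarrow> 'm"

definition hom :: "('o, 'm, 'x) cat_scheme \<Rightarrow> 'o \<Rightarrow> 'o \<Rightarrow> 'm set" where
  "hom C a b = {f \<in> Arr C. Dom C f = a \<and> Cod C f = b}"

definition inverse_pair :: "('o, 'm, 'x) cat_scheme \<Rightarrow> 'm \<Rightarrow> 'm \<Rightarrow> bool" where
  "inverse_pair C f g \<longleftrightarrow>
     f \<in> Arr C \<and> g \<in> hom C (Cod C f) (Dom C f) \<and>
     g \<cdot>\<^bsub>C\<^esub> f = ident C (Dom C f) \<and> f \<cdot>\<^bsub>C\<^esub> g = ident C (Cod C f)"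

definition iso :: "('o, 'm, 'x) cat_scheme \<Rightarrow> 'm \<Rightarrow> bool" where
  "iso C f \<longleftrightarrow> (\<exists>g. inverse_pair C f g)"

definition inv_ar :: "('o, 'm, 'x) cat_scheme \<Rightarrow> 'm \<Rightarrow> 'm" where
  "inv_ar C f = (THE g. inverse_pair C f g)"

locale category =
  fixes C :: "('o, 'm, 'x) cat_scheme" (structure)
  assumes Dom_Obj: "f \<in> Arr C \<Longrightarrow> Dom C f \<in> Obj C"
    and Cod_Obj: "f \<in> Arr C \<Longrightarrow> Cod C f \<in> Obj C"
    and ident_hom: "a \<in> Obj C \<Longrightarrow> ident C a \<in> hom C a a"
    and comp_hom: "\<lbrakk>f \<in> hom C a b; g \<in> hom C b c\<rbrakk> \<Longrightarrow> g \<cdot> f \<in> hom C a c"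
    and comp_ident: "f \<in> hom C a b \<Longrightarrow> f \<cdot> ident C a = f"
    and ident_comp: "f \<in> hom C a b \<Longrightarrow> ident C b \<cdot> f = f"
    and comp_assoc: "\<lbrakk>f \<in> hom C a b; g \<in> hom C b c; h \<in> hom C c d\<rbrakk>
          \<Longrightarrow> (h \<cdot> g) \<cdot> f = h \<cdot> (g \<cdot> f)"

locale sym_mon_cat = category C for C :: "('o, 'm, 'x) smcat_scheme" (structure) +
  assumes unit_Obj: "\<one> \<in> Obj C"
    and ten_Obj: "\<lbrakk>a \<in> Obj C; b \<in> Obj C\<rbrakk> \<Longrightarrow> a \<otimes> b \<in> Obj C"
    and ten_hom: "\<lbrakk>f \<in> hom C a a'; g \<in> hom C b b'\<rbrakk> \<Longrightarrow> f \<diamondop> g \<in> hom C (a \<otimes> b) (a' \<otimes> b')"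
    and ten_ident: "\<lbrakk>a \<in> Obj C; b \<in> Obj C\<rbrakk>
          \<Longrightarrow> ident C a \<diamondop> ident C b = ident C (a \<otimes> b)"
    and ten_comp: "\<lbrakk>f \<in> hom C a a'; f' \<in> hom C a' a''; g \<in> hom C b b'; g' \<in> hom C b' b''\<rbrakk>
          \<Longrightarrow> (f' \<cdot> f) \<diamondop> (g' \<cdot> g) = (f' \<diamondop> g') \<cdot> (f \<diamondop> g)"
    and ass_hom: "\<lbrakk>a \<in> Obj C; b \<in> Obj C; c \<in> Obj C\<rbrakk>
          \<Longrightarrow> ass C a b c \<in> hom C (a \<otimes> (b \<otimes> c)) ((a \<otimes> b) \<otimes> c)"
    and ass_iso: "\<lbrakk>a \<in> Obj C; b \<in> Obj C; c \<in> Obj C\<rbrakk> \<Longrightarrow> iso C (ass C a b c)"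
    and ass_nat: "\<lbrakk>f \<in> hom C a a'; g \<in> hom C b b'; h \<in> hom C c c'\<rbrakk>
          \<Longrightarrow> ass C a' b' c' \<cdot> (f \<diamondop> (g \<diamondop> h)) = ((f \<diamondop> g) \<diamondop> h) \<cdot> ass C a b c"
    and runit_hom: "a \<in> Obj C \<Longrightarrow> runit C a \<in> hom C (a \<otimes> \<one>) a"
    and runit_iso: "a \<in> Obj C \<Longrightarrow> iso C (runit C a)"
    and runit_nat: "f \<in> hom C a a' \<Longrightarrow> runit C a' \<cdot> (f \<diamondop> ident C \<one>) = f \<cdot> runit C a"
    and lunit_hom: "a \<in> Obj C \<Longrightarrow> lunit C a \<in> hom C (\<one> \<otimes> a) a"
    and lunit_iso: "a \<in> Obj C \<Longrightarrow> iso C (lunit C a)"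
    and lunit_nat: "f \<in> hom C a a' \<Longrightarrow> lunit C a' \<cdot> (ident C \<one> \<diamondop> f) = f \<cdot> lunit C a"
    and swap_hom: "\<lbrakk>a \<in> Obj C; b \<in> Obj C\<rbrakk> \<Longrightarrow> swap C a b \<in> hom C (a \<otimes> b) (b \<otimes> a)"
    and swap_nat: "\<lbrakk>f \<in> hom C a a'; g \<in> hom C b b'\<rbrakk>
          \<Longrightarrow> swap C a' b' \<cdot> (f \<diamondop> g) = (g \<diamondop> f) \<cdot> swap C a b"
    and pentagon: "\<lbrakk>a \<in> Obj C; b \<in> Obj C; c \<in> Obj C; d \<in> Obj C\<rbrakk>
          \<Longrightarrow> ass C (a \<otimes> b) c d \<cdot> ass C a b (c \<otimes> d) =
              (ass C a b c \<diamondop> ident C d) \<cdot> ass C a (b \<otimes> c) d \<cdot> (ident C a \<diamondop> ass C b c d)"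
    and triangle: "\<lbrakk>a \<in> Obj C; b \<in> Obj C\<rbrakk>
          \<Longrightarrow> (runit C a \<diamondop> ident C b) \<cdot> ass C a \<one> b = ident C a \<diamondop> lunit C b"
    and swap_swap: "\<lbrakk>a \<in> Obj C; b \<in> Obj C\<rbrakk> \<Longrightarrow> swap C b a \<cdot> swap C a b = ident C (a \<otimes> b)"
    and swap_unit: "a \<in> Obj C \<Longrightarrow> lunit C a \<cdot> swap C a \<one> = runit C a"
    and hexagon: "\<lbrakk>a \<in> Obj C; b \<in> Obj C; c \<in> Obj C\<rbrakk>
          \<Longrightarrow> ass C c a b \<cdot> swap C (a \<otimes> b) c \<cdot> ass C a b c =
              (swap C a c \<diamondop> ident C b) \<cdot> ass C a c b \<cdot> (ident C a \<diamondop> swap C b c)"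

text \<open>The canonical interchange
  \<open>(w \<otimes> x) \<otimes> (y \<otimes> z) \<rightarrow> (w \<otimes> y) \<otimes> (x \<otimes> z)\<close>.\<close>

definition interchange :: "('o, 'm, 'x) smcat_scheme \<Rightarrow> 'o \<Rightarrow> 'o \<Rightarrow> 'o \<Rightarrow> 'o \<Rightarrow> 'm" where
  "interchange C w x y z =
     inv_ar C (ass C (w \<otimes>\<^bsub>C\<^esub> y) x z) \<cdot>\<^bsub>C\<^esub>
     (ass C w y x \<diamondop>\<^bsub>C\<^esub> ident C z) \<cdot>\<^bsub>C\<^esub>
     ((ident C w \<diamondop>\<^bsub>C\<^esub> swap C x y) \<diamondop>\<^bsub>C\<^esub> ident C z) \<cdot>\<^bsub>C\<^esub>
     (inv_ar C (ass C w x y) \<diamondop>\<^bsub>C\<^esub> ident C z) \<cdot>\<^bsub>C\<^esub>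
     ass C (w \<otimes>\<^bsub>C\<^esub> x) y z"

section \<open>The 2-category of symmetric monoidal categories\<close>

text \<open>Functors and transformations take the value \<open>undefined\<close> off the carriers, so that two of them
  are equal in HOL iff they agree on the carriers. Source and target categories are not recorded in
  a functor; they are arguments of the predicates and operations below.\<close>

record ('o, 'm, 'p, 'n) smf =
  on_ob :: "'o \<Rightarrow> 'p"
  on_ar :: "'m \<Rightarrow> 'n"
  f0 :: "'n"
  f2 :: "'o \<Rightarrow> 'o \<Rightarrow> 'n"

record ('o, 'm, 'p, 'n) nt =
  src :: "('o, 'm, 'p, 'n) smf"
  tgt :: "('o, 'm, 'p, 'n) smf"
  at :: "'o \<Rightarrow> 'n"

locale sm_functor =
  fixes A :: "('o, 'm, 'x) smcat_scheme" and B :: "('p, 'n, 'y) smcat_scheme"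
    and F :: "('o, 'm, 'p, 'n) smf"
  assumes on_ob_ext: "on_ob F \<in> extensional (Obj A)"
    and on_ar_ext: "on_ar F \<in> extensional (Arr A)"
    and f2_ext: "\<not> (x \<in> Obj A \<and> y \<in> Obj A) \<Longrightarrow> f2 F x y = undefined"
    and on_ob: "x \<in> Obj A \<Longrightarrow> on_ob F x \<in> Obj B"
    and on_ar: "f \<in> hom A x y \<Longrightarrow> on_ar F f \<in> hom B (on_ob F x) (on_ob F y)"
    and on_ident: "x \<in> Obj A \<Longrightarrow> on_ar F (ident A x) = ident B (on_ob F x)"
    and on_comp: "\<lbrakk>f \<in> hom A x y; g \<in> hom A y z\<rbrakk>
          \<Longrightarrow> on_ar F (g \<cdot>\<^bsub>A\<^esub> f) = on_ar F g \<cdot>\<^bsub>B\<^esub> on_ar F f"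
    and f0_hom: "f0 F \<in> hom B \<one>\<^bsub>B\<^esub> (on_ob F \<one>\<^bsub>A\<^esub>)"
    and f2_hom: "\<lbrakk>x \<in> Obj A; y \<in> Obj A\<rbrakk>
          \<Longrightarrow> f2 F x y \<in> hom B (on_ob F x \<otimes>\<^bsub>B\<^esub> on_ob F y) (on_ob F (x \<otimes>\<^bsub>A\<^esub> y))"
    and f2_nat: "\<lbrakk>f \<in> hom A x x'; g \<in> hom A y y'\<rbrakk>
          \<Longrightarrow> on_ar F (f \<diamondop>\<^bsub>A\<^esub> g) \<cdot>\<^bsub>B\<^esub> f2 F x y =
              f2 F x' y' \<cdot>\<^bsub>B\<^esub> (on_ar F f \<diamondop>\<^bsub>B\<^esub> on_ar F g)"
    and f2_ass: "\<lbrakk>x \<in> Obj A; y \<in> Obj A; z \<in> Obj A\<rbrakk>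
          \<Longrightarrow> on_ar F (ass A x y z) \<cdot>\<^bsub>B\<^esub> f2 F x (y \<otimes>\<^bsub>A\<^esub> z) \<cdot>\<^bsub>B\<^esub>
                (ident B (on_ob F x) \<diamondop>\<^bsub>B\<^esub> f2 F y z) =
              f2 F (x \<otimes>\<^bsub>A\<^esub> y) z \<cdot>\<^bsub>B\<^esub>
                (f2 F x y \<diamondop>\<^bsub>B\<^esub> ident B (on_ob F z)) \<cdot>\<^bsub>B\<^esub>
                ass B (on_ob F x) (on_ob F y) (on_ob F z)"
    and f2_runit: "x \<in> Obj A
          \<Longrightarrow> on_ar F (runit A x) \<cdot>\<^bsub>B\<^esub> f2 F x \<one>\<^bsub>A\<^esub> \<cdot>\<^bsub>B\<^esub>
                (ident B (on_ob F x) \<diamondop>\<^bsub>B\<^esub> f0 F) = runit B (on_ob F x)"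
    and f2_lunit: "x \<in> Obj A
          \<Longrightarrow> on_ar F (lunit A x) \<cdot>\<^bsub>B\<^esub> f2 F \<one>\<^bsub>A\<^esub> x \<cdot>\<^bsub>B\<^esub>
                (f0 F \<diamondop>\<^bsub>B\<^esub> ident B (on_ob F x)) = lunit B (on_ob F x)"
    and f2_swap: "\<lbrakk>x \<in> Obj A; y \<in> Obj A\<rbrakk>
          \<Longrightarrow> on_ar F (swap A x y) \<cdot>\<^bsub>B\<^esub> f2 F x y =
              f2 F y x \<cdot>\<^bsub>B\<^esub> swap B (on_ob F x) (on_ob F y)"

text \<open>Since \<open>f0 F : \<one> \<rightarrow> F \<one>\<close>, the first equation below also says \<open>F \<one> = \<one>\<close>; likewise for
  the second one.\<close>

locale strict_sm_functor = sm_functor A B F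
  for A :: "('o, 'm, 'x) smcat_scheme" and B :: "('p, 'n, 'y) smcat_scheme"
    and F :: "('o, 'm, 'p, 'n) smf" +
  assumes f0_strict: "f0 F = ident B \<one>\<^bsub>B\<^esub>"
    and f2_strict: "\<lbrakk>x \<in> Obj A; y \<in> Obj A\<rbrakk>
          \<Longrightarrow> f2 F x y = ident B (on_ob F x \<otimes>\<^bsub>B\<^esub> on_ob F y)"

text \<open>\<open>two_cell A B F G \<theta>\<close>: \<open>\<theta>\<close> is a monoidal natural transformation
  \<open>F \<rightarrow> G : A \<rightarrow> B\<close>.\<close>

locale two_cell = F: sm_functor A B F + G: sm_functor A B G
  for A :: "('o, 'm, 'x) smcat_scheme" and B :: "('p, 'n, 'y) smcat_scheme"
    and F :: "('o, 'm, 'p, 'n) smf" and G :: "('o, 'm, 'p, 'n) smf" +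
  fixes \<theta> :: "('o, 'm, 'p, 'n) nt"
  assumes src: "src \<theta> = F" and tgt: "tgt \<theta> = G"
    and at_ext: "at \<theta> \<in> extensional (Obj A)"
    and at_hom: "x \<in> Obj A \<Longrightarrow> at \<theta> x \<in> hom B (on_ob F x) (on_ob G x)"
    and at_nat: "f \<in> hom A x y
          \<Longrightarrow> at \<theta> y \<cdot>\<^bsub>B\<^esub> on_ar F f = on_ar G f \<cdot>\<^bsub>B\<^esub> at \<theta> x"
    and at_unit: "at \<theta> \<one>\<^bsub>A\<^esub> \<cdot>\<^bsub>B\<^esub> f0 F = f0 G"
    and at_ten: "\<lbrakk>x \<in> Obj A; y \<in> Obj A\<rbrakk>
          \<Longrightarrow> at \<theta> (x \<otimes>\<^bsub>A\<^esub> y) \<cdot>\<^bsub>B\<^esub> f2 F x y = f2 G x y \<cdot>\<^bsub>B\<^esub> (at \<theta> x \<diamondop>\<^bsub>B\<^esub> at \<theta> y)"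

text \<open>In \<open>smf_comp A C G F\<close> and in the two whiskerings, \<open>A\<close> and \<open>C\<close> are the source and the target of the
  composite functor. \<open>whisker_left\<close> is \<open>G * \<theta>\<close> and \<open>whisker_right\<close> is \<open>\<theta> * F\<close>.\<close>

definition smf_comp ::
  "('o, 'm, 'x) smcat_scheme \<Rightarrow> ('q, 'k, 'z) smcat_scheme \<Rightarrow>
   ('p, 'n, 'q, 'k) smf \<Rightarrow> ('o, 'm, 'p, 'n) smf \<Rightarrow> ('o, 'm, 'q, 'k) smf" where
  "smf_comp A C G F =
     \<lparr>on_ob = \<lambda>x\<in>Obj A. on_ob G (on_ob F x),
      on_ar = \<lambda>f\<in>Arr A. on_ar G (on_ar F f),
      f0 = on_ar G (f0 F) \<cdot>\<^bsub>C\<^esub> f0 G,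
      f2 = \<lambda>x y. if x \<in> Obj A \<and> y \<in> Obj A
             then on_ar G (f2 F x y) \<cdot>\<^bsub>C\<^esub> f2 G (on_ob F x) (on_ob F y) else undefined\<rparr>"

definition whisker_left ::
  "('o, 'm, 'x) smcat_scheme \<Rightarrow> ('q, 'k, 'z) smcat_scheme \<Rightarrow>
   ('p, 'n, 'q, 'k) smf \<Rightarrow> ('o, 'm, 'p, 'n) nt \<Rightarrow> ('o, 'm, 'q, 'k) nt" where
  "whisker_left A C G \<theta> =
     \<lparr>src = smf_comp A C G (src \<theta>), tgt = smf_comp A C G (tgt \<theta>),
      at = \<lambda>x\<in>Obj A. on_ar G (at \<theta> x)\<rparr>"

definition whisker_right ::
  "('o, 'm, 'x) smcat_scheme \<Rightarrow> ('q, 'k, 'z) smcat_scheme \<Rightarrow>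
   ('p, 'n, 'q, 'k) nt \<Rightarrow> ('o, 'm, 'p, 'n) smf \<Rightarrow> ('o, 'm, 'q, 'k) nt" where
  "whisker_right A C \<theta> F =
     \<lparr>src = smf_comp A C (src \<theta>) F, tgt = smf_comp A C (tgt \<theta>) F,
      at = \<lambda>x\<in>Obj A. at \<theta> (on_ob F x)\<rparr>"

section \<open>The internal hom\<close>

definition smf_unit ::
  "('o, 'm, 'x) smcat_scheme \<Rightarrow> ('p, 'n, 'y) smcat_scheme \<Rightarrow> ('o, 'm, 'p, 'n) smf" where
  "smf_unit A B =
     \<lparr>on_ob = \<lambda>x\<in>Obj A. \<one>\<^bsub>B\<^esub>,
      on_ar = \<lambda>f\<in>Arr A. ident B \<one>\<^bsub>B\<^esub>,
      f0 = ident B \<one>\<^bsub>B\<^esub>,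
      f2 = \<lambda>x y. if x \<in> Obj A \<and> y \<in> Obj A then runit B \<one>\<^bsub>B\<^esub> else undefined\<rparr>"

definition smf_ten ::
  "('o, 'm, 'x) smcat_scheme \<Rightarrow> ('p, 'n, 'y) smcat_scheme \<Rightarrow>
   ('o, 'm, 'p, 'n) smf \<Rightarrow> ('o, 'm, 'p, 'n) smf \<Rightarrow> ('o, 'm, 'p, 'n) smf" where
  "smf_ten A B F G =
     \<lparr>on_ob = \<lambda>x\<in>Obj A. on_ob F x \<otimes>\<^bsub>B\<^esub> on_ob G x,
      on_ar = \<lambda>f\<in>Arr A. on_ar F f \<diamondop>\<^bsub>B\<^esub> on_ar G f,
      f0 = (f0 F \<diamondop>\<^bsub>B\<^esub> f0 G) \<cdot>\<^bsub>B\<^esub> inv_ar B (runit B \<one>\<^bsub>B\<^esub>),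
      f2 = \<lambda>x y. if x \<in> Obj A \<and> y \<in> Obj A
             then (f2 F x y \<diamondop>\<^bsub>B\<^esub> f2 G x y) \<cdot>\<^bsub>B\<^esub>
               interchange B (on_ob F x) (on_ob G x) (on_ob F y) (on_ob G y)
             else undefined\<rparr>"

definition ihom ::
  "('o, 'm, 'x) smcat_scheme \<Rightarrow> ('p, 'n, 'y) smcat_scheme \<Rightarrow>
   (('o, 'm, 'p, 'n) smf, ('o, 'm, 'p, 'n) nt) smcat" where
  "ihom A B =
     \<lparr>Obj = {F. sm_functor A B F},
      Arr = {\<theta>. two_cell A B (src \<theta>) (tgt \<theta>) \<theta>},
      Dom = src,
      Cod = tgt,
      ident = \<lambda>F. \<lparr>src = F, tgt = F, at = \<lambda>x\<in>Obj A. ident B (on_ob F x)\<rparr>,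
      comp = \<lambda>\<tau> \<sigma>. \<lparr>src = src \<sigma>, tgt = tgt \<tau>, at = \<lambda>x\<in>Obj A. at \<tau> x \<cdot>\<^bsub>B\<^esub> at \<sigma> x\<rparr>,
      unit_ob = smf_unit A B,
      ten_ob = smf_ten A B,
      ten_ar = \<lambda>\<sigma> \<tau>. \<lparr>src = smf_ten A B (src \<sigma>) (src \<tau>), tgt = smf_ten A B (tgt \<sigma>) (tgt \<tau>),
                    at = \<lambda>x\<in>Obj A. at \<sigma> x \<diamondop>\<^bsub>B\<^esub> at \<tau> x\<rparr>,
      ass = \<lambda>F G H. \<lparr>src = smf_ten A B F (smf_ten A B G H), tgt = smf_ten A B (smf_ten A B F G) H,
                    at = \<lambda>x\<in>Obj A. ass B (on_ob F x) (on_ob G x) (on_ob H x)\<rparr>,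
      runit = \<lambda>F. \<lparr>src = smf_ten A B F (smf_unit A B), tgt = F,
                    at = \<lambda>x\<in>Obj A. runit B (on_ob F x)\<rparr>,
      lunit = \<lambda>F. \<lparr>src = smf_ten A B (smf_unit A B) F, tgt = F,
                    at = \<lambda>x\<in>Obj A. lunit B (on_ob F x)\<rparr>,
      swap = \<lambda>F G. \<lparr>src = smf_ten A B F G, tgt = smf_ten A B G F,
                    at = \<lambda>x\<in>Obj A. swap B (on_ob F x) (on_ob G x)\<rparr>\<rparr>"

text \<open>\<open>ihom_post A B C F\<close> is \<open>[A, F] : [A, B] \<rightarrow> [A, C]\<close> for \<open>F : B \<rightarrow> C\<close>, and
  \<open>ihom_post2 A B C \<sigma>\<close> is \<open>[A, \<sigma>] : [A, F] \<rightarrow> [A, G]\<close> for \<open>\<sigma> : F \<rightarrow> G\<close>.\<close>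

definition ihom_post ::
  "('o, 'm, 'x) smcat_scheme \<Rightarrow> ('p, 'n, 'y) smcat_scheme \<Rightarrow> ('q, 'k, 'z) smcat_scheme \<Rightarrow>
   ('p, 'n, 'q, 'k) smf \<Rightarrow>
   (('o, 'm, 'p, 'n) smf, ('o, 'm, 'p, 'n) nt, ('o, 'm, 'q, 'k) smf, ('o, 'm, 'q, 'k) nt) smf"
  where
  "ihom_post A B C F =
     \<lparr>on_ob = \<lambda>H\<in>Obj (ihom A B). smf_comp A C F H,
      on_ar = \<lambda>\<theta>\<in>Arr (ihom A B). whisker_left A C F \<theta>,
      f0 = \<lparr>src = smf_unit A C, tgt = smf_comp A C F (smf_unit A B), at = \<lambda>x\<in>Obj A. f0 F\<rparr>,
      f2 = \<lambda>H K. if H \<in> Obj (ihom A B) \<and> K \<in> Obj (ihom A B)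
             then \<lparr>src = smf_ten A C (smf_comp A C F H) (smf_comp A C F K),
                   tgt = smf_comp A C F (smf_ten A B H K),
                   at = \<lambda>x\<in>Obj A. f2 F (on_ob H x) (on_ob K x)\<rparr>
             else undefined\<rparr>"

definition ihom_post2 ::
  "('o, 'm, 'x) smcat_scheme \<Rightarrow> ('p, 'n, 'y) smcat_scheme \<Rightarrow> ('q, 'k, 'z) smcat_scheme \<Rightarrow>
   ('p, 'n, 'q, 'k) nt \<Rightarrow>
   (('o, 'm, 'p, 'n) smf, ('o, 'm, 'p, 'n) nt, ('o, 'm, 'q, 'k) smf, ('o, 'm, 'q, 'k) nt) nt"
  where
  "ihom_post2 A B C \<sigma> =
     \<lparr>src = ihom_post A B C (src \<sigma>), tgt = ihom_post A B C (tgt \<sigma>),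
      at = \<lambda>H\<in>Obj (ihom A B). whisker_right A C \<sigma> H\<rparr>"

section \<open>The tensor product\<close>

text \<open>Words, with \<open>WGen a b\<close> for the formal symbol \<open>a \<otimes> b\<close>.\<close>

datatype ('a, 'b) wrd =
    WI
  | WGen 'a 'b
  | WTen "('a, 'b) wrd" "('a, 'b) wrd" (infixl "\<odot>" 65)

text \<open>Formal arrows; \<open>'a\<close>, \<open>'b\<close> are the types of objects and \<open>'f\<close>, \<open>'g\<close> the types of arrows of the
  two factors. \<open>X \<triangleright> p\<close> and \<open>p \<triangleleft> X\<close> are the operations
  \<open>X \<otimes> p\<close> and \<open>p \<otimes> X\<close>, \<open>FGenL f b\<close> is \<open>f \<otimes> b\<close> and \<open>FGenR a g\<close> is \<open>a \<otimes> g\<close>.\<close>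

datatype ('a, 'f, 'b, 'g) farrow =
    FId "('a, 'b) wrd"
  | FComp "('a, 'f, 'b, 'g) farrow" "('a, 'f, 'b, 'g) farrow" (infixr "\<bullet>" 55)
  | FWhiskL "('a, 'b) wrd" "('a, 'f, 'b, 'g) farrow" (infixr "\<triangleright>" 60)
  | FWhiskR "('a, 'f, 'b, 'g) farrow" "('a, 'b) wrd" (infixl "\<triangleleft>" 60)
  | FAss "('a, 'b) wrd" "('a, 'b) wrd" "('a, 'b) wrd"
  | FAssInv "('a, 'b) wrd" "('a, 'b) wrd" "('a, 'b) wrd"
  | FR "('a, 'b) wrd"
  | FRInv "('a, 'b) wrd"
  | FL "('a, 'b) wrd"
  | FLInv "('a, 'b) wrd"
  | FS "('a, 'b) wrd" "('a, 'b) wrd"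
  | FAlpha 'b
  | FBeta 'a
  | FGamma 'a 'a 'b
  | FDelta 'a 'b 'b
  | FGenL 'f 'b
  | FGenR 'a 'g

primrec wf_wrd ::
  "('a, 'f, 'x) smcat_scheme \<Rightarrow> ('b, 'g, 'y) smcat_scheme \<Rightarrow> ('a, 'b) wrd \<Rightarrow> bool" where
  "wf_wrd A B WI \<longleftrightarrow> True"
| "wf_wrd A B (WGen a b) \<longleftrightarrow> a \<in> Obj A \<and> b \<in> Obj B"
| "wf_wrd A B (X \<odot> Y) \<longleftrightarrow> wf_wrd A B X \<and> wf_wrd A B Y"

primrec fdom ::
  "('a, 'f, 'x) smcat_scheme \<Rightarrow> ('b, 'g, 'y) smcat_scheme \<Rightarrow>
   ('a, 'f, 'b, 'g) farrow \<Rightarrow> ('a, 'b) wrd" where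
  "fdom A B (FId X) = X"
| "fdom A B (p \<bullet> q) = fdom A B q"
| "fdom A B (X \<triangleright> p) = X \<odot> fdom A B p"
| "fdom A B (p \<triangleleft> X) = fdom A B p \<odot> X"
| "fdom A B (FAss X Y Z) = X \<odot> (Y \<odot> Z)"
| "fdom A B (FAssInv X Y Z) = (X \<odot> Y) \<odot> Z"
| "fdom A B (FR X) = X \<odot> WI"
| "fdom A B (FRInv X) = X"
| "fdom A B (FL X) = WI \<odot> X"
| "fdom A B (FLInv X) = X"
| "fdom A B (FS X Y) = X \<odot> Y"
| "fdom A B (FAlpha b) = WI"
| "fdom A B (FBeta a) = WI"
| "fdom A B (FGamma a a' b) = WGen a b \<odot> WGen a' b"
| "fdom A B (FDelta a b b') = WGen a b \<odot> WGen a b'"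
| "fdom A B (FGenL f b) = WGen (Dom A f) b"
| "fdom A B (FGenR a g) = WGen a (Dom B g)"

primrec fcod ::
  "('a, 'f, 'x) smcat_scheme \<Rightarrow> ('b, 'g, 'y) smcat_scheme \<Rightarrow>
   ('a, 'f, 'b, 'g) farrow \<Rightarrow> ('a, 'b) wrd" where
  "fcod A B (FId X) = X"
| "fcod A B (p \<bullet> q) = fcod A B p"
| "fcod A B (X \<triangleright> p) = X \<odot> fcod A B p"
| "fcod A B (p \<triangleleft> X) = fcod A B p \<odot> X"
| "fcod A B (FAss X Y Z) = (X \<odot> Y) \<odot> Z"
| "fcod A B (FAssInv X Y Z) = X \<odot> (Y \<odot> Z)"
| "fcod A B (FR X) = X"
| "fcod A B (FRInv X) = X \<odot> WI"
| "fcod A B (FL X) = X"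
| "fcod A B (FLInv X) = WI \<odot> X"
| "fcod A B (FS X Y) = Y \<odot> X"
| "fcod A B (FAlpha b) = WGen \<one>\<^bsub>A\<^esub> b"
| "fcod A B (FBeta a) = WGen a \<one>\<^bsub>B\<^esub>"
| "fcod A B (FGamma a a' b) = WGen (a \<otimes>\<^bsub>A\<^esub> a') b"
| "fcod A B (FDelta a b b') = WGen a (b \<otimes>\<^bsub>B\<^esub> b')"
| "fcod A B (FGenL f b) = WGen (Cod A f) b"
| "fcod A B (FGenR a g) = WGen a (Cod B g)"

primrec wf_farrow ::
  "('a, 'f, 'x) smcat_scheme \<Rightarrow> ('b, 'g, 'y) smcat_scheme \<Rightarrow>
   ('a, 'f, 'b, 'g) farrow \<Rightarrow> bool" where
  "wf_farrow A B (FId X) \<longleftrightarrow> wf_wrd A B X"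
| "wf_farrow A B (p \<bullet> q) \<longleftrightarrow> wf_farrow A B p \<and> wf_farrow A B q \<and> fdom A B p = fcod A B q"
| "wf_farrow A B (X \<triangleright> p) \<longleftrightarrow> wf_wrd A B X \<and> wf_farrow A B p"
| "wf_farrow A B (p \<triangleleft> X) \<longleftrightarrow> wf_wrd A B X \<and> wf_farrow A B p"
| "wf_farrow A B (FAss X Y Z) \<longleftrightarrow> wf_wrd A B X \<and> wf_wrd A B Y \<and> wf_wrd A B Z"
| "wf_farrow A B (FAssInv X Y Z) \<longleftrightarrow> wf_wrd A B X \<and> wf_wrd A B Y \<and> wf_wrd A B Z"
| "wf_farrow A B (FR X) \<longleftrightarrow> wf_wrd A B X"
| "wf_farrow A B (FRInv X) \<longleftrightarrow> wf_wrd A B X"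
| "wf_farrow A B (FL X) \<longleftrightarrow> wf_wrd A B X"
| "wf_farrow A B (FLInv X) \<longleftrightarrow> wf_wrd A B X"
| "wf_farrow A B (FS X Y) \<longleftrightarrow> wf_wrd A B X \<and> wf_wrd A B Y"
| "wf_farrow A B (FAlpha b) \<longleftrightarrow> b \<in> Obj B"
| "wf_farrow A B (FBeta a) \<longleftrightarrow> a \<in> Obj A"
| "wf_farrow A B (FGamma a a' b) \<longleftrightarrow> a \<in> Obj A \<and> a' \<in> Obj A \<and> b \<in> Obj B"
| "wf_farrow A B (FDelta a b b') \<longleftrightarrow> a \<in> Obj A \<and> b \<in> Obj B \<and> b' \<in> Obj B"
| "wf_farrow A B (FGenL f b) \<longleftrightarrow> f \<in> Arr A \<and> b \<in> Obj B"
| "wf_farrow A B (FGenR a g) \<longleftrightarrow> a \<in> Obj A \<and> g \<in> Arr B"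

definition fhom ::
  "('a, 'f, 'x) smcat_scheme \<Rightarrow> ('b, 'g, 'y) smcat_scheme \<Rightarrow>
   ('a, 'b) wrd \<Rightarrow> ('a, 'b) wrd \<Rightarrow> ('a, 'f, 'b, 'g) farrow set" where
  "fhom A B X Y = {p. wf_farrow A B p \<and> fdom A B p = X \<and> fcod A B p = Y}"

text \<open>The tensor of two formal arrows, and the formal interchange
  \<open>(W \<odot> X) \<odot> (Y \<odot> Z) \<rightarrow> (W \<odot> Y) \<odot> (X \<odot> Z)\<close>.\<close>

definition ften ::
  "('a, 'f, 'x) smcat_scheme \<Rightarrow> ('b, 'g, 'y) smcat_scheme \<Rightarrow>
   ('a, 'f, 'b, 'g) farrow \<Rightarrow> ('a, 'f, 'b, 'g) farrow \<Rightarrow> ('a, 'f, 'b, 'g) farrow" where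
  "ften A B p q = (fcod A B p \<triangleright> q) \<bullet> (p \<triangleleft> fdom A B q)"

definition finterchange ::
  "('a, 'b) wrd \<Rightarrow> ('a, 'b) wrd \<Rightarrow> ('a, 'b) wrd \<Rightarrow> ('a, 'b) wrd \<Rightarrow> ('a, 'f, 'b, 'g) farrow" where
  "finterchange W X Y Z =
     FAssInv (W \<odot> Y) X Z \<bullet> (FAss W Y X \<triangleleft> Z) \<bullet> ((W \<triangleright> FS X Y) \<triangleleft> Z) \<bullet>
     (FAssInv W X Y \<triangleleft> Z) \<bullet> FAss (W \<odot> X) Y Z"

text \<open>The congruence on formal arrows. It only relates well-formed parallel arrows. The canonical
  arrow \<open>I \<odot> I \<rightarrow> I\<close> in (v) is \<open>FR WI\<close>, which is congruent to \<open>FL WI\<close>.\<close>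

inductive feq ::
  "('a, 'f, 'x) smcat_scheme \<Rightarrow> ('b, 'g, 'y) smcat_scheme \<Rightarrow>
   ('a, 'f, 'b, 'g) farrow \<Rightarrow> ('a, 'f, 'b, 'g) farrow \<Rightarrow> bool"
  for A :: "('a, 'f, 'x) smcat_scheme" and B :: "('b, 'g, 'y) smcat_scheme" where
  \<comment> \<open>congruence\<close>
  feq_refl: "wf_farrow A B p \<Longrightarrow> feq A B p p"
| feq_sym: "feq A B p q \<Longrightarrow> feq A B q p"
| feq_trans: "\<lbrakk>feq A B p q; feq A B q r\<rbrakk> \<Longrightarrow> feq A B p r"
| cong_comp: "\<lbrakk>feq A B p p'; feq A B q q'; fdom A B p = fcod A B q\<rbrakk> \<Longrightarrow> feq A B (p \<bullet> q) (p' \<bullet> q')"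
| cong_whiskL: "\<lbrakk>wf_wrd A B X; feq A B p q\<rbrakk> \<Longrightarrow> feq A B (X \<triangleright> p) (X \<triangleright> q)"
| cong_whiskR: "\<lbrakk>wf_wrd A B X; feq A B p q\<rbrakk> \<Longrightarrow> feq A B (p \<triangleleft> X) (q \<triangleleft> X)"
  \<comment> \<open>category\<close>
| comp_id: "p \<in> fhom A B X Y \<Longrightarrow> feq A B (p \<bullet> FId X) p"
| id_comp: "p \<in> fhom A B X Y \<Longrightarrow> feq A B (FId Y \<bullet> p) p"
| assoc: "\<lbrakk>p \<in> fhom A B X Y; q \<in> fhom A B Y Z; r \<in> fhom A B Z W\<rbrakk>
    \<Longrightarrow> feq A B ((r \<bullet> q) \<bullet> p) (r \<bullet> (q \<bullet> p))"
  \<comment> \<open>(i): bifunctor and symmetric monoidal structure\<close>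
| whiskL_id: "\<lbrakk>wf_wrd A B X; wf_wrd A B Y\<rbrakk> \<Longrightarrow> feq A B (X \<triangleright> FId Y) (FId (X \<odot> Y))"
| whiskL_comp: "\<lbrakk>wf_wrd A B X; p \<in> fhom A B Y Z; q \<in> fhom A B Z W\<rbrakk>
    \<Longrightarrow> feq A B (X \<triangleright> (q \<bullet> p)) ((X \<triangleright> q) \<bullet> (X \<triangleright> p))"
| whiskR_id: "\<lbrakk>wf_wrd A B X; wf_wrd A B Y\<rbrakk> \<Longrightarrow> feq A B (FId X \<triangleleft> Y) (FId (X \<odot> Y))"
| whiskR_comp: "\<lbrakk>wf_wrd A B X; p \<in> fhom A B Y Z; q \<in> fhom A B Z W\<rbrakk>
    \<Longrightarrow> feq A B ((q \<bullet> p) \<triangleleft> X) ((q \<triangleleft> X) \<bullet> (p \<triangleleft> X))"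
| whisk_whisk: "\<lbrakk>p \<in> fhom A B X X'; q \<in> fhom A B Y Y'\<rbrakk>
    \<Longrightarrow> feq A B ((p \<triangleleft> Y') \<bullet> (X \<triangleright> q)) ((X' \<triangleright> q) \<bullet> (p \<triangleleft> Y))"
| ass_inv1: "\<lbrakk>wf_wrd A B X; wf_wrd A B Y; wf_wrd A B Z\<rbrakk>
    \<Longrightarrow> feq A B (FAssInv X Y Z \<bullet> FAss X Y Z) (FId (X \<odot> (Y \<odot> Z)))"
| ass_inv2: "\<lbrakk>wf_wrd A B X; wf_wrd A B Y; wf_wrd A B Z\<rbrakk>
    \<Longrightarrow> feq A B (FAss X Y Z \<bullet> FAssInv X Y Z) (FId ((X \<odot> Y) \<odot> Z))"
| ass_nat: "\<lbrakk>p \<in> fhom A B X X'; q \<in> fhom A B Y Y'; r \<in> fhom A B Z Z'\<rbrakk>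
    \<Longrightarrow> feq A B (FAss X' Y' Z' \<bullet> ften A B p (ften A B q r)) (ften A B (ften A B p q) r \<bullet> FAss X Y Z)"
| r_inv1: "wf_wrd A B X \<Longrightarrow> feq A B (FRInv X \<bullet> FR X) (FId (X \<odot> WI))"
| r_inv2: "wf_wrd A B X \<Longrightarrow> feq A B (FR X \<bullet> FRInv X) (FId X)"
| r_nat: "p \<in> fhom A B X Y \<Longrightarrow> feq A B (FR Y \<bullet> (p \<triangleleft> WI)) (p \<bullet> FR X)"
| l_inv1: "wf_wrd A B X \<Longrightarrow> feq A B (FLInv X \<bullet> FL X) (FId (WI \<odot> X))"
| l_inv2: "wf_wrd A B X \<Longrightarrow> feq A B (FL X \<bullet> FLInv X) (FId X)"
| l_nat: "p \<in> fhom A B X Y \<Longrightarrow> feq A B (FL Y \<bullet> (WI \<triangleright> p)) (p \<bullet> FL X)"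
| s_nat: "\<lbrakk>p \<in> fhom A B X X'; q \<in> fhom A B Y Y'\<rbrakk>
    \<Longrightarrow> feq A B (FS X' Y' \<bullet> ften A B p q) (ften A B q p \<bullet> FS X Y)"
| pentagon: "\<lbrakk>wf_wrd A B X; wf_wrd A B Y; wf_wrd A B Z; wf_wrd A B W\<rbrakk>
    \<Longrightarrow> feq A B (FAss (X \<odot> Y) Z W \<bullet> FAss X Y (Z \<odot> W))
          ((FAss X Y Z \<triangleleft> W) \<bullet> FAss X (Y \<odot> Z) W \<bullet> (X \<triangleright> FAss Y Z W))"
| triangle: "\<lbrakk>wf_wrd A B X; wf_wrd A B Y\<rbrakk>
    \<Longrightarrow> feq A B ((FR X \<triangleleft> Y) \<bullet> FAss X WI Y) (X \<triangleright> FL Y)"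
| s_s: "\<lbrakk>wf_wrd A B X; wf_wrd A B Y\<rbrakk> \<Longrightarrow> feq A B (FS Y X \<bullet> FS X Y) (FId (X \<odot> Y))"
| s_unit: "wf_wrd A B X \<Longrightarrow> feq A B (FL X \<bullet> FS X WI) (FR X)"
| hexagon: "\<lbrakk>wf_wrd A B X; wf_wrd A B Y; wf_wrd A B Z\<rbrakk>
    \<Longrightarrow> feq A B (FAss Z X Y \<bullet> FS (X \<odot> Y) Z \<bullet> FAss X Y Z)
          ((FS X Z \<triangleleft> Y) \<bullet> FAss X Z Y \<bullet> (X \<triangleright> FS Y Z))"
  \<comment> \<open>(ii): \<open>a \<otimes> -\<close> is a symmetric monoidal functor\<close>
| genR_id: "\<lbrakk>a \<in> Obj A; b \<in> Obj B\<rbrakk> \<Longrightarrow> feq A B (FGenR a (ident B b)) (FId (WGen a b))"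
| genR_comp: "\<lbrakk>a \<in> Obj A; g \<in> hom B b b'; h \<in> hom B b' b''\<rbrakk>
    \<Longrightarrow> feq A B (FGenR a (h \<cdot>\<^bsub>B\<^esub> g)) (FGenR a h \<bullet> FGenR a g)"
| delta_nat: "\<lbrakk>a \<in> Obj A; g \<in> hom B b c; h \<in> hom B b' c'\<rbrakk>
    \<Longrightarrow> feq A B (FGenR a (g \<diamondop>\<^bsub>B\<^esub> h) \<bullet> FDelta a b b')
          (FDelta a c c' \<bullet> ften A B (FGenR a g) (FGenR a h))"
| delta_ass: "\<lbrakk>a \<in> Obj A; b \<in> Obj B; b' \<in> Obj B; b'' \<in> Obj B\<rbrakk>
    \<Longrightarrow> feq A B (FGenR a (ass B b b' b'') \<bullet> FDelta a b (b' \<otimes>\<^bsub>B\<^esub> b'') \<bullet> (WGen a b \<triangleright> FDelta a b' b''))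
          (FDelta a (b \<otimes>\<^bsub>B\<^esub> b') b'' \<bullet> (FDelta a b b' \<triangleleft> WGen a b'') \<bullet>
           FAss (WGen a b) (WGen a b') (WGen a b''))"
| delta_r: "\<lbrakk>a \<in> Obj A; b \<in> Obj B\<rbrakk>
    \<Longrightarrow> feq A B (FGenR a (runit B b) \<bullet> FDelta a b \<one>\<^bsub>B\<^esub> \<bullet> (WGen a b \<triangleright> FBeta a)) (FR (WGen a b))"
| delta_l: "\<lbrakk>a \<in> Obj A; b \<in> Obj B\<rbrakk>
    \<Longrightarrow> feq A B (FGenR a (lunit B b) \<bullet> FDelta a \<one>\<^bsub>B\<^esub> b \<bullet> (FBeta a \<triangleleft> WGen a b)) (FL (WGen a b))"
| delta_s: "\<lbrakk>a \<in> Obj A; b \<in> Obj B; b' \<in> Obj B\<rbrakk>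
    \<Longrightarrow> feq A B (FGenR a (swap B b b') \<bullet> FDelta a b b')
          (FDelta a b' b \<bullet> FS (WGen a b) (WGen a b'))"
  \<comment> \<open>(iii): \<open>- \<otimes> b\<close> is a symmetric monoidal functor\<close>
| genL_id: "\<lbrakk>a \<in> Obj A; b \<in> Obj B\<rbrakk> \<Longrightarrow> feq A B (FGenL (ident A a) b) (FId (WGen a b))"
| genL_comp: "\<lbrakk>b \<in> Obj B; f \<in> hom A a a'; h \<in> hom A a' a''\<rbrakk>
    \<Longrightarrow> feq A B (FGenL (h \<cdot>\<^bsub>A\<^esub> f) b) (FGenL h b \<bullet> FGenL f b)"
| gamma_nat: "\<lbrakk>b \<in> Obj B; f \<in> hom A a c; h \<in> hom A a' c'\<rbrakk>
    \<Longrightarrow> feq A B (FGenL (f \<diamondop>\<^bsub>A\<^esub> h) b \<bullet> FGamma a a' b)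
          (FGamma c c' b \<bullet> ften A B (FGenL f b) (FGenL h b))"
| gamma_ass: "\<lbrakk>b \<in> Obj B; a \<in> Obj A; a' \<in> Obj A; a'' \<in> Obj A\<rbrakk>
    \<Longrightarrow> feq A B (FGenL (ass A a a' a'') b \<bullet> FGamma a (a' \<otimes>\<^bsub>A\<^esub> a'') b \<bullet> (WGen a b \<triangleright> FGamma a' a'' b))
          (FGamma (a \<otimes>\<^bsub>A\<^esub> a') a'' b \<bullet> (FGamma a a' b \<triangleleft> WGen a'' b) \<bullet>
           FAss (WGen a b) (WGen a' b) (WGen a'' b))"
| gamma_r: "\<lbrakk>b \<in> Obj B; a \<in> Obj A\<rbrakk>
    \<Longrightarrow> feq A B (FGenL (runit A a) b \<bullet> FGamma a \<one>\<^bsub>A\<^esub> b \<bullet> (WGen a b \<triangleright> FAlpha b)) (FR (WGen a b))"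
| gamma_l: "\<lbrakk>b \<in> Obj B; a \<in> Obj A\<rbrakk>
    \<Longrightarrow> feq A B (FGenL (lunit A a) b \<bullet> FGamma \<one>\<^bsub>A\<^esub> a b \<bullet> (FAlpha b \<triangleleft> WGen a b)) (FL (WGen a b))"
| gamma_s: "\<lbrakk>b \<in> Obj B; a \<in> Obj A; a' \<in> Obj A\<rbrakk>
    \<Longrightarrow> feq A B (FGenL (swap A a a') b \<bullet> FGamma a a' b)
          (FGamma a' a b \<bullet> FS (WGen a b) (WGen a' b))"
  \<comment> \<open>(iv): \<open>f \<otimes> -\<close> and \<open>- \<otimes> g\<close> are monoidal natural transformations (the naturality square is
     common to both)\<close>
| gen_nat: "\<lbrakk>f \<in> hom A a a'; g \<in> hom B b b'\<rbrakk>
    \<Longrightarrow> feq A B (FGenL f b' \<bullet> FGenR a g) (FGenR a' g \<bullet> FGenL f b)"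
| genL_beta: "f \<in> hom A a a' \<Longrightarrow> feq A B (FGenL f \<one>\<^bsub>B\<^esub> \<bullet> FBeta a) (FBeta a')"
| genL_delta: "\<lbrakk>f \<in> hom A a a'; b \<in> Obj B; b' \<in> Obj B\<rbrakk>
    \<Longrightarrow> feq A B (FGenL f (b \<otimes>\<^bsub>B\<^esub> b') \<bullet> FDelta a b b')
          (FDelta a' b b' \<bullet> ften A B (FGenL f b) (FGenL f b'))"
| genR_alpha: "g \<in> hom B b b' \<Longrightarrow> feq A B (FGenR \<one>\<^bsub>A\<^esub> g \<bullet> FAlpha b) (FAlpha b')"
| genR_gamma: "\<lbrakk>g \<in> hom B b b'; a \<in> Obj A; a' \<in> Obj A\<rbrakk>
    \<Longrightarrow> feq A B (FGenR (a \<otimes>\<^bsub>A\<^esub> a') g \<bullet> FGamma a a' b)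
          (FGamma a a' b' \<bullet> ften A B (FGenR a g) (FGenR a' g))"
  \<comment> \<open>(v)\<close>
| alpha_delta: "\<lbrakk>b \<in> Obj B; b' \<in> Obj B\<rbrakk>
    \<Longrightarrow> feq A B (FAlpha (b \<otimes>\<^bsub>B\<^esub> b') \<bullet> FR WI)
          (FDelta \<one>\<^bsub>A\<^esub> b b' \<bullet> ften A B (FAlpha b) (FAlpha b'))"
| beta_gamma: "\<lbrakk>a \<in> Obj A; a' \<in> Obj A\<rbrakk>
    \<Longrightarrow> feq A B (FBeta (a \<otimes>\<^bsub>A\<^esub> a') \<bullet> FR WI)
          (FGamma a a' \<one>\<^bsub>B\<^esub> \<bullet> ften A B (FBeta a) (FBeta a'))"
| beta_alpha: "feq A B (FBeta \<one>\<^bsub>A\<^esub>) (FAlpha \<one>\<^bsub>B\<^esub>)"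
  \<comment> \<open>(vi)\<close>
| gamma_delta: "\<lbrakk>a \<in> Obj A; a' \<in> Obj A; b \<in> Obj B; b' \<in> Obj B\<rbrakk>
    \<Longrightarrow> feq A B (FGamma a a' (b \<otimes>\<^bsub>B\<^esub> b') \<bullet> ften A B (FDelta a b b') (FDelta a' b b'))
          (FDelta (a \<otimes>\<^bsub>A\<^esub> a') b b' \<bullet> ften A B (FGamma a a' b) (FGamma a a' b') \<bullet>
           finterchange (WGen a b) (WGen a b') (WGen a' b) (WGen a' b'))"

definition fclass ::
  "('a, 'f, 'x) smcat_scheme \<Rightarrow> ('b, 'g, 'y) smcat_scheme \<Rightarrow>
   ('a, 'f, 'b, 'g) farrow \<Rightarrow> ('a, 'f, 'b, 'g) farrow set" where
  "fclass A B p = {q. feq A B p q}"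

text \<open>The arrows of the tensor product are congruence classes. Operations on them are computed on
  representatives chosen by \<open>frep\<close>; since \<open>fdom\<close>, \<open>fcod\<close>, the formal operations and \<open>eval_ar\<close> below
  respect \<open>feq\<close>, the choice does not matter.\<close>

definition frep :: "('a, 'f, 'b, 'g) farrow set \<Rightarrow> ('a, 'f, 'b, 'g) farrow" where
  "frep P = (SOME p. p \<in> P)"

definition tensor ::
  "('a, 'f, 'x) smcat_scheme \<Rightarrow> ('b, 'g, 'y) smcat_scheme \<Rightarrow>
   (('a, 'b) wrd, ('a, 'f, 'b, 'g) farrow set) smcat" where
  "tensor A B =
     \<lparr>Obj = {X. wf_wrd A B X},
      Arr = fclass A B ` {p. wf_farrow A B p},
      Dom = \<lambda>P. fdom A B (frep P),
      Cod = \<lambda>P. fcod A B (frep P),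
      ident = \<lambda>X. fclass A B (FId X),
      comp = \<lambda>P Q. fclass A B (frep P \<bullet> frep Q),
      unit_ob = WI,
      ten_ob = WTen,
      ten_ar = \<lambda>P Q. fclass A B (ften A B (frep P) (frep Q)),
      ass = \<lambda>X Y Z. fclass A B (FAss X Y Z),
      runit = \<lambda>X. fclass A B (FR X),
      lunit = \<lambda>X. fclass A B (FL X),
      swap = \<lambda>X Y. fclass A B (FS X Y)\<rparr>"

definition eta_ob ::
  "('a, 'f, 'x) smcat_scheme \<Rightarrow> ('b, 'g, 'y) smcat_scheme \<Rightarrow> 'a \<Rightarrow>
   ('b, 'g, ('a, 'b) wrd, ('a, 'f, 'b, 'g) farrow set) smf" where
  "eta_ob A B a =
     \<lparr>on_ob = \<lambda>b\<in>Obj B. WGen a b,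
      on_ar = \<lambda>g\<in>Arr B. fclass A B (FGenR a g),
      f0 = fclass A B (FBeta a),
      f2 = \<lambda>b b'. if b \<in> Obj B \<and> b' \<in> Obj B then fclass A B (FDelta a b b') else undefined\<rparr>"

text \<open>The functor \<open>\<eta> : A \<rightarrow> [B, A \<otimes> B]\<close>.\<close>

definition eta ::
  "('a, 'f, 'x) smcat_scheme \<Rightarrow> ('b, 'g, 'y) smcat_scheme \<Rightarrow>
   ('a, 'f, ('b, 'g, ('a, 'b) wrd, ('a, 'f, 'b, 'g) farrow set) smf,
            ('b, 'g, ('a, 'b) wrd, ('a, 'f, 'b, 'g) farrow set) nt) smf" where
  "eta A B =
     \<lparr>on_ob = \<lambda>a\<in>Obj A. eta_ob A B a,
      on_ar = \<lambda>f\<in>Arr A. \<lparr>src = eta_ob A B (Dom A f), tgt = eta_ob A B (Cod A f),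
                        at = \<lambda>b\<in>Obj B. fclass A B (FGenL f b)\<rparr>,
      f0 = \<lparr>src = smf_unit B (tensor A B), tgt = eta_ob A B \<one>\<^bsub>A\<^esub>,
            at = \<lambda>b\<in>Obj B. fclass A B (FAlpha b)\<rparr>,
      f2 = \<lambda>a a'. if a \<in> Obj A \<and> a' \<in> Obj A
             then \<lparr>src = smf_ten B (tensor A B) (eta_ob A B a) (eta_ob A B a'),
                   tgt = eta_ob A B (a \<otimes>\<^bsub>A\<^esub> a'),
                   at = \<lambda>b\<in>Obj B. fclass A B (FGamma a a' b)\<rparr>
             else undefined\<rparr>"

section \<open>The functor and the 2-cell induced on the tensor product\<close>

text \<open>For \<open>F : A \<rightarrow> [B, C]\<close>, \<open>eval_ob\<close> and \<open>eval_ar\<close> interpret words and formal arrows in \<open>C\<close>, and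
  \<open>bar A B C F\<close> is the strict functor that they induce on \<open>A \<otimes> B\<close>; \<open>bar2 A B C \<sigma>\<close> is the induced
  transformation. Here \<open>at (at \<sigma> a) b\<close> is \<open>(\<sigma>_a)_b\<close>.\<close>

primrec eval_ob ::
  "('c, 'k, 'z) smcat_scheme \<Rightarrow>
   ('a, 'f, ('b, 'g, 'c, 'k) smf, ('b, 'g, 'c, 'k) nt) smf \<Rightarrow> ('a, 'b) wrd \<Rightarrow> 'c" where
  "eval_ob C F WI = \<one>\<^bsub>C\<^esub>"
| "eval_ob C F (WGen a b) = on_ob (on_ob F a) b"
| "eval_ob C F (X \<odot> Y) = eval_ob C F X \<otimes>\<^bsub>C\<^esub> eval_ob C F Y"

primrec eval_ar ::
  "('c, 'k, 'z) smcat_scheme \<Rightarrow>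
   ('a, 'f, ('b, 'g, 'c, 'k) smf, ('b, 'g, 'c, 'k) nt) smf \<Rightarrow>
   ('a, 'f, 'b, 'g) farrow \<Rightarrow> 'k" where
  "eval_ar C F (FId X) = ident C (eval_ob C F X)"
| "eval_ar C F (p \<bullet> q) = eval_ar C F p \<cdot>\<^bsub>C\<^esub> eval_ar C F q"
| "eval_ar C F (X \<triangleright> p) = ident C (eval_ob C F X) \<diamondop>\<^bsub>C\<^esub> eval_ar C F p"
| "eval_ar C F (p \<triangleleft> X) = eval_ar C F p \<diamondop>\<^bsub>C\<^esub> ident C (eval_ob C F X)"
| "eval_ar C F (FAss X Y Z) = ass C (eval_ob C F X) (eval_ob C F Y) (eval_ob C F Z)"
| "eval_ar C F (FAssInv X Y Z) = inv_ar C (ass C (eval_ob C F X) (eval_ob C F Y) (eval_ob C F Z))"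
| "eval_ar C F (FR X) = runit C (eval_ob C F X)"
| "eval_ar C F (FRInv X) = inv_ar C (runit C (eval_ob C F X))"
| "eval_ar C F (FL X) = lunit C (eval_ob C F X)"
| "eval_ar C F (FLInv X) = inv_ar C (lunit C (eval_ob C F X))"
| "eval_ar C F (FS X Y) = swap C (eval_ob C F X) (eval_ob C F Y)"
| "eval_ar C F (FAlpha b) = at (f0 F) b"
| "eval_ar C F (FBeta a) = f0 (on_ob F a)"
| "eval_ar C F (FGamma a a' b) = at (f2 F a a') b"
| "eval_ar C F (FDelta a b b') = f2 (on_ob F a) b b'"
| "eval_ar C F (FGenL f b) = at (on_ar F f) b"
| "eval_ar C F (FGenR a g) = on_ar (on_ob F a) g"

primrec eval_nt ::
  "('c, 'k, 'z) smcat_scheme \<Rightarrow>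
   ('a, 'f, ('b, 'g, 'c, 'k) smf, ('b, 'g, 'c, 'k) nt) nt \<Rightarrow> ('a, 'b) wrd \<Rightarrow> 'k" where
  "eval_nt C \<sigma> WI = ident C \<one>\<^bsub>C\<^esub>"
| "eval_nt C \<sigma> (WGen a b) = at (at \<sigma> a) b"
| "eval_nt C \<sigma> (X \<odot> Y) = eval_nt C \<sigma> X \<diamondop>\<^bsub>C\<^esub> eval_nt C \<sigma> Y"

definition bar ::
  "('a, 'f, 'x) smcat_scheme \<Rightarrow> ('b, 'g, 'y) smcat_scheme \<Rightarrow> ('c, 'k, 'z) smcat_scheme \<Rightarrow>
   ('a, 'f, ('b, 'g, 'c, 'k) smf, ('b, 'g, 'c, 'k) nt) smf \<Rightarrow>
   (('a, 'b) wrd, ('a, 'f, 'b, 'g) farrow set, 'c, 'k) smf" where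
  "bar A B C F =
     \<lparr>on_ob = \<lambda>X\<in>Obj (tensor A B). eval_ob C F X,
      on_ar = \<lambda>P\<in>Arr (tensor A B). eval_ar C F (frep P),
      f0 = ident C \<one>\<^bsub>C\<^esub>,
      f2 = \<lambda>X Y. if X \<in> Obj (tensor A B) \<and> Y \<in> Obj (tensor A B)
             then ident C (eval_ob C F X \<otimes>\<^bsub>C\<^esub> eval_ob C F Y) else undefined\<rparr>"

definition bar2 ::
  "('a, 'f, 'x) smcat_scheme \<Rightarrow> ('b, 'g, 'y) smcat_scheme \<Rightarrow> ('c, 'k, 'z) smcat_scheme \<Rightarrow>
   ('a, 'f, ('b, 'g, 'c, 'k) smf, ('b, 'g, 'c, 'k) nt) nt \<Rightarrow>
   (('a, 'b) wrd, ('a, 'f, 'b, 'g) farrow set, 'c, 'k) nt" where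
  "bar2 A B C \<sigma> =
     \<lparr>src = bar A B C (src \<sigma>), tgt = bar A B C (tgt \<sigma>),
      at = \<lambda>X\<in>Obj (tensor A B). eval_nt C \<sigma> X\<rparr>"

end

theory Submission
  imports Defs
begin

text \<open>
  An object of \<open>A \<otimes> B\<close> is a word in the symbols \<open>a \<otimes> b\<close>, and an arrow is a formal composite of
  whiskered canonical arrows and of the generators \<open>\<alpha>\<close>, \<open>\<beta>\<close>, \<open>\<gamma>\<close>, \<open>\<delta>\<close>, \<open>f \<otimes> b\<close>, \<open>a \<otimes> g\<close>. A strict
  symmetric monoidal functor \<open>H\<close> on \<open>A \<otimes> B\<close> is therefore determined by its values on these generators,
  and restriction along \<open>\<eta>\<close> reads off exactly these values: \<open>[B, H] \<circ> \<eta>\<close> sends \<open>a\<close> to \<open>b \<mapsto> H (a \<otimes> b)\<close>,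
  and its actions on arrows and its structure arrows are the images under \<open>H\<close> of the six families of
  generators (\<open>restr_on_ob\<close>, \<open>restr_on_ar\<close>, \<open>restr_f0\<close>, \<open>restr_f2\<close>). Hence uniqueness is an
  induction over words and formal arrows (\<open>bar_unique\<close>). Existence means that the interpretation of
  formal arrows in \<open>C\<close> respects the congruence (\<open>feq_ar\<close>): the relations (ii) to (vi) are, one by one,
  the axioms of a symmetric monoidal functor whose values on objects are symmetric monoidal functors
  and whose values on arrows are monoidal natural transformations. The same induction treats 2-cells:
  a family on words that is built from its values on generators by tensoring is natural as soon as it
  is natural at the generating arrows, and naturality there is what \<open>\<sigma>\<close> provides (\<open>nt_square\<close>).

  Most of the work goes into \<open>\<eta>\<close> itself. Evaluating \<open>[B, H] \<circ> \<eta>\<close> requires that the values of \<open>\<eta>\<close> lie in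
  \<open>[B, A \<otimes> B]\<close>, so that \<open>A \<otimes> B\<close> has to be a symmetric monoidal category (\<open>sym_mon_cat_tensor\<close>) and the
  source \<open>\<eta>(a) \<box> \<eta>(a')\<close> of \<open>\<eta>\<^sup>2\<close> has to be a symmetric monoidal functor (\<open>sm_functor_smf_ten\<close>). The
  latter rests on coherence of the interchange \<open>(w \<otimes> x) \<otimes> (y \<otimes> z) \<rightarrow> (w \<otimes> y) \<otimes> (x \<otimes> z)\<close> in an
  arbitrary symmetric monoidal category, which is obtained by reduction to a strict calculation. A
  word of objects acts on objects \<open>x\<close> by tensoring its letters onto \<open>x\<close> one after the other, and an
  arrow between evaluated words is \<^emph>\<open>read\<close> as a family of arrows between the resulting right-nested
  tensor products. Associativity and unit arrows are read as identities, a symmetry is read as a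
  composite of transpositions \<open>a \<otimes> (b \<otimes> x) \<rightarrow> b \<otimes> (a \<otimes> x)\<close>, and since \<open>- \<otimes> I\<close> is faithful, two arrows
  with the same reading are equal (\<open>reads_eqI\<close>).
\<close>

section \<open>Calculating with typed arrows\<close>

text \<open>The axioms are restated with \<open>Dom\<close> and \<open>Cod\<close> in place of hom-sets. In this form no
  intermediate object occurs only in the premises, so that the axioms act as conditional rewrite
  rules: simplification checks that composites are typed and brackets them to the right.\<close>

context category
begin

lemma homD: "f \<in> hom C a b \<Longrightarrow> f \<in> Arr C \<and> Dom C f = a \<and> Cod C f = b \<and> a \<in> Obj C \<and> b \<in> Obj C"
  using Dom_Obj Cod_Obj by (auto simp: hom_def)

lemma Arr_hom: "f \<in> Arr C \<Longrightarrow> f \<in> hom C (Dom C f) (Cod C f)"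
  by (simp add: hom_def)

lemmas [simp] = Dom_Obj Cod_Obj

lemma ident_type [simp]:
  assumes "a \<in> Obj C"
  shows "ident C a \<in> Arr C" "Dom C (ident C a) = a" "Cod C (ident C a) = a"
  using homD[OF ident_hom[OF assms]] by auto

lemma comp_type [simp]:
  assumes "f \<in> Arr C" "g \<in> Arr C" "Dom C g = Cod C f"
  shows "g \<cdot> f \<in> Arr C" "Dom C (g \<cdot> f) = Dom C f" "Cod C (g \<cdot> f) = Cod C g"
  using homD[OF comp_hom[of f "Dom C f" "Cod C f" g "Cod C g"]] assms by (auto simp: hom_def)

lemma comp_ident_simp [simp]: "\<lbrakk>f \<in> Arr C; Dom C f = a\<rbrakk> \<Longrightarrow> f \<cdot> ident C a = f"
  by (rule comp_ident[of _ _ "Cod C f"]) (simp add: hom_def)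

lemma ident_comp_simp [simp]: "\<lbrakk>f \<in> Arr C; Cod C f = a\<rbrakk> \<Longrightarrow> ident C a \<cdot> f = f"
  by (rule ident_comp[of _ "Dom C f"]) (simp add: hom_def)

lemma comp_assoc_simp [simp]:
  "\<lbrakk>f \<in> Arr C; g \<in> Arr C; h \<in> Arr C; Dom C g = Cod C f; Dom C h = Cod C g\<rbrakk>
   \<Longrightarrow> (h \<cdot> g) \<cdot> f = h \<cdot> (g \<cdot> f)"
  by (rule comp_assoc[of _ "Dom C f" "Cod C f" _ "Cod C g" _ "Cod C h"]) (auto simp: hom_def)

lemma inverse_pair_unique:
  assumes "inverse_pair C f g" "inverse_pair C f h"
  shows "g = h"
proof -
  note [simp] = assms[unfolded inverse_pair_def hom_def, simplified]
  have "g = g \<cdot> (f \<cdot> h)" by simp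
  also have "\<dots> = (g \<cdot> f) \<cdot> h" by (rule comp_assoc_simp[symmetric]) simp_all
  also have "\<dots> = h" by simp
  finally show ?thesis .
qed

lemma inverse_pair_inv_ar: "inverse_pair C f g \<Longrightarrow> inv_ar C f = g"
  unfolding inv_ar_def by (rule the_equality) (auto intro: inverse_pair_unique)

lemma iso_inverse_pair: "iso C f \<Longrightarrow> inverse_pair C f (inv_ar C f)"
  unfolding iso_def using inverse_pair_inv_ar by fastforce

lemma inv_ar_type [simp]:
  assumes "iso C f"
  shows "inv_ar C f \<in> Arr C" "Dom C (inv_ar C f) = Cod C f" "Cod C (inv_ar C f) = Dom C f"
    "inv_ar C f \<cdot> f = ident C (Dom C f)" "f \<cdot> inv_ar C f = ident C (Cod C f)"
  using iso_inverse_pair[OF assms] by (auto simp: inverse_pair_def hom_def)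

lemma iso_Arr: "iso C f \<Longrightarrow> f \<in> Arr C"
  by (auto simp: iso_def inverse_pair_def)

lemma comp_inv_ar_assoc [simp]:
  assumes "iso C f" "g \<in> Arr C"
  shows "Cod C g = Dom C f \<Longrightarrow> inv_ar C f \<cdot> f \<cdot> g = g" "Cod C g = Cod C f \<Longrightarrow> f \<cdot> inv_ar C f \<cdot> g = g"
proof -
  note [simp] = assms iso_Arr[OF assms(1)]
  show "inv_ar C f \<cdot> f \<cdot> g = g" if "Cod C g = Dom C f"
    by (subst comp_assoc_simp[symmetric]) (simp_all add: that)
  show "f \<cdot> inv_ar C f \<cdot> g = g" if "Cod C g = Cod C f"
    by (subst comp_assoc_simp[symmetric]) (simp_all add: that)
qed

lemma iso_cancel_left:
  assumes "iso C h" "f \<in> Arr C" "g \<in> Arr C" "Cod C f = Dom C h" "Cod C g = Dom C h" "h \<cdot> f = h \<cdot> g"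
  shows "f = g"
  by (metis comp_inv_ar_assoc(1) assms)

lemma iso_cancel_right:
  assumes "iso C h" "f \<in> Arr C" "g \<in> Arr C" "Dom C f = Cod C h" "Dom C g = Cod C h" "f \<cdot> h = g \<cdot> h"
  shows "f = g"
proof -
  note [simp] = assms(1-5) iso_Arr[OF assms(1)]
  have "f = (f \<cdot> h) \<cdot> inv_ar C h" by simp
  also have "\<dots> = (g \<cdot> h) \<cdot> inv_ar C h" by (simp only: assms(6))
  also have "\<dots> = g" by simp
  finally show ?thesis .
qed

lemma isoI:
  assumes "f \<in> Arr C" "g \<in> Arr C" "Dom C g = Cod C f" "Cod C g = Dom C f"
    "g \<cdot> f = ident C (Dom C f)" "f \<cdot> g = ident C (Cod C f)"
  shows "iso C f" "inv_ar C f = g"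
proof -
  have "inverse_pair C f g" using assms by (simp add: inverse_pair_def hom_def)
  then show "iso C f" "inv_ar C f = g" by (auto simp: iso_def inverse_pair_inv_ar)
qed

lemma iso_inv_ar [simp]: "iso C f \<Longrightarrow> iso C (inv_ar C f)"
  by (rule isoI(1)[where g=f]) (simp_all add: iso_Arr)

lemma iso_ident [simp]: "a \<in> Obj C \<Longrightarrow> iso C (ident C a)"
  by (rule isoI(1)[where g="ident C a"]) simp_all

lemma iso_comp [simp]:
  assumes "iso C f" "iso C g" "Dom C g = Cod C f"
  shows "iso C (g \<cdot> f)"
  by (rule isoI(1)[where g="inv_ar C f \<cdot> inv_ar C g"]) (use assms in \<open>simp_all add: iso_Arr\<close>)

end

context sym_mon_cat
begin

lemmas [simp] = unit_Obj ten_Obj ten_ident ass_iso runit_iso lunit_iso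

lemma ten_type [simp]:
  assumes "f \<in> Arr C" "g \<in> Arr C"
  shows "f \<diamondop> g \<in> Arr C" "Dom C (f \<diamondop> g) = Dom C f \<otimes> Dom C g" "Cod C (f \<diamondop> g) = Cod C f \<otimes> Cod C g"
  using homD[OF ten_hom[of f "Dom C f" "Cod C f" g "Dom C g" "Cod C g"]] assms by (auto simp: hom_def)

lemma ass_type [simp]:
  assumes "a \<in> Obj C" "b \<in> Obj C" "c \<in> Obj C"
  shows "ass C a b c \<in> Arr C" "Dom C (ass C a b c) = a \<otimes> (b \<otimes> c)" "Cod C (ass C a b c) = (a \<otimes> b) \<otimes> c"
  using homD[OF ass_hom[OF assms]] by auto

lemma unit_type [simp]:
  assumes "a \<in> Obj C"
  shows "runit C a \<in> Arr C" "Dom C (runit C a) = a \<otimes> \<one>" "Cod C (runit C a) = a"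
    "lunit C a \<in> Arr C" "Dom C (lunit C a) = \<one> \<otimes> a" "Cod C (lunit C a) = a"
  using homD[OF runit_hom[OF assms]] homD[OF lunit_hom[OF assms]] by auto

lemma swap_type [simp]:
  assumes "a \<in> Obj C" "b \<in> Obj C"
  shows "swap C a b \<in> Arr C" "Dom C (swap C a b) = a \<otimes> b" "Cod C (swap C a b) = b \<otimes> a"
  using homD[OF swap_hom[OF assms]] by auto

text \<open>The bifunctor law is oriented towards one tensor of composites. Combined with bracketing to the
  right this gives a normal form, provided that composable tensors are also fused inside longer
  composites.\<close>

lemma ten_comp_simp [simp]:
  "\<lbrakk>f \<in> Arr C; f' \<in> Arr C; g \<in> Arr C; g' \<in> Arr C; Dom C f' = Cod C f; Dom C g' = Cod C g\<rbrakk>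
   \<Longrightarrow> (f' \<diamondop> g') \<cdot> (f \<diamondop> g) = (f' \<cdot> f) \<diamondop> (g' \<cdot> g)"
  by (rule ten_comp[symmetric]) (auto simp: hom_def)

lemma ten_comp_assoc_simp [simp]:
  assumes "f \<in> Arr C" "f' \<in> Arr C" "g \<in> Arr C" "g' \<in> Arr C" "Dom C f' = Cod C f" "Dom C g' = Cod C g"
    "h \<in> Arr C" "Cod C h = Dom C f \<otimes> Dom C g"
  shows "(f' \<diamondop> g') \<cdot> (f \<diamondop> g) \<cdot> h = ((f' \<cdot> f) \<diamondop> (g' \<cdot> g)) \<cdot> h"
  by (subst comp_assoc_simp[symmetric]) (simp_all add: assms)

lemma iso_ten [simp]:
  assumes "iso C f" "iso C g"
  shows "iso C (f \<diamondop> g)" "inv_ar C (f \<diamondop> g) = inv_ar C f \<diamondop> inv_ar C g"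
  using isoI[where f = "f \<diamondop> g" and g="inv_ar C f \<diamondop> inv_ar C g"] assms by (simp_all add: iso_Arr)

lemma iso_swap [simp]:
  assumes "a \<in> Obj C" "b \<in> Obj C"
  shows "iso C (swap C a b)" "inv_ar C (swap C a b) = swap C b a"
  using isoI[where f = "swap C a b" and g="swap C b a"] assms by (simp_all add: swap_swap)

lemmas [simp] = swap_swap

section \<open>Units\<close>

text \<open>Conjugation with \<open>l\<close> (or with \<open>r\<close>, below) turns the tensor with \<open>I\<close> back into the given
  arrow.\<close>

lemma unit_ten_faithful:
  assumes "f \<in> Arr C" "g \<in> Arr C" "Dom C f = Dom C g" "Cod C f = Cod C g"
    "ident C \<one> \<diamondop> f = ident C \<one> \<diamondop> g"
  shows "f = g"
proof -
  have "f \<cdot> lunit C (Dom C f) = g \<cdot> lunit C (Dom C f)"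
    using assms lunit_nat[OF Arr_hom, of f] lunit_nat[OF Arr_hom, of g] by simp
  then show ?thesis using assms by (auto intro: iso_cancel_right[of "lunit C (Dom C f)"])
qed

lemma ten_unit_faithful:
  assumes "f \<in> Arr C" "g \<in> Arr C" "Dom C f = Dom C g" "Cod C f = Cod C g"
    "f \<diamondop> ident C \<one> = g \<diamondop> ident C \<one>"
  shows "f = g"
proof -
  have "f \<cdot> runit C (Dom C f) = g \<cdot> runit C (Dom C f)"
    using assms runit_nat[OF Arr_hom, of f] runit_nat[OF Arr_hom, of g] by simp
  then show ?thesis using assms by (auto intro: iso_cancel_right[of "runit C (Dom C f)"])
qed

lemma ass_nat_simp:
  "\<lbrakk>f \<in> Arr C; g \<in> Arr C; h \<in> Arr C\<rbrakk>
   \<Longrightarrow> ass C (Cod C f) (Cod C g) (Cod C h) \<cdot> (f \<diamondop> (g \<diamondop> h)) = ((f \<diamondop> g) \<diamondop> h) \<cdot> ass C (Dom C f) (Dom C g) (Dom C h)"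
  by (rule ass_nat) (auto simp: hom_def)

text \<open>This is Kelly's lemma. As \<open>I \<otimes> -\<close> is faithful, the equation may be tensored with \<open>I\<close> on the
  left; it then follows from the pentagon for \<open>I, I, a, b\<close> and two instances of the triangle.\<close>

lemma lunit_ten:
  assumes [simp]: "a \<in> Obj C" "b \<in> Obj C"
  shows "(lunit C a \<diamondop> ident C b) \<cdot> ass C \<one> a b = lunit C (a \<otimes> b)"
proof (rule unit_ten_faithful)
  let ?I = "ident C \<one>" and ?a = "ident C a" and ?b = "ident C b"
  have "ass C \<one> a b \<cdot> (?I \<diamondop> ((lunit C a \<diamondop> ?b) \<cdot> ass C \<one> a b))
      = (ass C \<one> a b \<cdot> (?I \<diamondop> (lunit C a \<diamondop> ?b))) \<cdot> (?I \<diamondop> ass C \<one> a b)"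
    by simp
  also have "\<dots> = (((?I \<diamondop> lunit C a) \<diamondop> ?b) \<cdot> ass C \<one> (\<one> \<otimes> a) b) \<cdot> (?I \<diamondop> ass C \<one> a b)"
    using ass_nat_simp[of ?I "lunit C a" ?b] by simp
  also have "\<dots> = (((runit C \<one> \<diamondop> ?a) \<cdot> ass C \<one> \<one> a) \<diamondop> ?b) \<cdot> ass C \<one> (\<one> \<otimes> a) b \<cdot> (?I \<diamondop> ass C \<one> a b)"
    by (simp add: triangle)
  also have "\<dots> = ((runit C \<one> \<diamondop> ?a) \<diamondop> ?b) \<cdot> (ass C \<one> \<one> a \<diamondop> ?b) \<cdot> ass C \<one> (\<one> \<otimes> a) b \<cdot> (?I \<diamondop> ass C \<one> a b)"
    by simp
  also have "\<dots> = ((runit C \<one> \<diamondop> ?a) \<diamondop> ?b) \<cdot> ass C (\<one> \<otimes> \<one>) a b \<cdot> ass C \<one> \<one> (a \<otimes> b)"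
    by (simp only: pentagon[OF unit_Obj unit_Obj assms, symmetric])
  also have "\<dots> = (((runit C \<one> \<diamondop> ?a) \<diamondop> ?b) \<cdot> ass C (\<one> \<otimes> \<one>) a b) \<cdot> ass C \<one> \<one> (a \<otimes> b)"
    by simp
  also have "\<dots> = (ass C \<one> a b \<cdot> (runit C \<one> \<diamondop> (?a \<diamondop> ?b))) \<cdot> ass C \<one> \<one> (a \<otimes> b)"
    using ass_nat_simp[of "runit C \<one>" ?a ?b] by simp
  also have "\<dots> = ass C \<one> a b \<cdot> (?I \<diamondop> lunit C (a \<otimes> b))"
    by (simp add: triangle)
  finally show "?I \<diamondop> ((lunit C a \<diamondop> ?b) \<cdot> ass C \<one> a b) = ?I \<diamondop> lunit C (a \<otimes> b)"
    by (rule iso_cancel_left[rotated -1]) simp_all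
qed simp_all

text \<open>Naturality of \<open>l\<close> at \<open>l\<^sub>I\<close> gives \<open>I \<otimes> l\<^sub>I = l\<^bsub>I \<otimes> I\<^esub>\<close>. The left side is computed by the triangle and
  the right side by Kelly's lemma, which leaves \<open>r\<^sub>I \<otimes> I = l\<^sub>I \<otimes> I\<close>.\<close>

lemma lunit_unit: "lunit C \<one> = runit C \<one>"
proof (rule ten_unit_faithful)
  have "lunit C \<one> \<cdot> (ident C \<one> \<diamondop> lunit C \<one>) = lunit C \<one> \<cdot> lunit C (\<one> \<otimes> \<one>)"
    using lunit_nat[OF Arr_hom, of "lunit C \<one>"] by simp
  then have "ident C \<one> \<diamondop> lunit C \<one> = lunit C (\<one> \<otimes> \<one>)"
    by (rule iso_cancel_left[rotated -1]) simp_all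
  then have "(lunit C \<one> \<diamondop> ident C \<one>) \<cdot> ass C \<one> \<one> \<one> = (runit C \<one> \<diamondop> ident C \<one>) \<cdot> ass C \<one> \<one> \<one>"
    by (simp add: lunit_ten triangle)
  then show "lunit C \<one> \<diamondop> ident C \<one> = runit C \<one> \<diamondop> ident C \<one>"
    by (rule iso_cancel_right[rotated -1]) simp_all
qed simp_all

lemma swap_unit_unit: "swap C \<one> \<one> = ident C (\<one> \<otimes> \<one>)"
proof -
  have "runit C \<one> \<cdot> swap C \<one> \<one> = runit C \<one> \<cdot> ident C (\<one> \<otimes> \<one>)"
    using swap_unit[OF unit_Obj] by (simp add: lunit_unit)
  then show ?thesis by (rule iso_cancel_left[rotated -1]) simp_all
qed

end

section \<open>Words of objects acting on objects\<close>

text \<open>A word is a bracketed tensor product. Its evaluation \<open>ev\<close> keeps the brackets and the units,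
  whereas the action \<open>act\<close> on an object \<open>x\<close> tensors the letters onto \<open>x\<close> from the left, one at a time,
  and so depends only on the sequence of letters. The isomorphism
  \<open>canon w x : act w x \<rightarrow> ev w \<otimes> x\<close> compares the two.\<close>

datatype (letters: 'o) word = Empty | Letter 'o | Join "'o word" "'o word"

context sym_mon_cat
begin

primrec ev :: "'o word \<Rightarrow> 'o" where
  "ev Empty = \<one>"
| "ev (Letter a) = a"
| "ev (Join v w) = ev v \<otimes> ev w"

primrec act :: "'o word \<Rightarrow> 'o \<Rightarrow> 'o" where
  "act Empty x = x"
| "act (Letter a) x = a \<otimes> x"
| "act (Join v w) x = act v (act w x)"

primrec act_ar :: "'o word \<Rightarrow> 'm \<Rightarrow> 'm" where
  "act_ar Empty f = f"
| "act_ar (Letter a) f = ident C a \<diamondop> f"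
| "act_ar (Join v w) f = act_ar v (act_ar w f)"

primrec canon :: "'o word \<Rightarrow> 'o \<Rightarrow> 'm" where
  "canon Empty x = inv_ar C (lunit C x)"
| "canon (Letter a) x = ident C (a \<otimes> x)"
| "canon (Join v w) x = ass C (ev v) (ev w) x \<cdot> (ident C (ev v) \<diamondop> canon w x) \<cdot> canon v (act w x)"

definition wfw :: "'o word \<Rightarrow> bool" where
  "wfw w \<longleftrightarrow> letters w \<subseteq> Obj C"

lemma wfw_simps [simp]: "wfw Empty" "wfw (Letter a) \<longleftrightarrow> a \<in> Obj C" "wfw (Join v w) \<longleftrightarrow> wfw v \<and> wfw w"
  by (auto simp: wfw_def)

lemma ev_Obj [simp]: "wfw w \<Longrightarrow> ev w \<in> Obj C"
  by (induction w) auto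

lemma act_Obj [simp]: "\<lbrakk>wfw w; x \<in> Obj C\<rbrakk> \<Longrightarrow> act w x \<in> Obj C"
  by (induction w arbitrary: x) auto

lemma act_ar_type [simp]:
  assumes "wfw w" "f \<in> Arr C"
  shows "act_ar w f \<in> Arr C" "Dom C (act_ar w f) = act w (Dom C f)" "Cod C (act_ar w f) = act w (Cod C f)"
proof -
  have "act_ar w f \<in> Arr C \<and> Dom C (act_ar w f) = act w (Dom C f) \<and> Cod C (act_ar w f) = act w (Cod C f)"
    using assms by (induction w arbitrary: f) auto
  then show "act_ar w f \<in> Arr C" "Dom C (act_ar w f) = act w (Dom C f)" "Cod C (act_ar w f) = act w (Cod C f)"
    by auto
qed

lemma act_ar_ident [simp]: "\<lbrakk>wfw w; x \<in> Obj C\<rbrakk> \<Longrightarrow> act_ar w (ident C x) = ident C (act w x)"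
  by (induction w arbitrary: x) auto

lemma act_ar_comp:
  "\<lbrakk>wfw w; f \<in> Arr C; g \<in> Arr C; Dom C g = Cod C f\<rbrakk> \<Longrightarrow> act_ar w (g \<cdot> f) = act_ar w g \<cdot> act_ar w f"
  by (induction w arbitrary: f g) auto

lemma canon_type [simp]:
  assumes "wfw w" "x \<in> Obj C"
  shows "iso C (canon w x)" "canon w x \<in> Arr C" "Dom C (canon w x) = act w x" "Cod C (canon w x) = ev w \<otimes> x"
proof -
  have "iso C (canon w x) \<and> canon w x \<in> Arr C \<and> Dom C (canon w x) = act w x \<and> Cod C (canon w x) = ev w \<otimes> x"
    using assms by (induction w arbitrary: x) auto
  then show "iso C (canon w x)" "canon w x \<in> Arr C" "Dom C (canon w x) = act w x" "Cod C (canon w x) = ev w \<otimes> x"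
    by auto
qed

lemma canon_nat:
  "\<lbrakk>wfw w; f \<in> Arr C\<rbrakk>
   \<Longrightarrow> canon w (Cod C f) \<cdot> act_ar w f = (ident C (ev w) \<diamondop> f) \<cdot> canon w (Dom C f)"
proof (induction w arbitrary: f)
  case Empty
  note [simp] = Empty
  have "lunit C (Cod C f) \<cdot> canon Empty (Cod C f) \<cdot> act_ar Empty f
      = (f \<cdot> lunit C (Dom C f)) \<cdot> canon Empty (Dom C f)"
    by simp
  also have "\<dots> = (lunit C (Cod C f) \<cdot> (ident C \<one> \<diamondop> f)) \<cdot> canon Empty (Dom C f)"
    by (simp only: lunit_nat[OF Arr_hom[OF Empty(2)]])
  also have "\<dots> = lunit C (Cod C f) \<cdot> (ident C (ev Empty) \<diamondop> f) \<cdot> canon Empty (Dom C f)"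
    by simp
  finally show ?case by (rule iso_cancel_left[rotated -1]) simp_all
next
  case (Letter a)
  then show ?case by simp
next
  case (Join v w)
  then have [simp]: "wfw v" "wfw w" "f \<in> Arr C" by auto
  let ?v = "ident C (ev v)" and ?x = "Dom C f" and ?y = "Cod C f"
  have "canon (Join v w) ?y \<cdot> act_ar (Join v w) f
      = ass C (ev v) (ev w) ?y \<cdot> (?v \<diamondop> canon w ?y) \<cdot> (canon v (act w ?y) \<cdot> act_ar v (act_ar w f))"
    by simp
  also have "\<dots> = ass C (ev v) (ev w) ?y \<cdot> (?v \<diamondop> canon w ?y) \<cdot> ((?v \<diamondop> act_ar w f) \<cdot> canon v (act w ?x))"
    using Join.IH(1)[of "act_ar w f"] by simp
  also have "\<dots> = ass C (ev v) (ev w) ?y \<cdot> (?v \<diamondop> (canon w ?y \<cdot> act_ar w f)) \<cdot> canon v (act w ?x)"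
    by simp
  also have "\<dots> = ass C (ev v) (ev w) ?y \<cdot> (?v \<diamondop> ((ident C (ev w) \<diamondop> f) \<cdot> canon w ?x)) \<cdot> canon v (act w ?x)"
    using Join.IH(2)[of f] by simp
  also have "\<dots> = (ass C (ev v) (ev w) ?y \<cdot> (?v \<diamondop> (ident C (ev w) \<diamondop> f))) \<cdot> (?v \<diamondop> canon w ?x) \<cdot> canon v (act w ?x)"
    by simp
  also have "\<dots> = (((?v \<diamondop> ident C (ev w)) \<diamondop> f) \<cdot> ass C (ev v) (ev w) ?x) \<cdot> (?v \<diamondop> canon w ?x) \<cdot> canon v (act w ?x)"
    using ass_nat_simp[of ?v "ident C (ev w)" f] by simp
  also have "\<dots> = (ident C (ev (Join v w)) \<diamondop> f) \<cdot> canon (Join v w) ?x"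
    by simp
  finally show ?case .
qed

text \<open>Here \<open>\<phi>\<close> is the family \<open>f \<otimes> x\<close> transported along \<open>canon\<close>. Although \<open>\<phi>\<close> is determined by \<open>f\<close>, it
  is kept as an argument of a relation, so that the rules below compute it in closed form along the
  structure of \<open>f\<close>.\<close>

definition reads :: "'o word \<Rightarrow> 'o word \<Rightarrow> 'm \<Rightarrow> ('o \<Rightarrow> 'm) \<Rightarrow> bool" where
  "reads w v f \<phi> \<longleftrightarrow> wfw w \<and> wfw v \<and> f \<in> hom C (ev w) (ev v) \<and>
     (\<forall>x\<in>Obj C. \<phi> x \<in> hom C (act w x) (act v x) \<and> canon v x \<cdot> \<phi> x = (f \<diamondop> ident C x) \<cdot> canon w x)"

lemma readsD:
  assumes "reads w v f \<phi>"
  shows "wfw w" "wfw v" "f \<in> Arr C" "Dom C f = ev w" "Cod C f = ev v"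
    "x \<in> Obj C \<Longrightarrow> \<phi> x \<in> Arr C" "x \<in> Obj C \<Longrightarrow> Dom C (\<phi> x) = act w x" "x \<in> Obj C \<Longrightarrow> Cod C (\<phi> x) = act v x"
    "x \<in> Obj C \<Longrightarrow> canon v x \<cdot> \<phi> x = (f \<diamondop> ident C x) \<cdot> canon w x"
  using assms by (auto simp: reads_def hom_def)

text \<open>It suffices to compare the readings at \<open>x = I\<close>, because \<open>- \<otimes> I\<close> is faithful.\<close>

lemma reads_eqI:
  assumes f: "reads w v f \<phi>" and g: "reads w v g \<psi>" and eq: "\<And>x. x \<in> Obj C \<Longrightarrow> \<phi> x = \<psi> x"
  shows "f = g"
proof (rule ten_unit_faithful)
  note [simp] = readsD[OF f] readsD(3-5)[OF g]
  have "(f \<diamondop> ident C \<one>) \<cdot> canon w \<one> = (g \<diamondop> ident C \<one>) \<cdot> canon w \<one>"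
    using readsD(9)[OF f unit_Obj] readsD(9)[OF g unit_Obj] eq[OF unit_Obj] by metis
  then show "f \<diamondop> ident C \<one> = g \<diamondop> ident C \<one>"
    by (rule iso_cancel_right[rotated -1]) simp_all
qed (simp_all add: readsD[OF f] readsD(3-5)[OF g])

text \<open>A reading inherits naturality in \<open>x\<close> from \<open>f \<otimes> x\<close> and from \<open>canon\<close>.\<close>

lemma reads_nat:
  assumes f: "reads w v f \<phi>" and h[simp]: "h \<in> Arr C"
  shows "\<phi> (Cod C h) \<cdot> act_ar w h = act_ar v h \<cdot> \<phi> (Dom C h)"
proof -
  note [simp] = readsD(1-8)[OF f]
  let ?x = "Dom C h" and ?y = "Cod C h"
  have "canon v ?y \<cdot> (\<phi> ?y \<cdot> act_ar w h) = (canon v ?y \<cdot> \<phi> ?y) \<cdot> act_ar w h" by simp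
  also have "\<dots> = (f \<diamondop> ident C ?y) \<cdot> (canon w ?y \<cdot> act_ar w h)" by (subst readsD(9)[OF f]) simp_all
  also have "\<dots> = (f \<diamondop> ident C ?y) \<cdot> ((ident C (ev w) \<diamondop> h) \<cdot> canon w ?x)" by (subst canon_nat) simp_all
  also have "\<dots> = (ident C (ev v) \<diamondop> h) \<cdot> ((f \<diamondop> ident C ?x) \<cdot> canon w ?x)" by simp
  also have "\<dots> = (ident C (ev v) \<diamondop> h) \<cdot> (canon v ?x \<cdot> \<phi> ?x)" by (subst readsD(9)[OF f]) simp_all
  also have "\<dots> = ((ident C (ev v) \<diamondop> h) \<cdot> canon v ?x) \<cdot> \<phi> ?x" by simp
  also have "\<dots> = (canon v ?y \<cdot> act_ar v h) \<cdot> \<phi> ?x" by (subst canon_nat) simp_all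
  also have "\<dots> = canon v ?y \<cdot> (act_ar v h \<cdot> \<phi> ?x)" by simp
  finally show ?thesis by (rule iso_cancel_left[rotated -1]) simp_all
qed

lemma reads_ident: "wfw w \<Longrightarrow> reads w w (ident C (ev w)) (\<lambda>x. ident C (act w x))"
  by (simp add: reads_def hom_def)

lemma reads_comp:
  assumes g: "reads v u g \<psi>" and f: "reads w v f \<phi>"
  shows "reads w u (g \<cdot> f) (\<lambda>x. \<psi> x \<cdot> \<phi> x)"
  unfolding reads_def
proof (intro conjI ballI)
  note [simp] = readsD(1-8)[OF f] readsD(1-8)[OF g]
  fix x assume [simp]: "x \<in> Obj C"
  show "\<psi> x \<cdot> \<phi> x \<in> hom C (act w x) (act u x)" by (simp add: hom_def)
  have "canon u x \<cdot> \<psi> x \<cdot> \<phi> x = (canon u x \<cdot> \<psi> x) \<cdot> \<phi> x" by simp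
  also have "\<dots> = (g \<diamondop> ident C x) \<cdot> (canon v x \<cdot> \<phi> x)" by (subst readsD(9)[OF g]) simp_all
  also have "\<dots> = (g \<diamondop> ident C x) \<cdot> ((f \<diamondop> ident C x) \<cdot> canon w x)" by (subst readsD(9)[OF f]) simp_all
  finally show "canon u x \<cdot> \<psi> x \<cdot> \<phi> x = ((g \<cdot> f) \<diamondop> ident C x) \<cdot> canon w x" by simp
qed (simp_all add: hom_def readsD[OF f] readsD[OF g])

text \<open>A concatenated word acts by composition, so that the tensor of two arrows is read as the
  horizontal composite of two natural families. The right factor is applied first.\<close>

lemma reads_ten:
  assumes f: "reads w w' f \<phi>" and g: "reads v v' g \<psi>"
  shows "reads (Join w v) (Join w' v') (f \<diamondop> g) (\<lambda>x. \<phi> (act v' x) \<cdot> act_ar w (\<psi> x))"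
  unfolding reads_def
proof (intro conjI ballI)
  note [simp] = readsD(1-8)[OF f] readsD(1-8)[OF g]
  fix x assume [simp]: "x \<in> Obj C"
  show "\<phi> (act v' x) \<cdot> act_ar w (\<psi> x) \<in> hom C (act (Join w v) x) (act (Join w' v') x)" by (simp add: hom_def)
  let ?x = "ident C x" and ?w = "ident C (ev w)"
  let ?a = "ass C (ev w) (ev v) x" and ?a' = "ass C (ev w') (ev v') x"
  have "canon (Join w' v') x \<cdot> \<phi> (act v' x) \<cdot> act_ar w (\<psi> x)
      = ?a' \<cdot> (ident C (ev w') \<diamondop> canon v' x) \<cdot> (canon w' (act v' x) \<cdot> \<phi> (act v' x)) \<cdot> act_ar w (\<psi> x)"
    by simp
  also have "\<dots> = ?a' \<cdot> (ident C (ev w') \<diamondop> canon v' x) \<cdot> (f \<diamondop> ident C (act v' x)) \<cdot> (canon w (act v' x) \<cdot> act_ar w (\<psi> x))"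
    by (subst readsD(9)[OF f]) simp_all
  also have "canon w (act v' x) \<cdot> act_ar w (\<psi> x) = (?w \<diamondop> \<psi> x) \<cdot> canon w (act v x)"
    using canon_nat[of w "\<psi> x"] by simp
  also have "?a' \<cdot> (ident C (ev w') \<diamondop> canon v' x) \<cdot> (f \<diamondop> ident C (act v' x)) \<cdot> (?w \<diamondop> \<psi> x) \<cdot> canon w (act v x)
     = ?a' \<cdot> (f \<diamondop> (canon v' x \<cdot> \<psi> x)) \<cdot> canon w (act v x)"
    by simp
  also have "\<dots> = ?a' \<cdot> (f \<diamondop> ((g \<diamondop> ?x) \<cdot> canon v x)) \<cdot> canon w (act v x)"
    by (subst readsD(9)[OF g]) simp_all
  also have "\<dots> = (?a' \<cdot> (f \<diamondop> (g \<diamondop> ?x))) \<cdot> (?w \<diamondop> canon v x) \<cdot> canon w (act v x)"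
    by simp
  also have "\<dots> = (((f \<diamondop> g) \<diamondop> ?x) \<cdot> ?a) \<cdot> (?w \<diamondop> canon v x) \<cdot> canon w (act v x)"
    using ass_nat_simp[of f g ?x] by simp
  finally show "canon (Join w' v') x \<cdot> \<phi> (act v' x) \<cdot> act_ar w (\<psi> x) = ((f \<diamondop> g) \<diamondop> ?x) \<cdot> canon (Join w v) x"
    by simp
qed (simp_all add: hom_def readsD[OF f] readsD[OF g])

text \<open>A one-sided inverse of the reading is enough, since \<open>f\<close> is already known to be invertible.\<close>

lemma reads_inv:
  assumes f: "reads w v f \<phi>" and iso[simp]: "iso C f"
    and \<psi>: "\<And>x. x \<in> Obj C \<Longrightarrow> \<psi> x \<in> hom C (act v x) (act w x)" "\<And>x. x \<in> Obj C \<Longrightarrow> \<phi> x \<cdot> \<psi> x = ident C (act v x)"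
  shows "reads v w (inv_ar C f) \<psi>"
  unfolding reads_def
proof (intro conjI ballI)
  note [simp] = readsD(1-8)[OF f]
  fix x assume [simp]: "x \<in> Obj C"
  show "\<psi> x \<in> hom C (act v x) (act w x)" by (rule \<psi>) simp
  then have [simp]: "\<psi> x \<in> Arr C" "Dom C (\<psi> x) = act v x" "Cod C (\<psi> x) = act w x" by (auto simp: hom_def)
  let ?x = "ident C x"
  have "(f \<diamondop> ?x) \<cdot> canon w x \<cdot> \<psi> x = ((f \<diamondop> ?x) \<cdot> canon w x) \<cdot> \<psi> x" by simp
  also have "\<dots> = canon v x \<cdot> (\<phi> x \<cdot> \<psi> x)" by (subst readsD(9)[OF f, symmetric]) simp_all
  also have "\<dots> = canon v x" by (simp add: \<psi>)
  also have "\<dots> = (f \<diamondop> ?x) \<cdot> (inv_ar C f \<diamondop> ?x) \<cdot> canon v x" by simp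
  finally show "canon w x \<cdot> \<psi> x = (inv_ar C f \<diamondop> ?x) \<cdot> canon v x"
    by (rule iso_cancel_left[rotated -1]) simp_all
qed (simp_all add: hom_def readsD[OF f])

text \<open>Both bracketings of \<open>u, v, w\<close> act in the same way, and the pentagon for \<open>u, v, w, x\<close> says that
  the associativity arrow is compatible with the two isomorphisms \<open>canon\<close>.\<close>

lemma reads_ass:
  assumes [simp]: "wfw u" "wfw v" "wfw w"
  shows "reads (Join u (Join v w)) (Join (Join u v) w) (ass C (ev u) (ev v) (ev w))
     (\<lambda>x. ident C (act u (act v (act w x))))"
  unfolding reads_def
proof (intro conjI ballI)
  fix x assume [simp]: "x \<in> Obj C"
  show "ident C (act u (act v (act w x))) \<in> hom C (act (Join u (Join v w)) x) (act (Join (Join u v) w) x)"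
    by (simp add: hom_def)
  let ?u = "ev u" and ?v = "ev v" and ?w = "ev w" and ?i = "ident C (ev u)"
  let ?k = "(?i \<diamondop> canon v (act w x)) \<cdot> canon u (act v (act w x))"
  have "(ass C ?u ?v ?w \<diamondop> ident C x) \<cdot> canon (Join u (Join v w)) x
      = ((ass C ?u ?v ?w \<diamondop> ident C x) \<cdot> ass C ?u (?v \<otimes> ?w) x \<cdot> (?i \<diamondop> ass C ?v ?w x)) \<cdot>
        (?i \<diamondop> (ident C ?v \<diamondop> canon w x)) \<cdot> ?k"
    by simp
  also have "\<dots> = (ass C (?u \<otimes> ?v) ?w x \<cdot> ass C ?u ?v (?w \<otimes> x)) \<cdot> (?i \<diamondop> (ident C ?v \<diamondop> canon w x)) \<cdot> ?k"
    by (subst pentagon) simp_all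
  also have "\<dots> = ass C (?u \<otimes> ?v) ?w x \<cdot> (ass C ?u ?v (?w \<otimes> x) \<cdot> (?i \<diamondop> (ident C ?v \<diamondop> canon w x))) \<cdot> ?k"
    by simp
  also have "ass C ?u ?v (?w \<otimes> x) \<cdot> (?i \<diamondop> (ident C ?v \<diamondop> canon w x))
      = ((?i \<diamondop> ident C ?v) \<diamondop> canon w x) \<cdot> ass C ?u ?v (act w x)"
    using ass_nat_simp[of ?i "ident C ?v" "canon w x"] by simp
  also have "ass C (?u \<otimes> ?v) ?w x \<cdot> (((?i \<diamondop> ident C ?v) \<diamondop> canon w x) \<cdot> ass C ?u ?v (act w x)) \<cdot> ?k
      = canon (Join (Join u v) w) x \<cdot> ident C (act u (act v (act w x)))"
    by simp
  finally show "canon (Join (Join u v) w) x \<cdot> ident C (act u (act v (act w x)))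
     = (ass C ?u ?v ?w \<diamondop> ident C x) \<cdot> canon (Join u (Join v w)) x" by (rule sym)
qed (simp_all add: hom_def)

text \<open>For the right unit the compatibility with \<open>canon\<close> is the triangle; for the left unit it is Kelly's
  lemma.\<close>

lemma reads_runit:
  assumes [simp]: "wfw w"
  shows "reads (Join w Empty) w (runit C (ev w)) (\<lambda>x. ident C (act w x))"
  unfolding reads_def
proof (intro conjI ballI)
  fix x assume [simp]: "x \<in> Obj C"
  show "ident C (act w x) \<in> hom C (act (Join w Empty) x) (act w x)"
    by (simp add: hom_def)
  have "(runit C (ev w) \<diamondop> ident C x) \<cdot> canon (Join w Empty) x
      = ((runit C (ev w) \<diamondop> ident C x) \<cdot> ass C (ev w) \<one> x) \<cdot> (ident C (ev w) \<diamondop> inv_ar C (lunit C x)) \<cdot> canon w x"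
    by simp
  also have "\<dots> = canon w x \<cdot> ident C (act w x)"
    by (subst triangle) simp_all
  finally show "canon w x \<cdot> ident C (act w x) = (runit C (ev w) \<diamondop> ident C x) \<cdot> canon (Join w Empty) x"
    by (rule sym)
qed (simp_all add: hom_def)

lemma reads_lunit:
  assumes [simp]: "wfw w"
  shows "reads (Join Empty w) w (lunit C (ev w)) (\<lambda>x. ident C (act w x))"
  unfolding reads_def
proof (intro conjI ballI)
  fix x assume [simp]: "x \<in> Obj C"
  show "ident C (act w x) \<in> hom C (act (Join Empty w) x) (act w x)"
    by (simp add: hom_def)
  have "(lunit C (ev w) \<diamondop> ident C x) \<cdot> canon (Join Empty w) x
      = ((lunit C (ev w) \<diamondop> ident C x) \<cdot> ass C \<one> (ev w) x) \<cdot> (ident C \<one> \<diamondop> canon w x) \<cdot> inv_ar C (lunit C (act w x))"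
    by simp
  also have "\<dots> = (lunit C (ev w \<otimes> x) \<cdot> (ident C \<one> \<diamondop> canon w x)) \<cdot> inv_ar C (lunit C (act w x))"
    by (subst lunit_ten) simp_all
  also have "\<dots> = (canon w x \<cdot> lunit C (act w x)) \<cdot> inv_ar C (lunit C (act w x))"
    using lunit_nat[OF Arr_hom, of "canon w x"] by simp
  also have "\<dots> = canon w x \<cdot> ident C (act w x)" by simp
  finally show "canon w x \<cdot> ident C (act w x) = (lunit C (ev w) \<diamondop> ident C x) \<cdot> canon (Join Empty w) x"
    by (rule sym)
qed (simp_all add: hom_def)

lemma reads_unique:
  assumes f: "reads w v f \<phi>" and g: "reads w v f \<psi>" and [simp]: "x \<in> Obj C"
  shows "\<phi> x = \<psi> x"
  by (rule iso_cancel_left[of "canon v x"]) (simp_all add: readsD[OF f] readsD(6-9)[OF g])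

lemma reads_cong:
  "\<lbrakk>reads w v f \<phi>; f = g; \<And>x. x \<in> Obj C \<Longrightarrow> \<phi> x = \<psi> x\<rbrakk> \<Longrightarrow> reads w v g \<psi>"
  by (simp add: reads_def)

lemma reads_inv_of_ident:
  assumes f: "reads w v f (\<lambda>x. ident C (act w x))" and iso: "iso C f"
  shows "reads v w (inv_ar C f) (\<lambda>x. ident C (act w x))"
proof (rule reads_inv[OF f iso])
  fix x assume [simp]: "x \<in> Obj C"
  note [simp] = readsD(1,2)[OF f]
  have "act v x = act w x" using readsD(8)[OF f, of x] by simp
  then show "ident C (act w x) \<in> hom C (act v x) (act w x)"
    "ident C (act w x) \<cdot> ident C (act w x) = ident C (act v x)" by (simp_all add: hom_def)
qed

lemma reads_ass_inv:
  assumes [simp]: "wfw u" "wfw v" "wfw w"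
  shows "reads (Join (Join u v) w) (Join u (Join v w)) (inv_ar C (ass C (ev u) (ev v) (ev w)))
     (\<lambda>x. ident C (act u (act v (act w x))))"
  using reads_inv_of_ident[of "Join u (Join v w)"] reads_ass[of u v w] by simp

section \<open>Reading symmetries and interchanges\<close>

text \<open>The reading of the symmetry of two letters.\<close>

definition shuffle :: "'o \<Rightarrow> 'o \<Rightarrow> 'o \<Rightarrow> 'm" where
  "shuffle a b x = inv_ar C (ass C b a x) \<cdot> (swap C a b \<diamondop> ident C x) \<cdot> ass C a b x"

lemma shuffle_type [simp]:
  assumes "a \<in> Obj C" "b \<in> Obj C" "x \<in> Obj C"
  shows "shuffle a b x \<in> Arr C" "Dom C (shuffle a b x) = a \<otimes> (b \<otimes> x)" "Cod C (shuffle a b x) = b \<otimes> (a \<otimes> x)"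
  using assms by (simp_all add: shuffle_def)

lemma reads_swap_letters:
  "\<lbrakk>a \<in> Obj C; b \<in> Obj C\<rbrakk>
   \<Longrightarrow> reads (Join (Letter a) (Letter b)) (Join (Letter b) (Letter a)) (swap C a b) (shuffle a b)"
  by (auto simp: reads_def hom_def) (simp add: shuffle_def)

text \<open>Both families are readings of \<open>s\<^bsub>b,a\<^esub> \<circ> s\<^bsub>a,b\<^esub> = 1\<close>, and readings are unique.\<close>

lemma shuffle_shuffle:
  assumes "a \<in> Obj C" "b \<in> Obj C" "x \<in> Obj C"
  shows "shuffle b a x \<cdot> shuffle a b x = ident C (a \<otimes> (b \<otimes> x))"
  using reads_unique[OF reads_comp[OF reads_swap_letters[of b a] reads_swap_letters[of a b]], of "\<lambda>x. ident C (a \<otimes> (b \<otimes> x))" x]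
    reads_ident[of "Join (Letter a) (Letter b)"] assms by simp

lemma shuffle_nat:
  "\<lbrakk>a \<in> Obj C; b \<in> Obj C; h \<in> Arr C\<rbrakk>
   \<Longrightarrow> shuffle a b (Cod C h) \<cdot> (ident C a \<diamondop> (ident C b \<diamondop> h))
       = (ident C b \<diamondop> (ident C a \<diamondop> h)) \<cdot> shuffle a b (Dom C h)"
  using reads_nat[OF reads_swap_letters[of a b], of h] by simp

text \<open>The hexagon expresses the symmetry of \<open>u \<otimes> v\<close> and \<open>w\<close> through associativity arrows, which are read
  as identities, and the symmetries of \<open>v, w\<close> and of \<open>u, w\<close>: first \<open>w\<close> moves past \<open>v\<close>, then past
  \<open>u\<close>.\<close>

lemma reads_swap_left:
  assumes f: "reads (Join u w) (Join w u) (swap C (ev u) (ev w)) \<phi>"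
    and g: "reads (Join v w) (Join w v) (swap C (ev v) (ev w)) \<psi>"
  shows "reads (Join (Join u v) w) (Join w (Join u v)) (swap C (ev u \<otimes> ev v) (ev w))
           (\<lambda>x. \<phi> (act v x) \<cdot> act_ar u (\<psi> x))"
proof -
  have [simp]: "wfw u" "wfw v" "wfw w" using readsD(1,2)[OF f] readsD(1,2)[OF g] by auto
  note [simp] = readsD(6-8)[OF f] readsD(6-8)[OF g]
  let ?u = "ev u" and ?v = "ev v" and ?w = "ev w"
  let ?m = "(swap C ?u ?w \<diamondop> ident C ?v) \<cdot> ass C ?u ?w ?v \<cdot> (ident C ?u \<diamondop> swap C ?v ?w)"
  have "inv_ar C (ass C ?w ?u ?v) \<cdot> ?m \<cdot> inv_ar C (ass C ?u ?v ?w)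
     = inv_ar C (ass C ?w ?u ?v) \<cdot> (ass C ?w ?u ?v \<cdot> swap C (?u \<otimes> ?v) ?w \<cdot> ass C ?u ?v ?w) \<cdot> inv_ar C (ass C ?u ?v ?w)"
    by (subst hexagon) simp_all
  also have "\<dots> = swap C (?u \<otimes> ?v) ?w" by simp
  finally have eq: "inv_ar C (ass C ?w ?u ?v) \<cdot> ?m \<cdot> inv_ar C (ass C ?u ?v ?w) = swap C (?u \<otimes> ?v) ?w" .
  show ?thesis
    by (rule reads_cong[OF reads_comp[OF reads_ass_inv[of w u v] reads_comp[OF
      reads_comp[OF reads_ten[OF f reads_ident[of v]] reads_comp[OF reads_ass[of u w v] reads_ten[OF reads_ident[of u] g]]]
      reads_ass_inv[of u v w]]] eq]) simp_all
qed

text \<open>The symmetry of \<open>u\<close> and \<open>v \<otimes> w\<close> is the inverse of the symmetry of \<open>v \<otimes> w\<close> and \<open>u\<close>, so this is the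
  preceding rule with all arrows inverted; \<open>\<phi>'\<close> and \<open>\<psi>'\<close> are the inverses of \<open>\<phi>\<close> and \<open>\<psi>\<close>.\<close>

lemma reads_swap_right:
  assumes f: "reads (Join u v) (Join v u) (swap C (ev u) (ev v)) \<phi>" "reads (Join v u) (Join u v) (swap C (ev v) (ev u)) \<phi>'"
    and g: "reads (Join u w) (Join w u) (swap C (ev u) (ev w)) \<psi>" "reads (Join w u) (Join u w) (swap C (ev w) (ev u)) \<psi>'"
  shows "reads (Join u (Join v w)) (Join (Join v w) u) (swap C (ev u) (ev v \<otimes> ev w))
           (\<lambda>x. act_ar v (\<psi> x) \<cdot> \<phi> (act w x))"
proof -
  have [simp]: "wfw u" "wfw v" "wfw w" using readsD(1,2)[OF f(1)] readsD(1,2)[OF g(1)] by auto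
  note [simp] = readsD(6-8)[OF f(1)] readsD(6-8)[OF f(2)] readsD(6-8)[OF g(1)] readsD(6-8)[OF g(2)]
  have i1: "\<phi>' x \<cdot> \<phi> x = ident C (act u (act v x))" if [simp]: "x \<in> Obj C" for x
    using reads_unique[OF reads_comp[OF f(2,1)], of "\<lambda>x. ident C (act u (act v x))" x] reads_ident[of "Join u v"] by simp
  have i2: "\<psi>' x \<cdot> \<psi> x = ident C (act u (act w x))" if [simp]: "x \<in> Obj C" for x
    using reads_unique[OF reads_comp[OF g(2,1)], of "\<lambda>x. ident C (act u (act w x))" x] reads_ident[of "Join u w"] by simp
  have "reads (Join u (Join v w)) (Join (Join v w) u) (inv_ar C (swap C (ev v \<otimes> ev w) (ev u)))
           (\<lambda>x. act_ar v (\<psi> x) \<cdot> \<phi> (act w x))"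
  proof (rule reads_inv[OF reads_swap_left[OF f(2) g(2)]])
    fix x assume [simp]: "x \<in> Obj C"
    show "act_ar v (\<psi> x) \<cdot> \<phi> (act w x) \<in> hom C (act (Join u (Join v w)) x) (act (Join (Join v w) u) x)"
      by (simp add: hom_def)
    have "(\<phi>' (act w x) \<cdot> act_ar v (\<psi>' x)) \<cdot> act_ar v (\<psi> x) \<cdot> \<phi> (act w x)
        = \<phi>' (act w x) \<cdot> (act_ar v (\<psi>' x) \<cdot> act_ar v (\<psi> x)) \<cdot> \<phi> (act w x)" by simp
    also have "\<dots> = \<phi>' (act w x) \<cdot> act_ar v (\<psi>' x \<cdot> \<psi> x) \<cdot> \<phi> (act w x)" by (subst act_ar_comp) simp_all
    also have "\<dots> = ident C (act (Join u (Join v w)) x)" by (simp add: i1 i2)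
    finally show "(\<phi>' (act w x) \<cdot> act_ar v (\<psi>' x)) \<cdot> act_ar v (\<psi> x) \<cdot> \<phi> (act w x) = ident C (act (Join u (Join v w)) x)" .
  qed simp
  then show ?thesis by simp
qed

text \<open>The symmetry with \<open>I\<close> equals \<open>l\<inverse> \<circ> r\<close>, and both factors are read as identities.\<close>

lemma reads_swap_unit_right:
  assumes [simp]: "wfw w"
  shows "reads (Join w Empty) (Join Empty w) (swap C (ev w) \<one>) (\<lambda>x. ident C (act w x))"
proof -
  have "inv_ar C (lunit C (ev w)) \<cdot> runit C (ev w) = inv_ar C (lunit C (ev w)) \<cdot> lunit C (ev w) \<cdot> swap C (ev w) \<one>"
    by (subst swap_unit) simp_all
  then have eq: "inv_ar C (lunit C (ev w)) \<cdot> runit C (ev w) = swap C (ev w) \<one>" by simp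
  have "reads w (Join Empty w) (inv_ar C (lunit C (ev w))) (\<lambda>x. ident C (act w x))"
    using reads_inv_of_ident[of "Join Empty w" w] reads_lunit[of w] by simp
  from reads_comp[OF this reads_runit[OF assms]] show ?thesis
    by (rule reads_cong[OF _ eq]) simp
qed

lemma reads_swap_unit_left:
  assumes [simp]: "wfw w"
  shows "reads (Join Empty w) (Join w Empty) (swap C \<one> (ev w)) (\<lambda>x. ident C (act w x))"
  using reads_inv_of_ident[of "Join w Empty" "Join Empty w" "swap C (ev w) \<one>"] reads_swap_unit_right[of w] by simp

text \<open>Of the five factors of the interchange, only the symmetry in the middle has a reading other than
  the identity. It acts behind \<open>u\<close> and in front of \<open>z\<close>.\<close>

lemma reads_interchange:
  assumes f: "reads (Join v w) (Join w v) (swap C (ev v) (ev w)) \<phi>" and [simp]: "wfw u" "wfw z"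
  shows "reads (Join (Join u v) (Join w z)) (Join (Join u w) (Join v z)) (interchange C (ev u) (ev v) (ev w) (ev z))
     (\<lambda>x. act_ar u (\<phi> (act z x)))"
proof -
  have wf[simp]: "wfw v" "wfw w" using readsD(1,2)[OF f] by auto
  note [simp] = readsD(6-8)[OF f]
  show ?thesis unfolding interchange_def
    by (rule reads_cong[OF reads_comp[OF reads_ass_inv[of "Join u w" v z] reads_comp[OF
        reads_ten[OF reads_ass[of u w v] reads_ident[of z]] reads_comp[OF
        reads_ten[OF reads_ten[OF reads_ident[of u] f] reads_ident[of z]] reads_comp[OF
        reads_ten[OF reads_ass_inv[of u v w] reads_ident[of z]]
        reads_ass[of "Join u v" w z]]]]]]) simp_all
qed

section \<open>Coherence of the interchange\<close>

lemma interchange_type [simp]: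
  assumes "w \<in> Obj C" "x \<in> Obj C" "y \<in> Obj C" "z \<in> Obj C"
  shows "interchange C w x y z \<in> Arr C" "Dom C (interchange C w x y z) = (w \<otimes> x) \<otimes> (y \<otimes> z)"
    "Cod C (interchange C w x y z) = (w \<otimes> y) \<otimes> (x \<otimes> z)"
  using assms by (simp_all add: interchange_def)

lemma interchange_interchange:
  assumes [simp]: "w \<in> Obj C" "x \<in> Obj C" "y \<in> Obj C" "z \<in> Obj C"
  shows "interchange C w y x z \<cdot> interchange C w x y z = ident C ((w \<otimes> x) \<otimes> (y \<otimes> z))"
proof -
  let ?w = "Letter w" and ?x = "Letter x" and ?y = "Letter y" and ?z = "Letter z"
  have i: "reads (Join (Join ?w a) (Join b ?z)) (Join (Join ?w b) (Join a ?z)) (interchange C w (ev a) (ev b) z)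
      (\<lambda>t. ident C w \<diamondop> \<phi> (z \<otimes> t))"
    if "reads (Join a b) (Join b a) (swap C (ev a) (ev b)) \<phi>" for a b \<phi>
    using reads_interchange[OF that, of ?w ?z] by simp
  show ?thesis
    using reads_eqI[OF reads_comp[OF i i] reads_ident[of "Join (Join ?w ?x) (Join ?y ?z)"], of "shuffle y x" "shuffle x y"]
      reads_swap_letters[of x y] reads_swap_letters[of y x] by (simp add: shuffle_shuffle)
qed

text \<open>The square has \<open>f\<close> and \<open>g\<close> as vertical and \<open>y\<close> and \<open>x\<close> as horizontal sides, so that naturality of
  \<open>t : R \<rightarrow> S\<close> at \<open>f : a \<rightarrow> a'\<close> is \<open>square (t a') (R f) (S f) (t a)\<close>. Such squares paste along composition and tensor
  and can be inverted; this reduces naturality of composite families to that of their factors.\<close>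

definition square :: "'m \<Rightarrow> 'm \<Rightarrow> 'm \<Rightarrow> 'm \<Rightarrow> bool" where
  "square x f g y \<longleftrightarrow> x \<in> Arr C \<and> f \<in> Arr C \<and> g \<in> Arr C \<and> y \<in> Arr C \<and>
     Dom C x = Cod C f \<and> Dom C g = Cod C y \<and> Dom C f = Dom C y \<and> Cod C x = Cod C g \<and> x \<cdot> f = g \<cdot> y"

lemma square_comp:
  assumes 1: "square x' g h y'" and 2: "square x f g y"
  shows "square (x' \<cdot> x) f h (y' \<cdot> y)"
proof -
  have t[simp]: "x' \<in> Arr C" "g \<in> Arr C" "h \<in> Arr C" "y' \<in> Arr C" "Dom C x' = Cod C g" "Dom C h = Cod C y'"
    "Dom C g = Dom C y'" "Cod C x' = Cod C h" "x \<in> Arr C" "f \<in> Arr C" "y \<in> Arr C" "Dom C x = Cod C f"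
    "Dom C y' = Cod C y" "Dom C f = Dom C y" "Cod C x = Cod C g"
    and e: "x' \<cdot> g = h \<cdot> y'" "x \<cdot> f = g \<cdot> y"
    using 1 2 by (auto simp: square_def)
  have "(x' \<cdot> x) \<cdot> f = x' \<cdot> (x \<cdot> f)" by simp
  also have "\<dots> = (x' \<cdot> g) \<cdot> y" by (simp only: e(2)) simp
  also have "\<dots> = h \<cdot> (y' \<cdot> y)" by (simp only: e(1)) simp
  finally show ?thesis by (simp add: square_def)
qed

lemma square_ten:
  assumes 1: "square x f g y" and 2: "square x' f' g' y'"
  shows "square (x \<diamondop> x') (f \<diamondop> f') (g \<diamondop> g') (y \<diamondop> y')"
  using assms by (auto simp: square_def)

lemma square_inv:
  assumes 1: "square x f g y" and [simp]: "iso C x" "iso C y"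
  shows "square (inv_ar C x) g f (inv_ar C y)"
proof -
  have t[simp]: "x \<in> Arr C" "f \<in> Arr C" "g \<in> Arr C" "y \<in> Arr C"
     "Dom C x = Cod C f" "Dom C g = Cod C y" "Dom C f = Dom C y" "Cod C x = Cod C g" and e: "x \<cdot> f = g \<cdot> y"
    using 1 by (auto simp: square_def)
  have "inv_ar C x \<cdot> g = inv_ar C x \<cdot> (g \<cdot> y) \<cdot> inv_ar C y" by simp
  also have "\<dots> = f \<cdot> inv_ar C y" by (subst e[symmetric]) simp
  finally show ?thesis by (simp add: square_def)
qed

lemma square_ident: "f \<in> Arr C \<Longrightarrow> square (ident C (Cod C f)) f f (ident C (Dom C f))"
  by (simp add: square_def)

lemma square_ass:
  "\<lbrakk>f \<in> Arr C; g \<in> Arr C; h \<in> Arr C\<rbrakk>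
   \<Longrightarrow> square (ass C (Cod C f) (Cod C g) (Cod C h)) (f \<diamondop> (g \<diamondop> h)) ((f \<diamondop> g) \<diamondop> h) (ass C (Dom C f) (Dom C g) (Dom C h))"
  by (simp add: square_def ass_nat_simp)

lemma square_swap:
  "\<lbrakk>f \<in> Arr C; g \<in> Arr C\<rbrakk>
   \<Longrightarrow> square (swap C (Cod C f) (Cod C g)) (f \<diamondop> g) (g \<diamondop> f) (swap C (Dom C f) (Dom C g))"
  by (simp add: square_def swap_nat[OF Arr_hom Arr_hom])

lemma interchange_nat:
  assumes [simp]: "f \<in> Arr C" "g \<in> Arr C" "h \<in> Arr C" "k \<in> Arr C"
  shows "interchange C (Cod C f) (Cod C g) (Cod C h) (Cod C k) \<cdot> ((f \<diamondop> g) \<diamondop> (h \<diamondop> k))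
     = ((f \<diamondop> h) \<diamondop> (g \<diamondop> k)) \<cdot> interchange C (Dom C f) (Dom C g) (Dom C h) (Dom C k)"
proof -
  have s1: "square (inv_ar C (ass C (Cod C f \<otimes> Cod C h) (Cod C g) (Cod C k))) (((f \<diamondop> h) \<diamondop> g) \<diamondop> k)
       ((f \<diamondop> h) \<diamondop> (g \<diamondop> k)) (inv_ar C (ass C (Dom C f \<otimes> Dom C h) (Dom C g) (Dom C k)))"
    using square_inv[OF square_ass[of "f \<diamondop> h" g k]] by simp
  have s2: "square (inv_ar C (ass C (Cod C f) (Cod C g) (Cod C h))) ((f \<diamondop> g) \<diamondop> h)
       (f \<diamondop> (g \<diamondop> h)) (inv_ar C (ass C (Dom C f) (Dom C g) (Dom C h)))"
    using square_inv[OF square_ass[of f g h]] by simp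
  have s3: "square (ass C (Cod C f \<otimes> Cod C g) (Cod C h) (Cod C k)) ((f \<diamondop> g) \<diamondop> (h \<diamondop> k))
       (((f \<diamondop> g) \<diamondop> h) \<diamondop> k) (ass C (Dom C f \<otimes> Dom C g) (Dom C h) (Dom C k))"
    using square_ass[of "f \<diamondop> g" h k] by simp
  have "square (interchange C (Cod C f) (Cod C g) (Cod C h) (Cod C k)) ((f \<diamondop> g) \<diamondop> (h \<diamondop> k))
     ((f \<diamondop> h) \<diamondop> (g \<diamondop> k)) (interchange C (Dom C f) (Dom C g) (Dom C h) (Dom C k))"
    unfolding interchange_def
    by (intro square_comp[OF s1] square_comp[OF square_ten[OF square_ass square_ident]]
        square_comp[OF square_ten[OF square_ten[OF square_ident square_swap] square_ident]]
        square_comp[OF square_ten[OF s2 square_ident] s3] assms)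
  then show ?thesis by (simp add: square_def)
qed

text \<open>On the letters \<open>a, a', b, b', c, c'\<close> both sides perform the transpositions of \<open>a', b\<close>, of \<open>a', c\<close>
  and of \<open>b', c\<close>. They perform them in different orders: the transpositions of \<open>a', b\<close> and of \<open>b', c\<close>
  are exchanged, which is naturality of \<open>shuffle a' b\<close>.\<close>

lemma interchange_ass:
  assumes [simp]: "a \<in> Obj C" "a' \<in> Obj C" "b \<in> Obj C" "b' \<in> Obj C" "c \<in> Obj C" "c' \<in> Obj C"
  shows "(ass C a b c \<diamondop> ass C a' b' c') \<cdot> interchange C a a' (b \<otimes> c) (b' \<otimes> c') \<cdot>
           (ident C (a \<otimes> a') \<diamondop> interchange C b b' c c')
       = interchange C (a \<otimes> b) (a' \<otimes> b') c c' \<cdot> (interchange C a a' b b' \<diamondop> ident C (c \<otimes> c')) \<cdot>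
           ass C (a \<otimes> a') (b \<otimes> b') (c \<otimes> c')" (is "?l = ?r")
proof -
  let ?a = "Letter a" and ?a' = "Letter a'" and ?b = "Letter b" and ?b' = "Letter b'" and ?c = "Letter c" and ?c' = "Letter c'"
  note s = reads_swap_letters
  have s1: "reads (Join ?a' (Join ?b ?c)) (Join (Join ?b ?c) ?a') (swap C (ev ?a') (ev (Join ?b ?c)))
      (\<lambda>x. (ident C b \<diamondop> shuffle a' c x) \<cdot> shuffle a' b (c \<otimes> x))"
    using reads_swap_right[of ?a' ?b _ _ ?c] s[of a' b] s[of b a'] s[of a' c] s[of c a'] by simp
  have s2: "reads (Join (Join ?a' ?b') ?c) (Join ?c (Join ?a' ?b')) (swap C (ev (Join ?a' ?b')) (ev ?c))
      (\<lambda>x. shuffle a' c (b' \<otimes> x) \<cdot> (ident C a' \<diamondop> shuffle b' c x))"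
    using reads_swap_left[of ?a' ?c _ ?b'] s[of a' c] s[of b' c] by simp
  have s3: "reads (Join ?b' ?c) (Join ?c ?b') (swap C (ev ?b') (ev ?c)) (shuffle b' c)"
    using s[of b' c] by simp
  have s4: "reads (Join ?a' ?b) (Join ?b ?a') (swap C (ev ?a') (ev ?b)) (shuffle a' b)"
    using s[of a' b] by simp
  have l: "reads (Join (Join ?a ?a') (Join (Join ?b ?b') (Join ?c ?c'))) (Join (Join (Join ?a ?b) ?c) (Join (Join ?a' ?b') ?c'))
     ?l (\<lambda>x. (ident C a \<diamondop> ((ident C b \<diamondop> shuffle a' c (b' \<otimes> (c' \<otimes> x))) \<cdot> shuffle a' b (c \<otimes> (b' \<otimes> (c' \<otimes> x)))))
         \<cdot> (ident C a \<diamondop> (ident C a' \<diamondop> (ident C b \<diamondop> shuffle b' c (c' \<otimes> x)))))"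
    by (rule reads_cong[OF reads_comp[OF reads_ten[OF reads_ass[of ?a ?b ?c] reads_ass[of ?a' ?b' ?c']]
      reads_comp[OF reads_interchange[OF s1, of ?a "Join ?b' ?c'"]
        reads_ten[OF reads_ident[of "Join ?a ?a'"] reads_interchange[OF s3, of ?b ?c']]]]]) simp_all
  have r: "reads (Join (Join ?a ?a') (Join (Join ?b ?b') (Join ?c ?c'))) (Join (Join (Join ?a ?b) ?c) (Join (Join ?a' ?b') ?c'))
     ?r (\<lambda>x. (ident C a \<diamondop> (ident C b \<diamondop> (shuffle a' c (b' \<otimes> (c' \<otimes> x)) \<cdot> (ident C a' \<diamondop> shuffle b' c (c' \<otimes> x)))))
         \<cdot> (ident C a \<diamondop> shuffle a' b (b' \<otimes> (c \<otimes> (c' \<otimes> x)))))"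
    by (rule reads_cong[OF reads_comp[OF reads_interchange[OF s2, of "Join ?a ?b" ?c']
      reads_comp[OF reads_ten[OF reads_interchange[OF s4, of ?a ?b'] reads_ident[of "Join ?c ?c'"]]
        reads_ass[of "Join ?a ?a'" "Join ?b ?b'" "Join ?c ?c'"]]]]) simp_all
  show ?thesis
  proof (rule reads_eqI[OF l r])
    fix x assume [simp]: "x \<in> Obj C"
    let ?t = "b' \<otimes> (c \<otimes> (c' \<otimes> x))" and ?h = "shuffle b' c (c' \<otimes> x)"
    have "shuffle a' b (c \<otimes> (b' \<otimes> (c' \<otimes> x))) \<cdot> (ident C a' \<diamondop> (ident C b \<diamondop> ?h))
        = (ident C b \<diamondop> (ident C a' \<diamondop> ?h)) \<cdot> shuffle a' b ?t"
      using shuffle_nat[of a' b ?h] by simp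
    then show "(ident C a \<diamondop> ((ident C b \<diamondop> shuffle a' c (b' \<otimes> (c' \<otimes> x))) \<cdot> shuffle a' b (c \<otimes> (b' \<otimes> (c' \<otimes> x)))))
         \<cdot> (ident C a \<diamondop> (ident C a' \<diamondop> (ident C b \<diamondop> ?h)))
       = (ident C a \<diamondop> (ident C b \<diamondop> (shuffle a' c (b' \<otimes> (c' \<otimes> x)) \<cdot> (ident C a' \<diamondop> ?h)))) \<cdot> (ident C a \<diamondop> shuffle a' b ?t)"
      by simp
  qed
qed

lemma interchange_runit:
  assumes [simp]: "a \<in> Obj C" "a' \<in> Obj C"
  shows "(runit C a \<diamondop> runit C a') \<cdot> interchange C a a' \<one> \<one> \<cdot> (ident C (a \<otimes> a') \<diamondop> inv_ar C (runit C \<one>))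
       = runit C (a \<otimes> a')" (is "?l = ?r")
proof -
  let ?a = "Letter a" and ?a' = "Letter a'" and ?e = Empty
  have u: "reads ?e (Join ?e ?e) (inv_ar C (runit C \<one>)) (\<lambda>x. ident C x)"
    by (rule reads_cong[OF reads_inv_of_ident[of "Join ?e ?e" ?e "runit C \<one>"]]) (use reads_runit[of ?e] in simp_all)
  have s: "reads (Join ?a' ?e) (Join ?e ?a') (swap C (ev ?a') (ev ?e)) (\<lambda>x. ident C (a' \<otimes> x))"
    by (rule reads_cong[OF reads_swap_unit_right[of ?a']]) simp_all
  have l: "reads (Join (Join ?a ?a') ?e) (Join ?a ?a') ?l (\<lambda>x. ident C (a \<otimes> (a' \<otimes> x)))"
    by (rule reads_cong[OF reads_comp[OF reads_ten[OF reads_runit[of ?a] reads_runit[of ?a']]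
      reads_comp[OF reads_interchange[OF s, of ?a ?e] reads_ten[OF reads_ident[of "Join ?a ?a'"] u]]]]) simp_all
  have r: "reads (Join (Join ?a ?a') ?e) (Join ?a ?a') ?r (\<lambda>x. ident C (a \<otimes> (a' \<otimes> x)))"
    by (rule reads_cong[OF reads_runit[of "Join ?a ?a'"]]) simp_all
  show ?thesis by (rule reads_eqI[OF l r]) simp
qed

lemma interchange_lunit:
  assumes [simp]: "a \<in> Obj C" "a' \<in> Obj C"
  shows "(lunit C a \<diamondop> lunit C a') \<cdot> interchange C \<one> \<one> a a' \<cdot> (inv_ar C (runit C \<one>) \<diamondop> ident C (a \<otimes> a'))
       = lunit C (a \<otimes> a')" (is "?l = ?r")
proof -
  let ?a = "Letter a" and ?a' = "Letter a'" and ?e = Empty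
  have u: "reads ?e (Join ?e ?e) (inv_ar C (runit C \<one>)) (\<lambda>x. ident C x)"
    by (rule reads_cong[OF reads_inv_of_ident[of "Join ?e ?e" ?e "runit C \<one>"]]) (use reads_runit[of ?e] in simp_all)
  have s: "reads (Join ?e ?a) (Join ?a ?e) (swap C (ev ?e) (ev ?a)) (\<lambda>x. ident C (a \<otimes> x))"
    by (rule reads_cong[OF reads_swap_unit_left[of ?a]]) simp_all
  have l: "reads (Join ?e (Join ?a ?a')) (Join ?a ?a') ?l (\<lambda>x. ident C (a \<otimes> (a' \<otimes> x)))"
    by (rule reads_cong[OF reads_comp[OF reads_ten[OF reads_lunit[of ?a] reads_lunit[of ?a']]
      reads_comp[OF reads_interchange[OF s, of ?e ?a'] reads_ten[OF u reads_ident[of "Join ?a ?a'"]]]]]) simp_all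
  have r: "reads (Join ?e (Join ?a ?a')) (Join ?a ?a') ?r (\<lambda>x. ident C (a \<otimes> (a' \<otimes> x)))"
    by (rule reads_cong[OF reads_lunit[of "Join ?a ?a'"]]) simp_all
  show ?thesis by (rule reads_eqI[OF l r]) simp
qed

text \<open>The symmetry of \<open>a \<otimes> a'\<close> and \<open>b \<otimes> b'\<close> is read as four transpositions. The last one, of \<open>a\<close> and \<open>b'\<close>,
  is undone by the interchange that follows; the other three make up the left side.\<close>

lemma interchange_swap:
  assumes [simp]: "a \<in> Obj C" "a' \<in> Obj C" "b \<in> Obj C" "b' \<in> Obj C"
  shows "(swap C a b \<diamondop> swap C a' b') \<cdot> interchange C a a' b b' = interchange C b b' a a' \<cdot> swap C (a \<otimes> a') (b \<otimes> b')"
    (is "?l = ?r")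
proof -
  let ?a = "Letter a" and ?a' = "Letter a'" and ?b = "Letter b" and ?b' = "Letter b'"
  note s = reads_swap_letters
  have s1: "reads (Join ?a' ?b) (Join ?b ?a') (swap C (ev ?a') (ev ?b)) (shuffle a' b)"
    using s[of a' b] by simp
  have s2: "reads (Join ?b' ?a) (Join ?a ?b') (swap C (ev ?b') (ev ?a)) (shuffle b' a)"
    using s[of b' a] by simp
  have t: "reads (Join p (Join ?b ?b')) (Join (Join ?b ?b') p) (swap C (ev p) (ev (Join ?b ?b')))
      (\<lambda>x. (ident C b \<diamondop> shuffle (ev p) b' x) \<cdot> shuffle (ev p) b (b' \<otimes> x))" if "p = ?a \<or> p = ?a'" for p
    using that reads_swap_right[of p ?b _ _ ?b'] s[of "ev p" b] s[of b "ev p"] s[of "ev p" b'] s[of b' "ev p"] by auto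
  have u: "reads (Join (Join ?a ?a') (Join ?b ?b')) (Join (Join ?b ?b') (Join ?a ?a')) (swap C (a \<otimes> a') (b \<otimes> b'))
      (\<lambda>x. (ident C b \<diamondop> shuffle a b' (a' \<otimes> x)) \<cdot> shuffle a b (b' \<otimes> (a' \<otimes> x)) \<cdot>
           (ident C a \<diamondop> ((ident C b \<diamondop> shuffle a' b' x) \<cdot> shuffle a' b (b' \<otimes> x))))"
    by (rule reads_cong[OF reads_swap_left[OF t[of ?a] t[of ?a']]]) simp_all
  have l: "reads (Join (Join ?a ?a') (Join ?b ?b')) (Join (Join ?b ?a) (Join ?b' ?a')) ?l
      (\<lambda>x. shuffle a b (b' \<otimes> (a' \<otimes> x)) \<cdot> (ident C a \<diamondop> (ident C b \<diamondop> shuffle a' b' x)) \<cdot>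
           (ident C a \<diamondop> shuffle a' b (b' \<otimes> x)))"
    by (rule reads_cong[OF reads_comp[OF reads_ten[OF s[of a b] s[of a' b']] reads_interchange[OF s1, of ?a ?b']]]) simp_all
  have r: "reads (Join (Join ?a ?a') (Join ?b ?b')) (Join (Join ?b ?a) (Join ?b' ?a')) ?r
      (\<lambda>x. (ident C b \<diamondop> shuffle b' a (a' \<otimes> x)) \<cdot> (ident C b \<diamondop> shuffle a b' (a' \<otimes> x)) \<cdot> shuffle a b (b' \<otimes> (a' \<otimes> x)) \<cdot>
           (ident C a \<diamondop> ((ident C b \<diamondop> shuffle a' b' x) \<cdot> shuffle a' b (b' \<otimes> x))))"
    by (rule reads_cong[OF reads_comp[OF reads_interchange[OF s2, of ?b ?a'] u]]) simp_all
  show ?thesis by (rule reads_eqI[OF l r]) (simp add: shuffle_shuffle)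
qed

end

section \<open>The pointwise unit and tensor of symmetric monoidal functors\<close>

locale smf_between = A: sym_mon_cat A + B: sym_mon_cat B + sm_functor A B F
  for A :: "('o, 'm, 'x) smcat_scheme" and B :: "('p, 'n, 'y) smcat_scheme" and F
begin

lemmas [simp] = on_ob

lemma on_ar_type [simp]:
  assumes "f \<in> Arr A"
  shows "on_ar F f \<in> Arr B" "Dom B (on_ar F f) = on_ob F (Dom A f)" "Cod B (on_ar F f) = on_ob F (Cod A f)"
  using on_ar[OF A.Arr_hom[OF assms]] by (auto simp: hom_def)

lemma structure_type [simp]:
  shows "f0 F \<in> Arr B" "Dom B (f0 F) = \<one>\<^bsub>B\<^esub>" "Cod B (f0 F) = on_ob F \<one>\<^bsub>A\<^esub>"
    and "\<lbrakk>x \<in> Obj A; y \<in> Obj A\<rbrakk> \<Longrightarrow> f2 F x y \<in> Arr B"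
    and "\<lbrakk>x \<in> Obj A; y \<in> Obj A\<rbrakk> \<Longrightarrow> Dom B (f2 F x y) = on_ob F x \<otimes>\<^bsub>B\<^esub> on_ob F y"
    and "\<lbrakk>x \<in> Obj A; y \<in> Obj A\<rbrakk> \<Longrightarrow> Cod B (f2 F x y) = on_ob F (x \<otimes>\<^bsub>A\<^esub> y)"
  using f0_hom f2_hom by (auto simp: hom_def)

end

text \<open>The axioms for a constant functor at \<open>I\<close> are equations between canonical arrows of \<open>I\<close>. They
  hold because \<open>l\<^sub>I = r\<^sub>I\<close> and \<open>s\<^bsub>I,I\<^esub> = 1\<close>.\<close>

lemma sm_functor_smf_unit:
  assumes "sym_mon_cat A" and "sym_mon_cat B"
  shows "sm_functor A B (smf_unit A B)"
proof -
  interpret A: sym_mon_cat A by fact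
  interpret B: sym_mon_cat B by fact
  show ?thesis
  proof
    fix x y z assume [simp]: "x \<in> Obj A" "y \<in> Obj A" "z \<in> Obj A"
    have "runit B \<one>\<^bsub>B\<^esub> \<cdot>\<^bsub>B\<^esub> (ident B \<one>\<^bsub>B\<^esub> \<diamondop>\<^bsub>B\<^esub> runit B \<one>\<^bsub>B\<^esub>)
       = runit B \<one>\<^bsub>B\<^esub> \<cdot>\<^bsub>B\<^esub> (runit B \<one>\<^bsub>B\<^esub> \<diamondop>\<^bsub>B\<^esub> ident B \<one>\<^bsub>B\<^esub>) \<cdot>\<^bsub>B\<^esub> ass B \<one>\<^bsub>B\<^esub> \<one>\<^bsub>B\<^esub> \<one>\<^bsub>B\<^esub>"
      by (subst B.triangle) (simp_all add: B.lunit_unit)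
    then show "on_ar (smf_unit A B) (ass A x y z) \<cdot>\<^bsub>B\<^esub> f2 (smf_unit A B) x (y \<otimes>\<^bsub>A\<^esub> z) \<cdot>\<^bsub>B\<^esub>
                (ident B (on_ob (smf_unit A B) x) \<diamondop>\<^bsub>B\<^esub> f2 (smf_unit A B) y z) =
              f2 (smf_unit A B) (x \<otimes>\<^bsub>A\<^esub> y) z \<cdot>\<^bsub>B\<^esub>
                (f2 (smf_unit A B) x y \<diamondop>\<^bsub>B\<^esub> ident B (on_ob (smf_unit A B) z)) \<cdot>\<^bsub>B\<^esub>
                ass B (on_ob (smf_unit A B) x) (on_ob (smf_unit A B) y) (on_ob (smf_unit A B) z)"
      by (simp add: smf_unit_def)
  qed (auto simp: smf_unit_def hom_def B.lunit_unit B.swap_unit_unit)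
qed

text \<open>In the axioms for associativity, units and symmetry, naturality of the interchange moves the
  structure arrows of \<open>F\<close> and \<open>G\<close> to its left, where the axiom for \<open>F\<close> and the axiom for \<open>G\<close> apply
  in the two tensor factors. What remains is the coherence law for the interchange and the canonical
  arrow concerned.\<close>

lemma sm_functor_smf_ten:
  assumes A: "sym_mon_cat A" and B: "sym_mon_cat B" and F: "sm_functor A B F" and G: "sm_functor A B G"
  shows "sm_functor A B (smf_ten A B F G)"
proof -
  interpret F: smf_between A B F using A B F by (simp add: smf_between_def)
  interpret G: smf_between A B G using A B G by (simp add: smf_between_def)
  let ?T = "smf_ten A B F G"
  let ?i = "\<lambda>x y. interchange B (on_ob F x) (on_ob G x) (on_ob F y) (on_ob G y)"
  let ?I = "\<lambda>x. ident B (on_ob F x) \<diamondop>\<^bsub>B\<^esub> ident B (on_ob G x)"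
  have f2T: "f2 ?T x y = (f2 F x y \<diamondop>\<^bsub>B\<^esub> f2 G x y) \<cdot>\<^bsub>B\<^esub> ?i x y" if "x \<in> Obj A" "y \<in> Obj A" for x y
    using that by (simp add: smf_ten_def)
  have obT: "on_ob ?T x = on_ob F x \<otimes>\<^bsub>B\<^esub> on_ob G x" if "x \<in> Obj A" for x
    using that by (simp add: smf_ten_def)
  have arT: "on_ar ?T f = on_ar F f \<diamondop>\<^bsub>B\<^esub> on_ar G f" if "f \<in> Arr A" for f
    using that by (simp add: smf_ten_def)
  have f0T: "f0 ?T = (f0 F \<diamondop>\<^bsub>B\<^esub> f0 G) \<cdot>\<^bsub>B\<^esub> inv_ar B (runit B \<one>\<^bsub>B\<^esub>)"
    by (simp add: smf_ten_def)
  show ?thesis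
  proof
    show "on_ob ?T \<in> extensional (Obj A)" "on_ar ?T \<in> extensional (Arr A)" by (simp_all add: smf_ten_def)
    show "f2 ?T x y = undefined" if "\<not> (x \<in> Obj A \<and> y \<in> Obj A)" for x y using that by (auto simp: smf_ten_def)
    show "on_ob ?T x \<in> Obj B" if "x \<in> Obj A" for x using that by (simp add: obT)
    show "on_ar ?T f \<in> hom B (on_ob ?T x) (on_ob ?T y)" if "f \<in> hom A x y" for f x y
      using F.A.homD[OF that] by (auto simp: hom_def arT obT)
    show "on_ar ?T (ident A x) = ident B (on_ob ?T x)" if "x \<in> Obj A" for x
      using that by (simp add: arT obT F.on_ident G.on_ident)
    show "on_ar ?T (g \<cdot>\<^bsub>A\<^esub> f) = on_ar ?T g \<cdot>\<^bsub>B\<^esub> on_ar ?T f" if "f \<in> hom A x y" "g \<in> hom A y z" for f g x y z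
      using F.A.homD[OF that(1)] F.A.homD[OF that(2)]
      by (auto simp: arT F.on_comp[OF that] G.on_comp[OF that])
    show "f0 ?T \<in> hom B \<one>\<^bsub>B\<^esub> (on_ob ?T \<one>\<^bsub>A\<^esub>)" by (simp add: f0T obT hom_def)
  next
    fix x y assume [simp]: "x \<in> Obj A" "y \<in> Obj A"
    show "f2 ?T x y \<in> hom B (on_ob ?T x \<otimes>\<^bsub>B\<^esub> on_ob ?T y) (on_ob ?T (x \<otimes>\<^bsub>A\<^esub> y))"
      by (simp add: f2T obT hom_def)
    have "on_ar ?T (swap A x y) \<cdot>\<^bsub>B\<^esub> f2 ?T x y
        = ((on_ar F (swap A x y) \<cdot>\<^bsub>B\<^esub> f2 F x y) \<diamondop>\<^bsub>B\<^esub> (on_ar G (swap A x y) \<cdot>\<^bsub>B\<^esub> f2 G x y)) \<cdot>\<^bsub>B\<^esub> ?i x y"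
      by (simp add: arT f2T)
    also have "\<dots> = (f2 F y x \<diamondop>\<^bsub>B\<^esub> f2 G y x) \<cdot>\<^bsub>B\<^esub>
        ((swap B (on_ob F x) (on_ob F y) \<diamondop>\<^bsub>B\<^esub> swap B (on_ob G x) (on_ob G y)) \<cdot>\<^bsub>B\<^esub> ?i x y)"
      by (simp add: F.f2_swap G.f2_swap)
    also have "\<dots> = f2 ?T y x \<cdot>\<^bsub>B\<^esub> swap B (on_ob ?T x) (on_ob ?T y)"
      by (subst F.B.interchange_swap) (simp_all add: f2T obT)
    finally show "on_ar ?T (swap A x y) \<cdot>\<^bsub>B\<^esub> f2 ?T x y = f2 ?T y x \<cdot>\<^bsub>B\<^esub> swap B (on_ob ?T x) (on_ob ?T y)" .
    let ?r = "inv_ar B (runit B \<one>\<^bsub>B\<^esub>)"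
    have "on_ar ?T (runit A x) \<cdot>\<^bsub>B\<^esub> f2 ?T x \<one>\<^bsub>A\<^esub> \<cdot>\<^bsub>B\<^esub> (ident B (on_ob ?T x) \<diamondop>\<^bsub>B\<^esub> f0 ?T)
       = ((on_ar F (runit A x) \<cdot>\<^bsub>B\<^esub> f2 F x \<one>\<^bsub>A\<^esub>) \<diamondop>\<^bsub>B\<^esub> (on_ar G (runit A x) \<cdot>\<^bsub>B\<^esub> f2 G x \<one>\<^bsub>A\<^esub>)) \<cdot>\<^bsub>B\<^esub>
          (?i x \<one>\<^bsub>A\<^esub> \<cdot>\<^bsub>B\<^esub> (?I x \<diamondop>\<^bsub>B\<^esub> (f0 F \<diamondop>\<^bsub>B\<^esub> f0 G))) \<cdot>\<^bsub>B\<^esub> (ident B (on_ob ?T x) \<diamondop>\<^bsub>B\<^esub> ?r)"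
      by (simp add: arT f2T f0T obT)
    also have "?i x \<one>\<^bsub>A\<^esub> \<cdot>\<^bsub>B\<^esub> (?I x \<diamondop>\<^bsub>B\<^esub> (f0 F \<diamondop>\<^bsub>B\<^esub> f0 G))
       = ((ident B (on_ob F x) \<diamondop>\<^bsub>B\<^esub> f0 F) \<diamondop>\<^bsub>B\<^esub> (ident B (on_ob G x) \<diamondop>\<^bsub>B\<^esub> f0 G)) \<cdot>\<^bsub>B\<^esub>
         interchange B (on_ob F x) (on_ob G x) \<one>\<^bsub>B\<^esub> \<one>\<^bsub>B\<^esub>"
      using F.B.interchange_nat[of "ident B (on_ob F x)" "ident B (on_ob G x)" "f0 F" "f0 G"] by simp
    also have "((on_ar F (runit A x) \<cdot>\<^bsub>B\<^esub> f2 F x \<one>\<^bsub>A\<^esub>) \<diamondop>\<^bsub>B\<^esub> (on_ar G (runit A x) \<cdot>\<^bsub>B\<^esub> f2 G x \<one>\<^bsub>A\<^esub>)) \<cdot>\<^bsub>B\<^esub>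
         (((ident B (on_ob F x) \<diamondop>\<^bsub>B\<^esub> f0 F) \<diamondop>\<^bsub>B\<^esub> (ident B (on_ob G x) \<diamondop>\<^bsub>B\<^esub> f0 G)) \<cdot>\<^bsub>B\<^esub>
         interchange B (on_ob F x) (on_ob G x) \<one>\<^bsub>B\<^esub> \<one>\<^bsub>B\<^esub>) \<cdot>\<^bsub>B\<^esub> (ident B (on_ob ?T x) \<diamondop>\<^bsub>B\<^esub> ?r)
       = ((on_ar F (runit A x) \<cdot>\<^bsub>B\<^esub> f2 F x \<one>\<^bsub>A\<^esub> \<cdot>\<^bsub>B\<^esub> (ident B (on_ob F x) \<diamondop>\<^bsub>B\<^esub> f0 F)) \<diamondop>\<^bsub>B\<^esub>
          (on_ar G (runit A x) \<cdot>\<^bsub>B\<^esub> f2 G x \<one>\<^bsub>A\<^esub> \<cdot>\<^bsub>B\<^esub> (ident B (on_ob G x) \<diamondop>\<^bsub>B\<^esub> f0 G))) \<cdot>\<^bsub>B\<^esub>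
         interchange B (on_ob F x) (on_ob G x) \<one>\<^bsub>B\<^esub> \<one>\<^bsub>B\<^esub> \<cdot>\<^bsub>B\<^esub> (ident B (on_ob ?T x) \<diamondop>\<^bsub>B\<^esub> ?r)"
      by (simp add: obT)
    also have "\<dots> = runit B (on_ob ?T x)"
      by (simp add: F.f2_runit G.f2_runit F.B.interchange_runit obT)
    finally show "on_ar ?T (runit A x) \<cdot>\<^bsub>B\<^esub> f2 ?T x \<one>\<^bsub>A\<^esub> \<cdot>\<^bsub>B\<^esub> (ident B (on_ob ?T x) \<diamondop>\<^bsub>B\<^esub> f0 ?T)
       = runit B (on_ob ?T x)" .
    have "on_ar ?T (lunit A x) \<cdot>\<^bsub>B\<^esub> f2 ?T \<one>\<^bsub>A\<^esub> x \<cdot>\<^bsub>B\<^esub> (f0 ?T \<diamondop>\<^bsub>B\<^esub> ident B (on_ob ?T x))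
       = ((on_ar F (lunit A x) \<cdot>\<^bsub>B\<^esub> f2 F \<one>\<^bsub>A\<^esub> x) \<diamondop>\<^bsub>B\<^esub> (on_ar G (lunit A x) \<cdot>\<^bsub>B\<^esub> f2 G \<one>\<^bsub>A\<^esub> x)) \<cdot>\<^bsub>B\<^esub>
          (?i \<one>\<^bsub>A\<^esub> x \<cdot>\<^bsub>B\<^esub> ((f0 F \<diamondop>\<^bsub>B\<^esub> f0 G) \<diamondop>\<^bsub>B\<^esub> ?I x)) \<cdot>\<^bsub>B\<^esub> (?r \<diamondop>\<^bsub>B\<^esub> ident B (on_ob ?T x))"
      by (simp add: arT f2T f0T obT)
    also have "?i \<one>\<^bsub>A\<^esub> x \<cdot>\<^bsub>B\<^esub> ((f0 F \<diamondop>\<^bsub>B\<^esub> f0 G) \<diamondop>\<^bsub>B\<^esub> ?I x)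
       = ((f0 F \<diamondop>\<^bsub>B\<^esub> ident B (on_ob F x)) \<diamondop>\<^bsub>B\<^esub> (f0 G \<diamondop>\<^bsub>B\<^esub> ident B (on_ob G x))) \<cdot>\<^bsub>B\<^esub>
         interchange B \<one>\<^bsub>B\<^esub> \<one>\<^bsub>B\<^esub> (on_ob F x) (on_ob G x)"
      using F.B.interchange_nat[of "f0 F" "f0 G" "ident B (on_ob F x)" "ident B (on_ob G x)"] by simp
    also have "((on_ar F (lunit A x) \<cdot>\<^bsub>B\<^esub> f2 F \<one>\<^bsub>A\<^esub> x) \<diamondop>\<^bsub>B\<^esub> (on_ar G (lunit A x) \<cdot>\<^bsub>B\<^esub> f2 G \<one>\<^bsub>A\<^esub> x)) \<cdot>\<^bsub>B\<^esub>
         (((f0 F \<diamondop>\<^bsub>B\<^esub> ident B (on_ob F x)) \<diamondop>\<^bsub>B\<^esub> (f0 G \<diamondop>\<^bsub>B\<^esub> ident B (on_ob G x))) \<cdot>\<^bsub>B\<^esub>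
         interchange B \<one>\<^bsub>B\<^esub> \<one>\<^bsub>B\<^esub> (on_ob F x) (on_ob G x)) \<cdot>\<^bsub>B\<^esub> (?r \<diamondop>\<^bsub>B\<^esub> ident B (on_ob ?T x))
       = ((on_ar F (lunit A x) \<cdot>\<^bsub>B\<^esub> f2 F \<one>\<^bsub>A\<^esub> x \<cdot>\<^bsub>B\<^esub> (f0 F \<diamondop>\<^bsub>B\<^esub> ident B (on_ob F x))) \<diamondop>\<^bsub>B\<^esub>
          (on_ar G (lunit A x) \<cdot>\<^bsub>B\<^esub> f2 G \<one>\<^bsub>A\<^esub> x \<cdot>\<^bsub>B\<^esub> (f0 G \<diamondop>\<^bsub>B\<^esub> ident B (on_ob G x)))) \<cdot>\<^bsub>B\<^esub>
         interchange B \<one>\<^bsub>B\<^esub> \<one>\<^bsub>B\<^esub> (on_ob F x) (on_ob G x) \<cdot>\<^bsub>B\<^esub> (?r \<diamondop>\<^bsub>B\<^esub> ident B (on_ob ?T x))"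
      by (simp add: obT)
    also have "\<dots> = lunit B (on_ob ?T x)"
      by (simp add: F.f2_lunit G.f2_lunit F.B.interchange_lunit obT)
    finally show "on_ar ?T (lunit A x) \<cdot>\<^bsub>B\<^esub> f2 ?T \<one>\<^bsub>A\<^esub> x \<cdot>\<^bsub>B\<^esub> (f0 ?T \<diamondop>\<^bsub>B\<^esub> ident B (on_ob ?T x))
       = lunit B (on_ob ?T x)" .
  next
    fix f g x x' y y' assume f: "f \<in> hom A x x'" and g: "g \<in> hom A y y'"
    note [simp] = F.A.homD[OF f] F.A.homD[OF g]
    have "on_ar ?T (f \<diamondop>\<^bsub>A\<^esub> g) \<cdot>\<^bsub>B\<^esub> f2 ?T x y
       = ((on_ar F (f \<diamondop>\<^bsub>A\<^esub> g) \<cdot>\<^bsub>B\<^esub> f2 F x y) \<diamondop>\<^bsub>B\<^esub> (on_ar G (f \<diamondop>\<^bsub>A\<^esub> g) \<cdot>\<^bsub>B\<^esub> f2 G x y)) \<cdot>\<^bsub>B\<^esub> ?i x y"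
      by (simp add: arT f2T)
    also have "\<dots> = (f2 F x' y' \<diamondop>\<^bsub>B\<^esub> f2 G x' y') \<cdot>\<^bsub>B\<^esub>
       (((on_ar F f \<diamondop>\<^bsub>B\<^esub> on_ar F g) \<diamondop>\<^bsub>B\<^esub> (on_ar G f \<diamondop>\<^bsub>B\<^esub> on_ar G g)) \<cdot>\<^bsub>B\<^esub> ?i x y)"
      by (simp add: F.f2_nat[OF f g] G.f2_nat[OF f g])
    also have "((on_ar F f \<diamondop>\<^bsub>B\<^esub> on_ar F g) \<diamondop>\<^bsub>B\<^esub> (on_ar G f \<diamondop>\<^bsub>B\<^esub> on_ar G g)) \<cdot>\<^bsub>B\<^esub> ?i x y
       = ?i x' y' \<cdot>\<^bsub>B\<^esub> ((on_ar F f \<diamondop>\<^bsub>B\<^esub> on_ar G f) \<diamondop>\<^bsub>B\<^esub> (on_ar F g \<diamondop>\<^bsub>B\<^esub> on_ar G g))"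
      using F.B.interchange_nat[of "on_ar F f" "on_ar G f" "on_ar F g" "on_ar G g"] by simp
    finally show "on_ar ?T (f \<diamondop>\<^bsub>A\<^esub> g) \<cdot>\<^bsub>B\<^esub> f2 ?T x y = f2 ?T x' y' \<cdot>\<^bsub>B\<^esub> (on_ar ?T f \<diamondop>\<^bsub>B\<^esub> on_ar ?T g)"
      by (simp add: arT f2T)
  next
    fix x y z assume [simp]: "x \<in> Obj A" "y \<in> Obj A" "z \<in> Obj A"
    let ?l = "\<lambda>H. on_ar H (ass A x y z) \<cdot>\<^bsub>B\<^esub> f2 H x (y \<otimes>\<^bsub>A\<^esub> z) \<cdot>\<^bsub>B\<^esub> (ident B (on_ob H x) \<diamondop>\<^bsub>B\<^esub> f2 H y z)"
    let ?r = "\<lambda>H. f2 H (x \<otimes>\<^bsub>A\<^esub> y) z \<cdot>\<^bsub>B\<^esub> (f2 H x y \<diamondop>\<^bsub>B\<^esub> ident B (on_ob H z))"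
    let ?a = "\<lambda>H. ass B (on_ob H x) (on_ob H y) (on_ob H z)"
    let ?j = "interchange B (on_ob F x) (on_ob G x) (on_ob F y \<otimes>\<^bsub>B\<^esub> on_ob F z) (on_ob G y \<otimes>\<^bsub>B\<^esub> on_ob G z)"
    let ?k = "interchange B (on_ob F x \<otimes>\<^bsub>B\<^esub> on_ob F y) (on_ob G x \<otimes>\<^bsub>B\<^esub> on_ob G y) (on_ob F z) (on_ob G z)"
    let ?u = "on_ar F (ass A x y z) \<cdot>\<^bsub>B\<^esub> f2 F x (y \<otimes>\<^bsub>A\<^esub> z)" and ?v = "on_ar G (ass A x y z) \<cdot>\<^bsub>B\<^esub> f2 G x (y \<otimes>\<^bsub>A\<^esub> z)"
    have "?l ?T = (?u \<diamondop>\<^bsub>B\<^esub> ?v) \<cdot>\<^bsub>B\<^esub> (?i x (y \<otimes>\<^bsub>A\<^esub> z) \<cdot>\<^bsub>B\<^esub> (?I x \<diamondop>\<^bsub>B\<^esub> (f2 F y z \<diamondop>\<^bsub>B\<^esub> f2 G y z))) \<cdot>\<^bsub>B\<^esub>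
        (ident B (on_ob ?T x) \<diamondop>\<^bsub>B\<^esub> ?i y z)"
      by (simp add: arT f2T obT)
    also have "?i x (y \<otimes>\<^bsub>A\<^esub> z) \<cdot>\<^bsub>B\<^esub> (?I x \<diamondop>\<^bsub>B\<^esub> (f2 F y z \<diamondop>\<^bsub>B\<^esub> f2 G y z))
       = ((ident B (on_ob F x) \<diamondop>\<^bsub>B\<^esub> f2 F y z) \<diamondop>\<^bsub>B\<^esub> (ident B (on_ob G x) \<diamondop>\<^bsub>B\<^esub> f2 G y z)) \<cdot>\<^bsub>B\<^esub> ?j"
      using F.B.interchange_nat[of "ident B (on_ob F x)" "ident B (on_ob G x)" "f2 F y z" "f2 G y z"] by simp
    also have "(?u \<diamondop>\<^bsub>B\<^esub> ?v) \<cdot>\<^bsub>B\<^esub>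
        (((ident B (on_ob F x) \<diamondop>\<^bsub>B\<^esub> f2 F y z) \<diamondop>\<^bsub>B\<^esub> (ident B (on_ob G x) \<diamondop>\<^bsub>B\<^esub> f2 G y z)) \<cdot>\<^bsub>B\<^esub> ?j) \<cdot>\<^bsub>B\<^esub>
        (ident B (on_ob ?T x) \<diamondop>\<^bsub>B\<^esub> ?i y z)
       = (?l F \<diamondop>\<^bsub>B\<^esub> ?l G) \<cdot>\<^bsub>B\<^esub> ?j \<cdot>\<^bsub>B\<^esub> (ident B (on_ob ?T x) \<diamondop>\<^bsub>B\<^esub> ?i y z)"
      by (simp add: obT)
    also have "\<dots> = ((?r F \<cdot>\<^bsub>B\<^esub> ?a F) \<diamondop>\<^bsub>B\<^esub> (?r G \<cdot>\<^bsub>B\<^esub> ?a G)) \<cdot>\<^bsub>B\<^esub> ?j \<cdot>\<^bsub>B\<^esub> (ident B (on_ob ?T x) \<diamondop>\<^bsub>B\<^esub> ?i y z)"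
      by (simp add: F.f2_ass G.f2_ass)
    also have "\<dots> = (?r F \<diamondop>\<^bsub>B\<^esub> ?r G) \<cdot>\<^bsub>B\<^esub> ((?a F \<diamondop>\<^bsub>B\<^esub> ?a G) \<cdot>\<^bsub>B\<^esub> ?j \<cdot>\<^bsub>B\<^esub> (ident B (on_ob ?T x) \<diamondop>\<^bsub>B\<^esub> ?i y z))"
      by (simp add: obT)
    also have "(?a F \<diamondop>\<^bsub>B\<^esub> ?a G) \<cdot>\<^bsub>B\<^esub> ?j \<cdot>\<^bsub>B\<^esub> (ident B (on_ob ?T x) \<diamondop>\<^bsub>B\<^esub> ?i y z)
       = ?k \<cdot>\<^bsub>B\<^esub> (?i x y \<diamondop>\<^bsub>B\<^esub> ident B (on_ob ?T z)) \<cdot>\<^bsub>B\<^esub> ?a ?T"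
      using F.B.interchange_ass by (simp add: obT)
    also have "(?r F \<diamondop>\<^bsub>B\<^esub> ?r G) \<cdot>\<^bsub>B\<^esub> ?k \<cdot>\<^bsub>B\<^esub> (?i x y \<diamondop>\<^bsub>B\<^esub> ident B (on_ob ?T z)) \<cdot>\<^bsub>B\<^esub> ?a ?T
       = (f2 F (x \<otimes>\<^bsub>A\<^esub> y) z \<diamondop>\<^bsub>B\<^esub> f2 G (x \<otimes>\<^bsub>A\<^esub> y) z) \<cdot>\<^bsub>B\<^esub>
         (((f2 F x y \<diamondop>\<^bsub>B\<^esub> ident B (on_ob F z)) \<diamondop>\<^bsub>B\<^esub> (f2 G x y \<diamondop>\<^bsub>B\<^esub> ident B (on_ob G z))) \<cdot>\<^bsub>B\<^esub> ?k) \<cdot>\<^bsub>B\<^esub>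
         (?i x y \<diamondop>\<^bsub>B\<^esub> ident B (on_ob ?T z)) \<cdot>\<^bsub>B\<^esub> ?a ?T"
      by (simp add: obT)
    also have "((f2 F x y \<diamondop>\<^bsub>B\<^esub> ident B (on_ob F z)) \<diamondop>\<^bsub>B\<^esub> (f2 G x y \<diamondop>\<^bsub>B\<^esub> ident B (on_ob G z))) \<cdot>\<^bsub>B\<^esub> ?k
       = ?i (x \<otimes>\<^bsub>A\<^esub> y) z \<cdot>\<^bsub>B\<^esub> ((f2 F x y \<diamondop>\<^bsub>B\<^esub> f2 G x y) \<diamondop>\<^bsub>B\<^esub> ?I z)"
      using F.B.interchange_nat[of "f2 F x y" "f2 G x y" "ident B (on_ob F z)" "ident B (on_ob G z)"] by simp
    also have "(f2 F (x \<otimes>\<^bsub>A\<^esub> y) z \<diamondop>\<^bsub>B\<^esub> f2 G (x \<otimes>\<^bsub>A\<^esub> y) z) \<cdot>\<^bsub>B\<^esub>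
         (?i (x \<otimes>\<^bsub>A\<^esub> y) z \<cdot>\<^bsub>B\<^esub> ((f2 F x y \<diamondop>\<^bsub>B\<^esub> f2 G x y) \<diamondop>\<^bsub>B\<^esub> ?I z)) \<cdot>\<^bsub>B\<^esub>
         (?i x y \<diamondop>\<^bsub>B\<^esub> ident B (on_ob ?T z)) \<cdot>\<^bsub>B\<^esub> ?a ?T
       = f2 ?T (x \<otimes>\<^bsub>A\<^esub> y) z \<cdot>\<^bsub>B\<^esub> (f2 ?T x y \<diamondop>\<^bsub>B\<^esub> ident B (on_ob ?T z)) \<cdot>\<^bsub>B\<^esub> ?a ?T"
      by (simp add: f2T obT)
    finally show "?l ?T = f2 ?T (x \<otimes>\<^bsub>A\<^esub> y) z \<cdot>\<^bsub>B\<^esub> (f2 ?T x y \<diamondop>\<^bsub>B\<^esub> ident B (on_ob ?T z)) \<cdot>\<^bsub>B\<^esub> ?a ?T" .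
  qed
qed

section \<open>The tensor product is a symmetric monoidal category\<close>

locale two_smcs = A: sym_mon_cat A + B: sym_mon_cat B
  for A :: "('a, 'f, 'x) smcat_scheme" and B :: "('b, 'g, 'y) smcat_scheme"
begin

abbreviation T where "T \<equiv> tensor A B"
abbreviation cl where "cl \<equiv> fclass A B"

lemma wf_fdom_fcod [simp]:
  "wf_farrow A B p \<Longrightarrow> wf_wrd A B (fdom A B p)" "wf_farrow A B p \<Longrightarrow> wf_wrd A B (fcod A B p)"
  by (induction p) auto

lemma ften_type [simp]:
  assumes "wf_farrow A B p" "wf_farrow A B q"
  shows "wf_farrow A B (ften A B p q)" "fdom A B (ften A B p q) = fdom A B p \<odot> fdom A B q"
    "fcod A B (ften A B p q) = fcod A B p \<odot> fcod A B q"
  using assms by (simp_all add: ften_def)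

lemma feq_parallel:
  "feq A B p q \<Longrightarrow> wf_farrow A B p \<and> wf_farrow A B q \<and> fdom A B p = fdom A B q \<and> fcod A B p = fcod A B q"
  by (induction rule: feq.induct)
    (auto simp: fhom_def hom_def finterchange_def simp del: A.comp_assoc_simp B.comp_assoc_simp)

lemma cl_eqI: "feq A B p q \<Longrightarrow> cl p = cl q"
  unfolding fclass_def by (blast intro: feq_sym feq_trans)

text \<open>Representatives may be replaced by the given arrows, up to the congruence. This justifies the
  computation rules \<open>cl_comp\<close> and \<open>cl_ten\<close>.\<close>

lemma feq_frep:
  assumes "wf_farrow A B p"
  shows "feq A B p (frep (cl p))"
proof -
  have "p \<in> cl p" using feq_refl[OF assms] by (simp add: fclass_def)
  then have "frep (cl p) \<in> cl p" unfolding frep_def by (rule someI)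
  then show ?thesis by (simp add: fclass_def)
qed

lemma frep_type [simp]:
  assumes "wf_farrow A B p"
  shows "wf_farrow A B (frep (cl p))" "fdom A B (frep (cl p)) = fdom A B p" "fcod A B (frep (cl p)) = fcod A B p"
  using feq_parallel[OF feq_frep[OF assms]] by auto

lemma tensor_simps [simp]:
  "Obj T = {X. wf_wrd A B X}" "ident T X = cl (FId X)" "\<one>\<^bsub>T\<^esub> = WI" "X \<otimes>\<^bsub>T\<^esub> Y = X \<odot> Y"
  "ass T X Y Z = cl (FAss X Y Z)" "runit T X = cl (FR X)" "lunit T X = cl (FL X)" "swap T X Y = cl (FS X Y)"
  by (simp_all add: tensor_def)

lemma cl_type [simp]:
  assumes "wf_farrow A B p"
  shows "cl p \<in> Arr T" "Dom T (cl p) = fdom A B p" "Cod T (cl p) = fcod A B p"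
  using assms by (simp_all add: tensor_def)

lemma cl_cases:
  assumes "P \<in> Arr T"
  obtains p where "wf_farrow A B p" "P = cl p"
  using assms by (auto simp: tensor_def)

lemma cl_hom_cases:
  assumes "P \<in> hom T X Y"
  obtains p where "p \<in> fhom A B X Y" "P = cl p"
proof -
  from assms have "P \<in> Arr T" by (simp add: hom_def)
  then obtain p where "wf_farrow A B p" "P = cl p" by (rule cl_cases)
  then show ?thesis using assms that[of p] by (simp add: hom_def fhom_def)
qed

lemma cl_comp:
  assumes "wf_farrow A B p" "wf_farrow A B q" "fdom A B p = fcod A B q"
  shows "cl p \<cdot>\<^bsub>T\<^esub> cl q = cl (p \<bullet> q)"
proof -
  have "feq A B (p \<bullet> q) (frep (cl p) \<bullet> frep (cl q))"
    by (intro cong_comp feq_frep assms)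
  then have "cl (frep (cl p) \<bullet> frep (cl q)) = cl (p \<bullet> q)" using cl_eqI by metis
  then show ?thesis by (simp add: tensor_def)
qed

lemma cl_ten:
  assumes "wf_farrow A B p" "wf_farrow A B q"
  shows "cl p \<diamondop>\<^bsub>T\<^esub> cl q = cl (ften A B p q)"
proof -
  have "feq A B (ften A B p q) (ften A B (frep (cl p)) (frep (cl q)))"
    using assms by (auto simp: ften_def intro!: cong_comp cong_whiskL cong_whiskR feq_frep)
  then have "cl (ften A B (frep (cl p)) (frep (cl q))) = cl (ften A B p q)" using cl_eqI by metis
  then show ?thesis by (simp add: tensor_def)
qed

lemma category_tensor: "category T"
proof
  fix P X Y assume "P \<in> hom T X Y"
  then obtain p where p: "p \<in> fhom A B X Y" and [simp]: "P = cl p" by (rule cl_hom_cases)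
  then have [simp]: "wf_farrow A B p" "fdom A B p = X" "fcod A B p = Y" by (auto simp: fhom_def)
  then have [simp]: "wf_wrd A B X" "wf_wrd A B Y" using wf_fdom_fcod[of p] by auto
  show "P \<cdot>\<^bsub>T\<^esub> ident T X = P" "ident T Y \<cdot>\<^bsub>T\<^esub> P = P"
    using cl_eqI[OF feq.comp_id[OF p]] cl_eqI[OF feq.id_comp[OF p]] by (simp_all add: cl_comp)
  fix Q Z assume "Q \<in> hom T Y Z"
  then obtain q where q: "q \<in> fhom A B Y Z" and [simp]: "Q = cl q" by (rule cl_hom_cases)
  then have [simp]: "wf_farrow A B q" "fdom A B q = Y" "fcod A B q = Z" by (auto simp: fhom_def)
  show "Q \<cdot>\<^bsub>T\<^esub> P \<in> hom T X Z" by (simp add: cl_comp hom_def)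
  fix R W assume "R \<in> hom T Z W"
  then obtain r where r: "r \<in> fhom A B Z W" and [simp]: "R = cl r" by (rule cl_hom_cases)
  then have [simp]: "wf_farrow A B r" "fdom A B r = Z" "fcod A B r = W" by (auto simp: fhom_def)
  show "(R \<cdot>\<^bsub>T\<^esub> Q) \<cdot>\<^bsub>T\<^esub> P = R \<cdot>\<^bsub>T\<^esub> (Q \<cdot>\<^bsub>T\<^esub> P)"
    using cl_eqI[OF feq.assoc[OF p q r]] by (simp add: cl_comp)
qed (auto simp: hom_def elim!: cl_cases)

sublocale Tc: category T by (rule category_tensor)

lemma cl_whiskL: "\<lbrakk>wf_wrd A B X; wf_farrow A B q\<rbrakk> \<Longrightarrow> cl (FId X) \<diamondop>\<^bsub>T\<^esub> cl q = cl (X \<triangleright> q)"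
proof -
  assume [simp]: "wf_wrd A B X" "wf_farrow A B q"
  have "cl (X \<triangleright> q) \<cdot>\<^bsub>T\<^esub> cl (FId X \<triangleleft> fdom A B q) = cl (X \<triangleright> q)"
    using Tc.comp_ident_simp[of "cl (X \<triangleright> q)"] by (simp add: cl_eqI[OF whiskR_id])
  then show ?thesis by (simp add: cl_ten ften_def cl_comp)
qed

lemma cl_whiskR: "\<lbrakk>wf_wrd A B X; wf_farrow A B p\<rbrakk> \<Longrightarrow> cl p \<diamondop>\<^bsub>T\<^esub> cl (FId X) = cl (p \<triangleleft> X)"
proof -
  assume [simp]: "wf_wrd A B X" "wf_farrow A B p"
  have "cl (fcod A B p \<triangleright> FId X) \<cdot>\<^bsub>T\<^esub> cl (p \<triangleleft> X) = cl (p \<triangleleft> X)"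
    using Tc.ident_comp_simp[of "cl (p \<triangleleft> X)"] by (simp add: cl_eqI[OF whiskL_id])
  then show ?thesis by (simp add: cl_ten ften_def cl_comp)
qed

lemma iso_cl:
  assumes "feq A B (q \<bullet> p) (FId (fdom A B p))" "feq A B (p \<bullet> q) (FId (fcod A B p))"
  shows "iso T (cl p)" "inv_ar T (cl p) = cl q"
proof -
  have [simp]: "wf_farrow A B p" "wf_farrow A B q" "fdom A B q = fcod A B p" "fdom A B p = fcod A B q"
    using feq_parallel[OF assms(1)] feq_parallel[OF assms(2)] by auto
  note e = cl_eqI[OF assms(1)] cl_eqI[OF assms(2)]
  show "iso T (cl p)" "inv_ar T (cl p) = cl q"
    using Tc.isoI[of "cl p" "cl q"] e by (simp_all add: cl_comp)
qed

lemma iso_cl_canonical [simp]: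
  "\<lbrakk>wf_wrd A B X; wf_wrd A B Y; wf_wrd A B Z\<rbrakk> \<Longrightarrow> iso T (cl (FAss X Y Z))"
  "\<lbrakk>wf_wrd A B X; wf_wrd A B Y; wf_wrd A B Z\<rbrakk> \<Longrightarrow> inv_ar T (cl (FAss X Y Z)) = cl (FAssInv X Y Z)"
  "wf_wrd A B X \<Longrightarrow> iso T (cl (FR X))" "wf_wrd A B X \<Longrightarrow> inv_ar T (cl (FR X)) = cl (FRInv X)"
  "wf_wrd A B X \<Longrightarrow> iso T (cl (FL X))" "wf_wrd A B X \<Longrightarrow> inv_ar T (cl (FL X)) = cl (FLInv X)"
  using iso_cl[of "FAssInv X Y Z" "FAss X Y Z"] ass_inv1[of A B X Y Z] ass_inv2[of A B X Y Z]
    iso_cl[of "FRInv X" "FR X"] r_inv1[of A B X] r_inv2[of A B X]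
    iso_cl[of "FLInv X" "FL X"] l_inv1[of A B X] l_inv2[of A B X] by auto

text \<open>On representatives each axiom follows directly from a clause of the congruence. An exception is
  functoriality of the tensor in both variables at once: the tensor of two formal arrows whiskers
  first on the right and then on the left, so that two whiskerings in the middle have to be
  exchanged.\<close>

theorem sym_mon_cat_tensor: "sym_mon_cat T"
proof
  show "\<one>\<^bsub>T\<^esub> \<in> Obj T" by simp
next
  fix X Y Z W assume "X \<in> Obj T" "Y \<in> Obj T" "Z \<in> Obj T" "W \<in> Obj T"
  then have [simp]: "wf_wrd A B X" "wf_wrd A B Y" "wf_wrd A B Z" "wf_wrd A B W" by auto
  show "X \<otimes>\<^bsub>T\<^esub> Y \<in> Obj T" by simp
  show "ident T X \<diamondop>\<^bsub>T\<^esub> ident T Y = ident T (X \<otimes>\<^bsub>T\<^esub> Y)"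
    by (simp add: cl_whiskL cl_eqI[OF whiskL_id])
  show "ass T X Y Z \<in> hom T (X \<otimes>\<^bsub>T\<^esub> (Y \<otimes>\<^bsub>T\<^esub> Z)) ((X \<otimes>\<^bsub>T\<^esub> Y) \<otimes>\<^bsub>T\<^esub> Z)"
    "iso T (ass T X Y Z)"
    "runit T X \<in> hom T (X \<otimes>\<^bsub>T\<^esub> \<one>\<^bsub>T\<^esub>) X" "iso T (runit T X)"
    "lunit T X \<in> hom T (\<one>\<^bsub>T\<^esub> \<otimes>\<^bsub>T\<^esub> X) X" "iso T (lunit T X)"
    "swap T X Y \<in> hom T (X \<otimes>\<^bsub>T\<^esub> Y) (Y \<otimes>\<^bsub>T\<^esub> X)"
    by (simp_all add: hom_def)
  show "ass T (X \<otimes>\<^bsub>T\<^esub> Y) Z W \<cdot>\<^bsub>T\<^esub> ass T X Y (Z \<otimes>\<^bsub>T\<^esub> W) =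
      (ass T X Y Z \<diamondop>\<^bsub>T\<^esub> ident T W) \<cdot>\<^bsub>T\<^esub> ass T X (Y \<otimes>\<^bsub>T\<^esub> Z) W \<cdot>\<^bsub>T\<^esub> (ident T X \<diamondop>\<^bsub>T\<^esub> ass T Y Z W)"
    using cl_eqI[OF feq.pentagon, of X Y Z W] by (simp add: cl_whiskL cl_whiskR cl_comp)
  show "(runit T X \<diamondop>\<^bsub>T\<^esub> ident T Y) \<cdot>\<^bsub>T\<^esub> ass T X \<one>\<^bsub>T\<^esub> Y = ident T X \<diamondop>\<^bsub>T\<^esub> lunit T Y"
    using cl_eqI[OF feq.triangle, of X Y] by (simp add: cl_whiskL cl_whiskR cl_comp)
  show "swap T Y X \<cdot>\<^bsub>T\<^esub> swap T X Y = ident T (X \<otimes>\<^bsub>T\<^esub> Y)"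
    using cl_eqI[OF feq.s_s, of X Y] by (simp add: cl_comp)
  show "lunit T X \<cdot>\<^bsub>T\<^esub> swap T X \<one>\<^bsub>T\<^esub> = runit T X"
    using cl_eqI[OF feq.s_unit, of X] by (simp add: cl_comp)
  show "ass T Z X Y \<cdot>\<^bsub>T\<^esub> swap T (X \<otimes>\<^bsub>T\<^esub> Y) Z \<cdot>\<^bsub>T\<^esub> ass T X Y Z =
      (swap T X Z \<diamondop>\<^bsub>T\<^esub> ident T Y) \<cdot>\<^bsub>T\<^esub> ass T X Z Y \<cdot>\<^bsub>T\<^esub> (ident T X \<diamondop>\<^bsub>T\<^esub> swap T Y Z)"
    using cl_eqI[OF feq.hexagon, of X Y Z] by (simp add: cl_whiskL cl_whiskR cl_comp)
next
  fix P Q X X' Y Y' assume "P \<in> hom T X X'" "Q \<in> hom T Y Y'"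
  then obtain p q where p: "p \<in> fhom A B X X'" and P[simp]: "P = cl p"
    and q: "q \<in> fhom A B Y Y'" and Q[simp]: "Q = cl q" by (metis cl_hom_cases)
  then have [simp]: "wf_farrow A B p" "fdom A B p = X" "fcod A B p = X'" "wf_farrow A B q" "fdom A B q = Y" "fcod A B q = Y'"
    by (auto simp: fhom_def)
  then have [simp]: "wf_wrd A B X" "wf_wrd A B Y" "wf_wrd A B X'" "wf_wrd A B Y'"
    using wf_fdom_fcod[of p] wf_fdom_fcod[of q] by auto
  show "P \<diamondop>\<^bsub>T\<^esub> Q \<in> hom T (X \<otimes>\<^bsub>T\<^esub> Y) (X' \<otimes>\<^bsub>T\<^esub> Y')" by (simp add: cl_ten hom_def)
  show "runit T X' \<cdot>\<^bsub>T\<^esub> (P \<diamondop>\<^bsub>T\<^esub> ident T \<one>\<^bsub>T\<^esub>) = P \<cdot>\<^bsub>T\<^esub> runit T X"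
    using cl_eqI[OF r_nat[OF p]] by (simp add: cl_whiskR cl_comp)
  show "lunit T X' \<cdot>\<^bsub>T\<^esub> (ident T \<one>\<^bsub>T\<^esub> \<diamondop>\<^bsub>T\<^esub> P) = P \<cdot>\<^bsub>T\<^esub> lunit T X"
    using cl_eqI[OF l_nat[OF p]] by (simp add: cl_whiskL cl_comp)
  show "swap T X' Y' \<cdot>\<^bsub>T\<^esub> (P \<diamondop>\<^bsub>T\<^esub> Q) = (Q \<diamondop>\<^bsub>T\<^esub> P) \<cdot>\<^bsub>T\<^esub> swap T X Y"
    using cl_eqI[OF s_nat[OF p q]] by (simp add: cl_ten cl_comp)
  {
    fix R Z Z' assume "R \<in> hom T Z Z'"
    then obtain r where r: "r \<in> fhom A B Z Z'" and [simp]: "R = cl r" by (metis cl_hom_cases)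
    then have [simp]: "wf_farrow A B r" "fdom A B r = Z" "fcod A B r = Z'" by (auto simp: fhom_def)
    then have [simp]: "wf_wrd A B Z" "wf_wrd A B Z'" using wf_fdom_fcod[of r] by auto
    show "ass T X' Y' Z' \<cdot>\<^bsub>T\<^esub> (P \<diamondop>\<^bsub>T\<^esub> (Q \<diamondop>\<^bsub>T\<^esub> R)) = ((P \<diamondop>\<^bsub>T\<^esub> Q) \<diamondop>\<^bsub>T\<^esub> R) \<cdot>\<^bsub>T\<^esub> ass T X Y Z"
      using cl_eqI[OF feq.ass_nat[OF p q r]] by (simp add: cl_ten cl_comp)
  }
next
  fix P P' Q Q' X X' X'' Y Y' Y''
  assume "P \<in> hom T X X'" "P' \<in> hom T X' X''" "Q \<in> hom T Y Y'" "Q' \<in> hom T Y' Y''"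
  then obtain p p' q q' where p: "p \<in> fhom A B X X'" "p' \<in> fhom A B X' X''" and P: "P = cl p" "P' = cl p'"
    and q: "q \<in> fhom A B Y Y'" "q' \<in> fhom A B Y' Y''" and Q: "Q = cl q" "Q' = cl q'" by (metis cl_hom_cases)
  then have [simp]: "wf_farrow A B p" "fdom A B p = X" "fcod A B p = X'" "wf_farrow A B q" "fdom A B q = Y" "fcod A B q = Y'"
     "wf_farrow A B p'" "fdom A B p' = X'" "fcod A B p' = X''" "wf_farrow A B q'" "fdom A B q' = Y'" "fcod A B q' = Y''"
    by (auto simp: fhom_def)
  then have [simp]: "wf_wrd A B X" "wf_wrd A B Y" "wf_wrd A B X'" "wf_wrd A B Y'" "wf_wrd A B X''" "wf_wrd A B Y''"
    using wf_fdom_fcod[of p] wf_fdom_fcod[of q] wf_fdom_fcod[of p'] wf_fdom_fcod[of q'] by auto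
  note [simp] = P Q
  have "(P' \<cdot>\<^bsub>T\<^esub> P) \<diamondop>\<^bsub>T\<^esub> (Q' \<cdot>\<^bsub>T\<^esub> Q) = cl (X'' \<triangleright> (q' \<bullet> q)) \<cdot>\<^bsub>T\<^esub> cl ((p' \<bullet> p) \<triangleleft> Y)"
    by (simp add: cl_comp cl_ten ften_def)
  also have "\<dots> = (cl (X'' \<triangleright> q') \<cdot>\<^bsub>T\<^esub> cl (X'' \<triangleright> q)) \<cdot>\<^bsub>T\<^esub> (cl (p' \<triangleleft> Y) \<cdot>\<^bsub>T\<^esub> cl (p \<triangleleft> Y))"
    using cl_eqI[OF whiskL_comp[of A B X'', OF _ q]] cl_eqI[OF whiskR_comp[of A B Y, OF _ p]] by (simp add: cl_comp)
  also have "\<dots> = cl (X'' \<triangleright> q') \<cdot>\<^bsub>T\<^esub> (cl (X'' \<triangleright> q) \<cdot>\<^bsub>T\<^esub> cl (p' \<triangleleft> Y)) \<cdot>\<^bsub>T\<^esub> cl (p \<triangleleft> Y)" by simp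
  also have "cl (X'' \<triangleright> q) \<cdot>\<^bsub>T\<^esub> cl (p' \<triangleleft> Y) = cl (p' \<triangleleft> Y') \<cdot>\<^bsub>T\<^esub> cl (X' \<triangleright> q)"
    using cl_eqI[OF whisk_whisk[OF p(2) q(1)]] by (simp add: cl_comp)
  also have "cl (X'' \<triangleright> q') \<cdot>\<^bsub>T\<^esub> (cl (p' \<triangleleft> Y') \<cdot>\<^bsub>T\<^esub> cl (X' \<triangleright> q)) \<cdot>\<^bsub>T\<^esub> cl (p \<triangleleft> Y)
      = (cl (X'' \<triangleright> q') \<cdot>\<^bsub>T\<^esub> cl (p' \<triangleleft> Y')) \<cdot>\<^bsub>T\<^esub> (cl (X' \<triangleright> q) \<cdot>\<^bsub>T\<^esub> cl (p \<triangleleft> Y))" by simp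
  also have "\<dots> = (P' \<diamondop>\<^bsub>T\<^esub> Q') \<cdot>\<^bsub>T\<^esub> (P \<diamondop>\<^bsub>T\<^esub> Q)"
    by (simp add: cl_comp cl_ten ften_def)
  finally show "(P' \<cdot>\<^bsub>T\<^esub> P) \<diamondop>\<^bsub>T\<^esub> (Q' \<cdot>\<^bsub>T\<^esub> Q) = (P' \<diamondop>\<^bsub>T\<^esub> Q') \<cdot>\<^bsub>T\<^esub> (P \<diamondop>\<^bsub>T\<^esub> Q)" .
qed

end

section \<open>The functor \<open>\<eta>\<close>\<close>

context two_smcs
begin

sublocale Tm: sym_mon_cat T by (rule sym_mon_cat_tensor)

text \<open>The components of \<open>\<eta>\<close> are typed by the relations of the congruence: (ii) makes \<open>\<eta>(a)\<close> a symmetric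
  monoidal functor, (iv) makes \<open>f \<otimes> -\<close> a monoidal transformation, and (iv), (v), (vi) do the same
  for \<open>\<alpha>\<close> and \<open>\<gamma>\<close>.\<close>

lemma sm_functor_eta_ob:
  assumes [simp]: "a \<in> Obj A"
  shows "sm_functor B T (eta_ob A B a)"
proof
  let ?E = "eta_ob A B a"
  show "on_ob ?E \<in> extensional (Obj B)" "on_ar ?E \<in> extensional (Arr B)" by (simp_all add: eta_ob_def)
  show "f2 ?E x y = undefined" if "\<not> (x \<in> Obj B \<and> y \<in> Obj B)" for x y using that by (auto simp: eta_ob_def)
  show "f0 ?E \<in> hom T \<one>\<^bsub>T\<^esub> (on_ob ?E \<one>\<^bsub>B\<^esub>)" by (simp add: eta_ob_def hom_def)
next
  let ?E = "eta_ob A B a"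
  fix x y z assume [simp]: "x \<in> Obj B" "y \<in> Obj B" "z \<in> Obj B"
  show "on_ob ?E x \<in> Obj T" by (simp add: eta_ob_def)
  show "on_ar ?E (ident B x) = ident T (on_ob ?E x)"
    using cl_eqI[OF genR_id[of a A x B]] by (simp add: eta_ob_def)
  show "f2 ?E x y \<in> hom T (on_ob ?E x \<otimes>\<^bsub>T\<^esub> on_ob ?E y) (on_ob ?E (x \<otimes>\<^bsub>B\<^esub> y))"
    by (simp add: eta_ob_def hom_def)
  show "on_ar ?E (ass B x y z) \<cdot>\<^bsub>T\<^esub> f2 ?E x (y \<otimes>\<^bsub>B\<^esub> z) \<cdot>\<^bsub>T\<^esub> (ident T (on_ob ?E x) \<diamondop>\<^bsub>T\<^esub> f2 ?E y z) =
        f2 ?E (x \<otimes>\<^bsub>B\<^esub> y) z \<cdot>\<^bsub>T\<^esub> (f2 ?E x y \<diamondop>\<^bsub>T\<^esub> ident T (on_ob ?E z)) \<cdot>\<^bsub>T\<^esub> ass T (on_ob ?E x) (on_ob ?E y) (on_ob ?E z)"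
    using cl_eqI[OF delta_ass[of a A x B y z]] by (simp add: eta_ob_def cl_whiskL cl_whiskR cl_comp)
  show "on_ar ?E (runit B x) \<cdot>\<^bsub>T\<^esub> f2 ?E x \<one>\<^bsub>B\<^esub> \<cdot>\<^bsub>T\<^esub> (ident T (on_ob ?E x) \<diamondop>\<^bsub>T\<^esub> f0 ?E) = runit T (on_ob ?E x)"
    using cl_eqI[OF delta_r[of a A x B]] by (simp add: eta_ob_def cl_whiskL cl_comp)
  show "on_ar ?E (lunit B x) \<cdot>\<^bsub>T\<^esub> f2 ?E \<one>\<^bsub>B\<^esub> x \<cdot>\<^bsub>T\<^esub> (f0 ?E \<diamondop>\<^bsub>T\<^esub> ident T (on_ob ?E x)) = lunit T (on_ob ?E x)"
    using cl_eqI[OF delta_l[of a A x B]] by (simp add: eta_ob_def cl_whiskR cl_comp)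
  show "on_ar ?E (swap B x y) \<cdot>\<^bsub>T\<^esub> f2 ?E x y = f2 ?E y x \<cdot>\<^bsub>T\<^esub> swap T (on_ob ?E x) (on_ob ?E y)"
    using cl_eqI[OF delta_s[of a A x B y]] by (simp add: eta_ob_def cl_comp)
next
  let ?E = "eta_ob A B a"
  fix g x y assume g: "g \<in> hom B x y"
  note [simp] = B.homD[OF g]
  show "on_ar ?E g \<in> hom T (on_ob ?E x) (on_ob ?E y)" by (simp add: eta_ob_def hom_def)
  {
    fix h z assume h: "h \<in> hom B y z"
    note [simp] = B.homD[OF h]
    show "on_ar ?E (h \<cdot>\<^bsub>B\<^esub> g) = on_ar ?E h \<cdot>\<^bsub>T\<^esub> on_ar ?E g"
      using cl_eqI[OF genR_comp[OF assms g h]] by (simp add: eta_ob_def cl_comp)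
  next
    fix h x' y' assume h: "h \<in> hom B x' y'"
    note [simp] = B.homD[OF h]
    show "on_ar ?E (g \<diamondop>\<^bsub>B\<^esub> h) \<cdot>\<^bsub>T\<^esub> f2 ?E x x' = f2 ?E y y' \<cdot>\<^bsub>T\<^esub> (on_ar ?E g \<diamondop>\<^bsub>T\<^esub> on_ar ?E h)"
      using cl_eqI[OF delta_nat[OF assms g h]] by (simp add: eta_ob_def cl_comp cl_ten)
  }
qed

lemma two_cell_eta_ar:
  assumes f[simp]: "f \<in> Arr A"
  shows "two_cell B T (eta_ob A B (Dom A f)) (eta_ob A B (Cod A f)) (on_ar (eta A B) f)"
proof (intro two_cell.intro sm_functor_eta_ob two_cell_axioms.intro)
  let ?E = "eta_ob A B (Dom A f)" and ?E' = "eta_ob A B (Cod A f)" and ?t = "on_ar (eta A B) f"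
  show "src ?t = ?E" "tgt ?t = ?E'" "at ?t \<in> extensional (Obj B)" by (simp_all add: eta_def)
  show "at ?t x \<in> hom T (on_ob ?E x) (on_ob ?E' x)" if "x \<in> Obj B" for x
    using that by (simp add: eta_def eta_ob_def hom_def)
  show "at ?t y \<cdot>\<^bsub>T\<^esub> on_ar ?E g = on_ar ?E' g \<cdot>\<^bsub>T\<^esub> at ?t x" if "g \<in> hom B x y" for g x y
    using B.homD[OF that] cl_eqI[OF gen_nat[OF A.Arr_hom[OF f] that]] by (simp add: eta_def eta_ob_def cl_comp)
  show "at ?t \<one>\<^bsub>B\<^esub> \<cdot>\<^bsub>T\<^esub> f0 ?E = f0 ?E'"
    using cl_eqI[OF genL_beta[OF A.Arr_hom[OF f], of B]] by (simp add: eta_def eta_ob_def cl_comp)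
  show "at ?t (x \<otimes>\<^bsub>B\<^esub> y) \<cdot>\<^bsub>T\<^esub> f2 ?E x y = f2 ?E' x y \<cdot>\<^bsub>T\<^esub> (at ?t x \<diamondop>\<^bsub>T\<^esub> at ?t y)"
    if [simp]: "x \<in> Obj B" "y \<in> Obj B" for x y
    using cl_eqI[OF genL_delta[OF A.Arr_hom[OF f], of x B y]] by (simp add: eta_def eta_ob_def cl_comp cl_ten)
qed simp_all

lemma two_cell_eta_f0: "two_cell B T (smf_unit B T) (eta_ob A B \<one>\<^bsub>A\<^esub>) (f0 (eta A B))"
proof (intro two_cell.intro sm_functor_eta_ob sm_functor_smf_unit two_cell_axioms.intro)
  let ?E = "smf_unit B T" and ?E' = "eta_ob A B \<one>\<^bsub>A\<^esub>" and ?t = "f0 (eta A B)"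
  show "src ?t = ?E" "tgt ?t = ?E'" "at ?t \<in> extensional (Obj B)" by (simp_all add: eta_def)
  show "at ?t x \<in> hom T (on_ob ?E x) (on_ob ?E' x)" if "x \<in> Obj B" for x
    using that by (simp add: eta_def eta_ob_def smf_unit_def hom_def)
  show "at ?t y \<cdot>\<^bsub>T\<^esub> on_ar ?E g = on_ar ?E' g \<cdot>\<^bsub>T\<^esub> at ?t x" if g: "g \<in> hom B x y" for g x y
  proof -
    note [simp] = B.homD[OF g]
    have "cl (FAlpha y) \<cdot>\<^bsub>T\<^esub> cl (FId WI) = cl (FAlpha y)"
      using Tc.comp_ident_simp[of "cl (FAlpha y)"] by simp
    then show ?thesis
      using cl_eqI[OF genR_alpha[OF g, of A]] by (simp add: eta_def eta_ob_def smf_unit_def cl_comp)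
  qed
  have "cl (FAlpha \<one>\<^bsub>B\<^esub>) \<cdot>\<^bsub>T\<^esub> cl (FId WI) = cl (FAlpha \<one>\<^bsub>B\<^esub>)"
    using Tc.comp_ident_simp[of "cl (FAlpha \<one>\<^bsub>B\<^esub>)"] by simp
  then show "at ?t \<one>\<^bsub>B\<^esub> \<cdot>\<^bsub>T\<^esub> f0 ?E = f0 ?E'"
    using cl_eqI[OF beta_alpha[of A B]] by (simp add: eta_def eta_ob_def smf_unit_def)
  show "at ?t (x \<otimes>\<^bsub>B\<^esub> y) \<cdot>\<^bsub>T\<^esub> f2 ?E x y = f2 ?E' x y \<cdot>\<^bsub>T\<^esub> (at ?t x \<diamondop>\<^bsub>T\<^esub> at ?t y)"
    if [simp]: "x \<in> Obj B" "y \<in> Obj B" for x y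
    using cl_eqI[OF alpha_delta[of x B y A]] by (simp add: eta_def eta_ob_def smf_unit_def cl_comp cl_ten)
qed (simp_all add: A.sym_mon_cat_axioms B.sym_mon_cat_axioms sym_mon_cat_tensor)

lemma cl_finterchange:
  assumes [simp]: "wf_wrd A B W" "wf_wrd A B X" "wf_wrd A B Y" "wf_wrd A B Z"
  shows "interchange T W X Y Z = cl (finterchange W X Y Z)"
  by (simp add: interchange_def finterchange_def cl_comp cl_whiskL cl_whiskR)

text \<open>Compatibility of \<open>\<gamma>\<close> with tensors has an interchange on the side of the \<open>\<delta>\<close>, since these belong to
  \<open>\<eta>(a) \<box> \<eta>(a')\<close>, whereas relation (vi) has one on the side of the \<open>\<gamma>\<close>. The two forms agree because
  the interchanges are mutually inverse.\<close>

lemma two_cell_eta_f2: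
  assumes [simp]: "a \<in> Obj A" "a' \<in> Obj A"
  shows "two_cell B T (smf_ten B T (eta_ob A B a) (eta_ob A B a')) (eta_ob A B (a \<otimes>\<^bsub>A\<^esub> a')) (f2 (eta A B) a a')"
proof (intro two_cell.intro sm_functor_eta_ob sm_functor_smf_ten two_cell_axioms.intro)
  let ?E = "smf_ten B T (eta_ob A B a) (eta_ob A B a')" and ?E' = "eta_ob A B (a \<otimes>\<^bsub>A\<^esub> a')" and ?t = "f2 (eta A B) a a'"
  show "src ?t = ?E" "tgt ?t = ?E'" "at ?t \<in> extensional (Obj B)" by (simp_all add: eta_def)
  show "at ?t x \<in> hom T (on_ob ?E x) (on_ob ?E' x)" if "x \<in> Obj B" for x
    using that by (simp add: eta_def eta_ob_def smf_ten_def hom_def)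
  show "at ?t y \<cdot>\<^bsub>T\<^esub> on_ar ?E g = on_ar ?E' g \<cdot>\<^bsub>T\<^esub> at ?t x" if g: "g \<in> hom B x y" for g x y
    using cl_eqI[OF genR_gamma[OF g, of a A a']] B.homD[OF g]
    by (simp add: eta_def eta_ob_def smf_ten_def cl_comp cl_ten)
  have "at ?t \<one>\<^bsub>B\<^esub> \<cdot>\<^bsub>T\<^esub> f0 ?E
     = (cl (FGamma a a' \<one>\<^bsub>B\<^esub>) \<cdot>\<^bsub>T\<^esub> cl (ften A B (FBeta a) (FBeta a'))) \<cdot>\<^bsub>T\<^esub> cl (FRInv WI)"
    by (simp add: eta_def eta_ob_def smf_ten_def cl_ten)
  also have "\<dots> = (cl (FBeta (a \<otimes>\<^bsub>A\<^esub> a')) \<cdot>\<^bsub>T\<^esub> cl (FR WI)) \<cdot>\<^bsub>T\<^esub> cl (FRInv WI)"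
    using cl_eqI[OF beta_gamma[of a A a' B]] by (simp add: cl_comp)
  also have "\<dots> = cl (FBeta (a \<otimes>\<^bsub>A\<^esub> a')) \<cdot>\<^bsub>T\<^esub> (cl (FR WI) \<cdot>\<^bsub>T\<^esub> cl (FRInv WI))"
    by simp
  also have "cl (FR WI) \<cdot>\<^bsub>T\<^esub> cl (FRInv WI) = ident T WI"
    using cl_eqI[OF r_inv2[of A B WI]] by (simp add: cl_comp)
  also have "cl (FBeta (a \<otimes>\<^bsub>A\<^esub> a')) \<cdot>\<^bsub>T\<^esub> ident T WI = f0 ?E'"
    using Tc.comp_ident_simp[of "cl (FBeta (a \<otimes>\<^bsub>A\<^esub> a'))"] by (simp add: eta_ob_def)
  finally show "at ?t \<one>\<^bsub>B\<^esub> \<cdot>\<^bsub>T\<^esub> f0 ?E = f0 ?E'" .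
  fix x y assume [simp]: "x \<in> Obj B" "y \<in> Obj B"
  let ?i = "interchange T (WGen a x) (WGen a' x) (WGen a y) (WGen a' y)"
  let ?j = "interchange T (WGen a x) (WGen a y) (WGen a' x) (WGen a' y)"
  have "at ?t (x \<otimes>\<^bsub>B\<^esub> y) \<cdot>\<^bsub>T\<^esub> f2 ?E x y = cl (FGamma a a' (x \<otimes>\<^bsub>B\<^esub> y)) \<cdot>\<^bsub>T\<^esub> cl (ften A B (FDelta a x y) (FDelta a' x y)) \<cdot>\<^bsub>T\<^esub> ?i"
    by (simp add: eta_def eta_ob_def smf_ten_def cl_ten)
  also have "\<dots> = (cl (FGamma a a' (x \<otimes>\<^bsub>B\<^esub> y)) \<cdot>\<^bsub>T\<^esub> cl (ften A B (FDelta a x y) (FDelta a' x y))) \<cdot>\<^bsub>T\<^esub> ?i"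
    by simp
  also have "\<dots> = (cl (FDelta (a \<otimes>\<^bsub>A\<^esub> a') x y) \<cdot>\<^bsub>T\<^esub> cl (ften A B (FGamma a a' x) (FGamma a a' y)) \<cdot>\<^bsub>T\<^esub> ?j) \<cdot>\<^bsub>T\<^esub> ?i"
    using cl_eqI[OF gamma_delta[of a A a' x B y]] by (simp add: cl_comp cl_finterchange finterchange_def)
  also have "\<dots> = cl (FDelta (a \<otimes>\<^bsub>A\<^esub> a') x y) \<cdot>\<^bsub>T\<^esub> cl (ften A B (FGamma a a' x) (FGamma a a' y)) \<cdot>\<^bsub>T\<^esub> (?j \<cdot>\<^bsub>T\<^esub> ?i)"
    by simp
  also have "?j \<cdot>\<^bsub>T\<^esub> ?i = ident T ((WGen a x \<odot> WGen a' x) \<odot> (WGen a y \<odot> WGen a' y))"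
    by (subst Tm.interchange_interchange) simp_all
  also have "cl (FDelta (a \<otimes>\<^bsub>A\<^esub> a') x y) \<cdot>\<^bsub>T\<^esub> cl (ften A B (FGamma a a' x) (FGamma a a' y)) \<cdot>\<^bsub>T\<^esub> \<dots>
      = f2 ?E' x y \<cdot>\<^bsub>T\<^esub> (at ?t x \<diamondop>\<^bsub>T\<^esub> at ?t y)"
    by (subst Tc.comp_ident_simp) (simp_all add: eta_def eta_ob_def cl_ten)
  finally show "at ?t (x \<otimes>\<^bsub>B\<^esub> y) \<cdot>\<^bsub>T\<^esub> f2 ?E x y = f2 ?E' x y \<cdot>\<^bsub>T\<^esub> (at ?t x \<diamondop>\<^bsub>T\<^esub> at ?t y)" .
qed (simp_all add: A.sym_mon_cat_axioms B.sym_mon_cat_axioms sym_mon_cat_tensor)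

end

section \<open>The induced functor\<close>

lemma hom_ihom: "\<theta> \<in> hom (ihom B C) F G \<longleftrightarrow> two_cell B C F G \<theta>"
  by (auto simp: hom_def ihom_def two_cell.src two_cell.tgt)

locale three_smcs = two_smcs A B + C: sym_mon_cat C
  for A :: "('a, 'f, 'x) smcat_scheme" and B :: "('b, 'g, 'y) smcat_scheme" and C :: "('c, 'k, 'z) smcat_scheme"

locale functor_to_ihom = three_smcs A B C + F: sm_functor A "ihom B C" F
  for A :: "('a, 'f, 'x) smcat_scheme" and B :: "('b, 'g, 'y) smcat_scheme" and C :: "('c, 'k, 'z) smcat_scheme" and F
begin

abbreviation ob where "ob \<equiv> eval_ob C F"
abbreviation ar where "ar \<equiv> eval_ar C F"

lemma smf_between_F: "a \<in> Obj A \<Longrightarrow> smf_between B C (on_ob F a)"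
  using F.on_ob[of a] B.sym_mon_cat_axioms C.sym_mon_cat_axioms by (simp add: ihom_def smf_between_def)

lemma sm_functor_F: "a \<in> Obj A \<Longrightarrow> sm_functor B C (on_ob F a)"
  using F.on_ob[of a] by (simp add: ihom_def)

lemma two_cell_F_ar: "f \<in> Arr A \<Longrightarrow> two_cell B C (on_ob F (Dom A f)) (on_ob F (Cod A f)) (on_ar F f)"
  using F.on_ar[OF A.Arr_hom] by (simp add: hom_ihom)

lemma two_cell_F_f0: "two_cell B C (smf_unit B C) (on_ob F \<one>\<^bsub>A\<^esub>) (f0 F)"
  using F.f0_hom by (simp add: hom_ihom) (simp add: ihom_def)

lemma two_cell_F_f2:
  "\<lbrakk>a \<in> Obj A; a' \<in> Obj A\<rbrakk>
   \<Longrightarrow> two_cell B C (smf_ten B C (on_ob F a) (on_ob F a')) (on_ob F (a \<otimes>\<^bsub>A\<^esub> a')) (f2 F a a')"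
  using F.f2_hom by (simp add: hom_ihom) (simp add: ihom_def)

lemmas F_type [simp] =
  smf_between.axioms(3)[OF smf_between_F, THEN sm_functor.on_ob]
  smf_between.on_ar_type[OF smf_between_F]
  smf_between.structure_type[OF smf_between_F]

lemma at_type [simp]:
  shows "\<lbrakk>f \<in> Arr A; b \<in> Obj B\<rbrakk> \<Longrightarrow> at (on_ar F f) b \<in> Arr C"
    and "\<lbrakk>f \<in> Arr A; b \<in> Obj B\<rbrakk> \<Longrightarrow> Dom C (at (on_ar F f) b) = on_ob (on_ob F (Dom A f)) b"
    and "\<lbrakk>f \<in> Arr A; b \<in> Obj B\<rbrakk> \<Longrightarrow> Cod C (at (on_ar F f) b) = on_ob (on_ob F (Cod A f)) b"
    and "b \<in> Obj B \<Longrightarrow> at (f0 F) b \<in> Arr C"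
    and "b \<in> Obj B \<Longrightarrow> Dom C (at (f0 F) b) = \<one>\<^bsub>C\<^esub>"
    and "b \<in> Obj B \<Longrightarrow> Cod C (at (f0 F) b) = on_ob (on_ob F \<one>\<^bsub>A\<^esub>) b"
    and "\<lbrakk>a \<in> Obj A; a' \<in> Obj A; b \<in> Obj B\<rbrakk> \<Longrightarrow> at (f2 F a a') b \<in> Arr C"
    and "\<lbrakk>a \<in> Obj A; a' \<in> Obj A; b \<in> Obj B\<rbrakk>
      \<Longrightarrow> Dom C (at (f2 F a a') b) = on_ob (on_ob F a) b \<otimes>\<^bsub>C\<^esub> on_ob (on_ob F a') b"
    and "\<lbrakk>a \<in> Obj A; a' \<in> Obj A; b \<in> Obj B\<rbrakk> \<Longrightarrow> Cod C (at (f2 F a a') b) = on_ob (on_ob F (a \<otimes>\<^bsub>A\<^esub> a')) b"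
  using two_cell.at_hom[OF two_cell_F_ar, of f b] two_cell.at_hom[OF two_cell_F_f0, of b]
    two_cell.at_hom[OF two_cell_F_f2, of a a' b]
  by (auto simp: hom_def smf_unit_def smf_ten_def)

lemma ob_Obj [simp]: "wf_wrd A B X \<Longrightarrow> ob X \<in> Obj C"
  by (induction X) auto

lemma ar_type [simp]:
  assumes "wf_farrow A B p"
  shows "ar p \<in> Arr C" "Dom C (ar p) = ob (fdom A B p)" "Cod C (ar p) = ob (fcod A B p)"
proof -
  have "ar p \<in> Arr C \<and> Dom C (ar p) = ob (fdom A B p) \<and> Cod C (ar p) = ob (fcod A B p)"
    using assms by (induction p) auto
  then show "ar p \<in> Arr C" "Dom C (ar p) = ob (fdom A B p)" "Cod C (ar p) = ob (fcod A B p)" by auto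
qed

lemma ar_ften [simp]: "\<lbrakk>wf_farrow A B p; wf_farrow A B q\<rbrakk> \<Longrightarrow> ar (ften A B p q) = ar p \<diamondop>\<^bsub>C\<^esub> ar q"
  by (simp add: ften_def)

lemma ar_finterchange [simp]: "ar (finterchange W X Y Z) = interchange C (ob W) (ob X) (ob Y) (ob Z)"
  by (simp add: finterchange_def interchange_def)

text \<open>The axioms for \<open>F\<close> are equations in \<open>[B, C]\<close>. Their components at an object \<open>b\<close> are the relations
  (iii), interpreted in \<open>C\<close>.\<close>

lemma at_ident: "\<lbrakk>a \<in> Obj A; b \<in> Obj B\<rbrakk> \<Longrightarrow> at (on_ar F (ident A a)) b = ident C (on_ob (on_ob F a) b)"
  by (simp add: F.on_ident) (simp add: ihom_def)

lemma at_comp: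
  assumes "f \<in> hom A x y" "g \<in> hom A y z" "b \<in> Obj B"
  shows "at (on_ar F (g \<cdot>\<^bsub>A\<^esub> f)) b = at (on_ar F g) b \<cdot>\<^bsub>C\<^esub> at (on_ar F f) b"
  using assms(3) by (simp add: F.on_comp[OF assms(1,2)]) (simp add: ihom_def)

lemma at_f2_nat:
  assumes f: "f \<in> hom A x x'" and g: "g \<in> hom A y y'" and b: "b \<in> Obj B"
  shows "at (on_ar F (f \<diamondop>\<^bsub>A\<^esub> g)) b \<cdot>\<^bsub>C\<^esub> at (f2 F x y) b =
    at (f2 F x' y') b \<cdot>\<^bsub>C\<^esub> (at (on_ar F f) b \<diamondop>\<^bsub>C\<^esub> at (on_ar F g) b)"
  using arg_cong[OF F.f2_nat[OF f g], of "\<lambda>t. at t b"] b by (simp add: ihom_def)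

lemma at_f2_ass:
  assumes "x \<in> Obj A" "y \<in> Obj A" "z \<in> Obj A" "b \<in> Obj B"
  shows "at (on_ar F (ass A x y z)) b \<cdot>\<^bsub>C\<^esub> at (f2 F x (y \<otimes>\<^bsub>A\<^esub> z)) b \<cdot>\<^bsub>C\<^esub>
           (ident C (on_ob (on_ob F x) b) \<diamondop>\<^bsub>C\<^esub> at (f2 F y z) b) =
         at (f2 F (x \<otimes>\<^bsub>A\<^esub> y) z) b \<cdot>\<^bsub>C\<^esub> (at (f2 F x y) b \<diamondop>\<^bsub>C\<^esub> ident C (on_ob (on_ob F z) b)) \<cdot>\<^bsub>C\<^esub>
           ass C (on_ob (on_ob F x) b) (on_ob (on_ob F y) b) (on_ob (on_ob F z) b)"
  using arg_cong[OF F.f2_ass[OF assms(1-3)], of "\<lambda>t. at t b"] assms(4) by (simp add: ihom_def)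

lemma at_f2_runit:
  assumes "x \<in> Obj A" "b \<in> Obj B"
  shows "at (on_ar F (runit A x)) b \<cdot>\<^bsub>C\<^esub> at (f2 F x \<one>\<^bsub>A\<^esub>) b \<cdot>\<^bsub>C\<^esub>
           (ident C (on_ob (on_ob F x) b) \<diamondop>\<^bsub>C\<^esub> at (f0 F) b) = runit C (on_ob (on_ob F x) b)"
  using arg_cong[OF F.f2_runit[OF assms(1)], of "\<lambda>t. at t b"] assms(2) by (simp add: ihom_def)

lemma at_f2_lunit:
  assumes "x \<in> Obj A" "b \<in> Obj B"
  shows "at (on_ar F (lunit A x)) b \<cdot>\<^bsub>C\<^esub> at (f2 F \<one>\<^bsub>A\<^esub> x) b \<cdot>\<^bsub>C\<^esub>
           (at (f0 F) b \<diamondop>\<^bsub>C\<^esub> ident C (on_ob (on_ob F x) b)) = lunit C (on_ob (on_ob F x) b)"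
  using arg_cong[OF F.f2_lunit[OF assms(1)], of "\<lambda>t. at t b"] assms(2) by (simp add: ihom_def)

lemma at_f2_swap:
  assumes "x \<in> Obj A" "y \<in> Obj A" "b \<in> Obj B"
  shows "at (on_ar F (swap A x y)) b \<cdot>\<^bsub>C\<^esub> at (f2 F x y) b =
    at (f2 F y x) b \<cdot>\<^bsub>C\<^esub> swap C (on_ob (on_ob F x) b) (on_ob (on_ob F y) b)"
  using arg_cong[OF F.f2_swap[OF assms(1,2)], of "\<lambda>t. at t b"] assms(3) by (simp add: ihom_def)

text \<open>The relations (ii) hold because each \<open>F a\<close> is a symmetric monoidal functor, (iii) because \<open>F\<close> is
  one, and (iv), (v) and (vi) because the values of \<open>F\<close> on arrows and its structure arrows are
  monoidal natural transformations.\<close>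

lemma feq_ar: "feq A B p q \<Longrightarrow> ar p = ar q"
proof (induction rule: feq.induct)
  case (cong_comp p p' q q')
  then show ?case by simp
next
  case (comp_id p X Y)
  then show ?case by (auto simp: fhom_def)
next
  case (id_comp p X Y)
  then show ?case by (auto simp: fhom_def)
next
  case (assoc p X Y q Z r W)
  then show ?case by (auto simp: fhom_def)
next
  case (whiskL_comp X p Y Z q W)
  then show ?case by (auto simp: fhom_def)
next
  case (whiskR_comp X p Y Z q W)
  then show ?case by (auto simp: fhom_def)
next
  case (whisk_whisk p X X' q Y Y')
  then show ?case by (auto simp: fhom_def)
next
  case (ass_nat p X X' q Y Y' r Z Z')
  then show ?case using C.ass_nat_simp[of "ar p" "ar q" "ar r"] by (auto simp: fhom_def)
next
  case (r_nat p X Y)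
  then show ?case using C.runit_nat[OF C.Arr_hom, of "ar p"] by (auto simp: fhom_def)
next
  case (l_nat p X Y)
  then show ?case using C.lunit_nat[OF C.Arr_hom, of "ar p"] by (auto simp: fhom_def)
next
  case (s_nat p X X' q Y Y')
  then show ?case using C.swap_nat[OF C.Arr_hom C.Arr_hom, of "ar p" "ar q"] by (auto simp: fhom_def)
next
  case (pentagon X Y Z W)
  then show ?case by (simp add: C.pentagon)
next
  case (triangle X Y)
  then show ?case by (simp add: C.triangle)
next
  case (s_unit X)
  then show ?case by (simp add: C.swap_unit)
next
  case (hexagon X Y Z)
  then show ?case by (simp add: C.hexagon)
next
  case (genR_id a b)
  then show ?case by (simp add: sm_functor.on_ident[OF sm_functor_F])
next
  case (genR_comp a g b b' h b'')
  then show ?case by (simp add: sm_functor.on_comp[OF sm_functor_F])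
next
  case (delta_nat a g b c h b' c')
  then show ?case
    using B.homD[OF delta_nat(2)] B.homD[OF delta_nat(3)] by (simp add: sm_functor.f2_nat[OF sm_functor_F])
next
  case (delta_ass a b b' b'')
  then show ?case by (simp add: sm_functor.f2_ass[OF sm_functor_F])
next
  case (delta_r a b)
  then show ?case by (simp add: sm_functor.f2_runit[OF sm_functor_F])
next
  case (delta_l a b)
  then show ?case by (simp add: sm_functor.f2_lunit[OF sm_functor_F])
next
  case (delta_s a b b')
  then show ?case by (simp add: sm_functor.f2_swap[OF sm_functor_F])
next
  case (genL_id a b)
  then show ?case by (simp add: at_ident)
next
  case (genL_comp b f a a' h a'')
  then show ?case by (simp add: at_comp)
next
  case (gamma_nat b f a c h a' c')
  then show ?case using A.homD[OF gamma_nat(2)] A.homD[OF gamma_nat(3)] by (simp add: at_f2_nat)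
next
  case (gamma_ass b a a' a'')
  then show ?case by (simp add: at_f2_ass)
next
  case (gamma_r b a)
  then show ?case by (simp add: at_f2_runit)
next
  case (gamma_l b a)
  then show ?case by (simp add: at_f2_lunit)
next
  case (gamma_s b a a')
  then show ?case by (simp add: at_f2_swap)
next
  case (gen_nat f a a' g b b')
  then show ?case using A.homD[OF gen_nat(1)] two_cell.at_nat[OF two_cell_F_ar, of f g b b'] by simp
next
  case (genL_beta f a a')
  then show ?case using A.homD[OF genL_beta] two_cell.at_unit[OF two_cell_F_ar, of f] by simp
next
  case (genL_delta f a a' b b')
  then show ?case using A.homD[OF genL_delta(1)] two_cell.at_ten[OF two_cell_F_ar, of f b b'] by simp
next
  case (genR_alpha g b b')
  then show ?case using B.homD[OF genR_alpha] two_cell.at_nat[OF two_cell_F_f0 genR_alpha] by (simp add: smf_unit_def)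
next
  case (genR_gamma g b b' a a')
  then show ?case using B.homD[OF genR_gamma(1)] two_cell.at_nat[OF two_cell_F_f2[of a a'] genR_gamma(1)]
    by (simp add: smf_ten_def)
next
  case (alpha_delta b b')
  then show ?case using two_cell.at_ten[OF two_cell_F_f0, of b b'] by (simp add: smf_unit_def)
next
  case (beta_gamma a a')
  then have [simp]: "a \<in> Obj A" "a' \<in> Obj A" by auto
  \<comment> \<open>\<open>(F a \<box> F a')\<^sup>0\<close> begins with \<open>r\<^sub>I\<inverse>\<close>, which cancels against the canonical arrow of the relation.\<close>
  have "f0 (on_ob F (a \<otimes>\<^bsub>A\<^esub> a')) \<cdot>\<^bsub>C\<^esub> runit C \<one>\<^bsub>C\<^esub>
     = (at (f2 F a a') \<one>\<^bsub>B\<^esub> \<cdot>\<^bsub>C\<^esub> (f0 (on_ob F a) \<diamondop>\<^bsub>C\<^esub> f0 (on_ob F a')) \<cdot>\<^bsub>C\<^esub> inv_ar C (runit C \<one>\<^bsub>C\<^esub>)) \<cdot>\<^bsub>C\<^esub> runit C \<one>\<^bsub>C\<^esub>"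
    using two_cell.at_unit[OF two_cell_F_f2[of a a']] by (simp add: smf_ten_def)
  then show ?case by simp
next
  case beta_alpha
  show ?case using two_cell.at_unit[OF two_cell_F_f0] by (simp add: smf_unit_def)
next
  case (gamma_delta a a' b b')
  then have [simp]: "a \<in> Obj A" "a' \<in> Obj A" "b \<in> Obj B" "b' \<in> Obj B" by auto
  let ?F = "\<lambda>a b. on_ob (on_ob F a) b"
  let ?i = "interchange C (?F a b) (?F a' b) (?F a b') (?F a' b')"
  let ?j = "interchange C (?F a b) (?F a b') (?F a' b) (?F a' b')"
  let ?d = "f2 (on_ob F a) b b' \<diamondop>\<^bsub>C\<^esub> f2 (on_ob F a') b b'"
  \<comment> \<open>The interchange is moved from the side of \<open>F\<^sup>2\<close> to the side of \<open>(F a)\<^sup>2\<close> by inserting \<open>?i \<cdot> ?j = 1\<close>.\<close>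
  have "at (f2 F a a') (b \<otimes>\<^bsub>B\<^esub> b') \<cdot>\<^bsub>C\<^esub> ?d = (at (f2 F a a') (b \<otimes>\<^bsub>B\<^esub> b') \<cdot>\<^bsub>C\<^esub> ?d \<cdot>\<^bsub>C\<^esub> ?i) \<cdot>\<^bsub>C\<^esub> ?j"
    by (simp add: C.interchange_interchange)
  also have "\<dots> = (f2 (on_ob F (a \<otimes>\<^bsub>A\<^esub> a')) b b' \<cdot>\<^bsub>C\<^esub> (at (f2 F a a') b \<diamondop>\<^bsub>C\<^esub> at (f2 F a a') b')) \<cdot>\<^bsub>C\<^esub> ?j"
    using two_cell.at_ten[OF two_cell_F_f2[of a a'], of b b'] by (simp add: smf_ten_def)
  finally show ?case by simp
qed simp_all

lemma bar_ob [simp]: "wf_wrd A B X \<Longrightarrow> on_ob (bar A B C F) X = ob X"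
  by (simp add: bar_def)

lemma bar_ar [simp]: "wf_farrow A B p \<Longrightarrow> on_ar (bar A B C F) (cl p) = ar p"
  using feq_ar[OF feq_frep[of p]] by (simp add: bar_def)

lemma bar_structure [simp]:
  "f0 (bar A B C F) = ident C \<one>\<^bsub>C\<^esub>"
  "\<lbrakk>wf_wrd A B X; wf_wrd A B Y\<rbrakk> \<Longrightarrow> f2 (bar A B C F) X Y = ident C (ob X \<otimes>\<^bsub>C\<^esub> ob Y)"
  by (simp_all add: bar_def)

theorem strict_sm_functor_bar: "strict_sm_functor T C (bar A B C F)"
proof
  let ?H = "bar A B C F"
  show "on_ob ?H \<in> extensional (Obj T)" "on_ar ?H \<in> extensional (Arr T)" by (simp_all add: bar_def)
  show "f2 ?H x y = undefined" if "\<not> (x \<in> Obj T \<and> y \<in> Obj T)" for x y using that by (auto simp: bar_def)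
  show "f0 ?H \<in> hom C \<one>\<^bsub>C\<^esub> (on_ob ?H \<one>\<^bsub>T\<^esub>)" "f0 ?H = ident C \<one>\<^bsub>C\<^esub>" by (simp_all add: hom_def)
next
  let ?H = "bar A B C F"
  fix X Y Z assume "X \<in> Obj T" "Y \<in> Obj T" "Z \<in> Obj T"
  then have [simp]: "wf_wrd A B X" "wf_wrd A B Y" "wf_wrd A B Z" by auto
  show "on_ob ?H X \<in> Obj C" "on_ar ?H (ident T X) = ident C (on_ob ?H X)"
    "f2 ?H X Y \<in> hom C (on_ob ?H X \<otimes>\<^bsub>C\<^esub> on_ob ?H Y) (on_ob ?H (X \<otimes>\<^bsub>T\<^esub> Y))"
    "on_ar ?H (ass T X Y Z) \<cdot>\<^bsub>C\<^esub> f2 ?H X (Y \<otimes>\<^bsub>T\<^esub> Z) \<cdot>\<^bsub>C\<^esub> (ident C (on_ob ?H X) \<diamondop>\<^bsub>C\<^esub> f2 ?H Y Z) =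
     f2 ?H (X \<otimes>\<^bsub>T\<^esub> Y) Z \<cdot>\<^bsub>C\<^esub> (f2 ?H X Y \<diamondop>\<^bsub>C\<^esub> ident C (on_ob ?H Z)) \<cdot>\<^bsub>C\<^esub> ass C (on_ob ?H X) (on_ob ?H Y) (on_ob ?H Z)"
    "on_ar ?H (runit T X) \<cdot>\<^bsub>C\<^esub> f2 ?H X \<one>\<^bsub>T\<^esub> \<cdot>\<^bsub>C\<^esub> (ident C (on_ob ?H X) \<diamondop>\<^bsub>C\<^esub> f0 ?H) = runit C (on_ob ?H X)"
    "on_ar ?H (lunit T X) \<cdot>\<^bsub>C\<^esub> f2 ?H \<one>\<^bsub>T\<^esub> X \<cdot>\<^bsub>C\<^esub> (f0 ?H \<diamondop>\<^bsub>C\<^esub> ident C (on_ob ?H X)) = lunit C (on_ob ?H X)"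
    "on_ar ?H (swap T X Y) \<cdot>\<^bsub>C\<^esub> f2 ?H X Y = f2 ?H Y X \<cdot>\<^bsub>C\<^esub> swap C (on_ob ?H X) (on_ob ?H Y)"
    "f2 ?H X Y = ident C (on_ob ?H X \<otimes>\<^bsub>C\<^esub> on_ob ?H Y)"
    by (simp_all add: hom_def)
next
  let ?H = "bar A B C F"
  fix P X X' assume "P \<in> hom T X X'"
  then obtain p where p: "p \<in> fhom A B X X'" and [simp]: "P = cl p" by (rule cl_hom_cases)
  then have [simp]: "wf_farrow A B p" "fdom A B p = X" "fcod A B p = X'" by (auto simp: fhom_def)
  then have [simp]: "wf_wrd A B X" "wf_wrd A B X'" using wf_fdom_fcod[of p] by auto
  show "on_ar ?H P \<in> hom C (on_ob ?H X) (on_ob ?H X')" by (simp add: hom_def)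
  fix Q
  show "on_ar ?H (Q \<cdot>\<^bsub>T\<^esub> P) = on_ar ?H Q \<cdot>\<^bsub>C\<^esub> on_ar ?H P" if "Q \<in> hom T X' Z" for Z
  proof -
    from that obtain q where q: "q \<in> fhom A B X' Z" and [simp]: "Q = cl q" by (rule cl_hom_cases)
    then have [simp]: "wf_farrow A B q" "fdom A B q = X'" "fcod A B q = Z" by (auto simp: fhom_def)
    show ?thesis by (simp add: cl_comp)
  qed
  show "on_ar ?H (P \<diamondop>\<^bsub>T\<^esub> Q) \<cdot>\<^bsub>C\<^esub> f2 ?H X Y = f2 ?H X' Y' \<cdot>\<^bsub>C\<^esub> (on_ar ?H P \<diamondop>\<^bsub>C\<^esub> on_ar ?H Q)" if "Q \<in> hom T Y Y'" for Y Y'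
  proof -
    from that obtain q where q: "q \<in> fhom A B Y Y'" and [simp]: "Q = cl q" by (rule cl_hom_cases)
    then have [simp]: "wf_farrow A B q" "fdom A B q = Y" "fcod A B q = Y'" by (auto simp: fhom_def)
    then have [simp]: "wf_wrd A B Y" "wf_wrd A B Y'" using wf_fdom_fcod[of q] by auto
    show ?thesis by (simp add: cl_ten)
  qed
qed

end

section \<open>Existence and uniqueness\<close>

text \<open>The composite \<open>[B, H] \<circ> \<eta>\<close>. On strict functors this operation is inverse to \<open>bar\<close>.\<close>

definition restrict_along_eta where
  "restrict_along_eta A B C H = smf_comp A (ihom B C) (ihom_post B (tensor A B) C H) (eta A B)"

context three_smcs
begin

abbreviation restr where "restr \<equiv> restrict_along_eta A B C"

text \<open>The operations of \<open>[B, H]\<close> are specified on objects and arrows of \<open>[B, A \<otimes> B]\<close> only, hence these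
  memberships are needed whenever \<open>[B, H] \<circ> \<eta>\<close> is evaluated.\<close>

lemma eta_in_ihom [simp]:
  shows "a \<in> Obj A \<Longrightarrow> on_ob (eta A B) a \<in> Obj (ihom B T)"
    and "f \<in> Arr A \<Longrightarrow> on_ar (eta A B) f \<in> Arr (ihom B T)"
    and "f0 (eta A B) \<in> Arr (ihom B T)"
    and "\<lbrakk>a \<in> Obj A; a' \<in> Obj A\<rbrakk> \<Longrightarrow> f2 (eta A B) a a' \<in> Arr (ihom B T)"
  using sm_functor_eta_ob[of a] hom_ihom[of "on_ar (eta A B) f" B T] two_cell_eta_ar[of f]
    hom_ihom[of "f0 (eta A B)" B T] two_cell_eta_f0 hom_ihom[of "f2 (eta A B) a a'" B T] two_cell_eta_f2[of a a']
  by (auto simp: hom_def) (auto simp: ihom_def eta_def)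

lemma restr_ext: "on_ob (restr H) \<in> extensional (Obj A)" "on_ar (restr H) \<in> extensional (Arr A)"
    "\<not> (x \<in> Obj A \<and> y \<in> Obj A) \<Longrightarrow> f2 (restr H) x y = undefined"
  by (auto simp: restrict_along_eta_def smf_comp_def)

context
  fixes H assumes H: "strict_sm_functor T C H"
begin

interpretation H: smf_between T C H
  using H C.sym_mon_cat_axioms sym_mon_cat_tensor by (simp add: smf_between_def strict_sm_functor_def)

lemma strict_on_ob:
  "on_ob H WI = \<one>\<^bsub>C\<^esub>" "\<lbrakk>wf_wrd A B X; wf_wrd A B Y\<rbrakk> \<Longrightarrow> on_ob H (X \<odot> Y) = on_ob H X \<otimes>\<^bsub>C\<^esub> on_ob H Y"
proof -
  have "Cod C (f0 H) = \<one>\<^bsub>C\<^esub>" using strict_sm_functor.f0_strict[OF H] by simp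
  then show "on_ob H WI = \<one>\<^bsub>C\<^esub>" by simp
  assume [simp]: "wf_wrd A B X" "wf_wrd A B Y"
  have "Cod C (f2 H X Y) = on_ob H X \<otimes>\<^bsub>C\<^esub> on_ob H Y"
    using strict_sm_functor.f2_strict[OF H, of X Y] H.on_ob[of X] H.on_ob[of Y] by simp
  then show "on_ob H (X \<odot> Y) = on_ob H X \<otimes>\<^bsub>C\<^esub> on_ob H Y" by simp
qed

text \<open>The structure arrows of a composite with \<open>H\<close> contain those of \<open>H\<close> as a factor. For strict \<open>H\<close> this
  factor is an identity.\<close>

lemma strict_comp_structure:
  assumes "wf_farrow A B p"
  shows "fdom A B p = WI \<Longrightarrow> on_ar H (cl p) \<cdot>\<^bsub>C\<^esub> f0 H = on_ar H (cl p)"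
    and "\<lbrakk>wf_wrd A B X; wf_wrd A B Y; fdom A B p = X \<odot> Y\<rbrakk> \<Longrightarrow> on_ar H (cl p) \<cdot>\<^bsub>C\<^esub> f2 H X Y = on_ar H (cl p)"
  using assms H.on_ob[of X] H.on_ob[of Y] strict_on_ob
  by (simp_all add: strict_sm_functor.f0_strict[OF H] strict_sm_functor.f2_strict[OF H])

lemma smf_comp_eta_ob: "a \<in> Obj A \<Longrightarrow> smf_comp B C H (eta_ob A B a) = on_ob (restr H) a"
  using eta_in_ihom(1)[of a] by (simp add: restrict_along_eta_def smf_comp_def[of A] ihom_post_def eta_def)

lemma restr_on_ob:
  assumes [simp]: "a \<in> Obj A"
  shows "on_ob (restr H) a = \<lparr>on_ob = \<lambda>b\<in>Obj B. on_ob H (WGen a b),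
      on_ar = \<lambda>g\<in>Arr B. on_ar H (cl (FGenR a g)),
      f0 = on_ar H (cl (FBeta a)),
      f2 = \<lambda>b b'. if b \<in> Obj B \<and> b' \<in> Obj B then on_ar H (cl (FDelta a b b')) else undefined\<rparr>"
  by (auto simp: smf_comp_eta_ob[symmetric] smf_comp_def eta_ob_def strict_comp_structure intro!: ext)

lemma restr_on_ar:
  assumes [simp]: "f \<in> Arr A"
  shows "on_ar (restr H) f = \<lparr>src = on_ob (restr H) (Dom A f), tgt = on_ob (restr H) (Cod A f),
      at = \<lambda>b\<in>Obj B. on_ar H (cl (FGenL f b))\<rparr>"
proof -
  have "on_ar (restr H) f = whisker_left B C H (on_ar (eta A B) f)"
    using eta_in_ihom(2)[of f] by (simp add: restrict_along_eta_def smf_comp_def[of A] ihom_post_def)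
  then show ?thesis by (auto simp: whisker_left_def eta_def smf_comp_eta_ob)
qed

lemma restr_f0:
  "f0 (restr H) = \<lparr>src = smf_unit B C, tgt = on_ob (restr H) \<one>\<^bsub>A\<^esub>, at = \<lambda>b\<in>Obj B. on_ar H (cl (FAlpha b))\<rparr>"
proof -
  have "f0 (restr H) = whisker_left B C H (f0 (eta A B)) \<cdot>\<^bsub>ihom B C\<^esub> f0 (ihom_post B T C H)"
    using eta_in_ihom(3) by (simp add: restrict_along_eta_def smf_comp_def[of A] ihom_post_def)
  then show ?thesis
    by (auto simp: whisker_left_def eta_def smf_comp_eta_ob ihom_post_def ihom_def strict_comp_structure intro!: ext)
qed

lemma restr_f2:
  assumes [simp]: "a \<in> Obj A" "a' \<in> Obj A"
  shows "f2 (restr H) a a' = \<lparr>src = smf_ten B C (on_ob (restr H) a) (on_ob (restr H) a'),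
      tgt = on_ob (restr H) (a \<otimes>\<^bsub>A\<^esub> a'), at = \<lambda>b\<in>Obj B. on_ar H (cl (FGamma a a' b))\<rparr>"
proof -
  have "f2 (restr H) a a' = whisker_left B C H (f2 (eta A B) a a') \<cdot>\<^bsub>ihom B C\<^esub>
      f2 (ihom_post B T C H) (on_ob (eta A B) a) (on_ob (eta A B) a')"
    using eta_in_ihom(4)[of a a'] by (simp add: restrict_along_eta_def smf_comp_def[of A] ihom_post_def)
  moreover have "f2 (ihom_post B T C H) (on_ob (eta A B) a) (on_ob (eta A B) a') =
     \<lparr>src = smf_ten B C (on_ob (restr H) a) (on_ob (restr H) a'),
      tgt = smf_comp B C H (smf_ten B T (eta_ob A B a) (eta_ob A B a')),
      at = \<lambda>b\<in>Obj B. f2 H (WGen a b) (WGen a' b)\<rparr>"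
    using eta_in_ihom(1)[of a] eta_in_ihom(1)[of a']
    by (auto simp: ihom_post_def eta_def smf_comp_eta_ob eta_ob_def[of A B a] eta_ob_def[of A B a'] intro!: ext)
       (auto simp: smf_comp_eta_ob eta_ob_def[symmetric])
  ultimately show ?thesis
    by (auto simp: whisker_left_def eta_def smf_comp_eta_ob ihom_def strict_comp_structure intro!: ext)
qed

text \<open>A strict functor preserves the canonical arrows on the nose: its structure arrows disappear from
  the axioms for \<open>ass\<close>, \<open>r\<close>, \<open>l\<close>, \<open>s\<close> and from naturality.\<close>

lemma strict_on_ar:
  shows "wf_wrd A B X \<Longrightarrow> on_ar H (cl (FId X)) = ident C (on_ob H X)"
    and "\<lbrakk>wf_farrow A B p; wf_farrow A B q; fdom A B p = fcod A B q\<rbrakk>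
      \<Longrightarrow> on_ar H (cl (p \<bullet> q)) = on_ar H (cl p) \<cdot>\<^bsub>C\<^esub> on_ar H (cl q)"
    and "\<lbrakk>wf_farrow A B p; wf_farrow A B q\<rbrakk> \<Longrightarrow> on_ar H (cl (ften A B p q)) = on_ar H (cl p) \<diamondop>\<^bsub>C\<^esub> on_ar H (cl q)"
    and "\<lbrakk>wf_wrd A B X; wf_wrd A B Y; wf_wrd A B Z\<rbrakk>
      \<Longrightarrow> on_ar H (cl (FAss X Y Z)) = ass C (on_ob H X) (on_ob H Y) (on_ob H Z)"
    and "wf_wrd A B X \<Longrightarrow> on_ar H (cl (FR X)) = runit C (on_ob H X)"
    and "wf_wrd A B X \<Longrightarrow> on_ar H (cl (FL X)) = lunit C (on_ob H X)"
    and "\<lbrakk>wf_wrd A B X; wf_wrd A B Y\<rbrakk> \<Longrightarrow> on_ar H (cl (FS X Y)) = swap C (on_ob H X) (on_ob H Y)"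
proof -
  have [simp]: "on_ob H X \<in> Obj C" if "wf_wrd A B X" for X using H.on_ob[of X] that by simp
  note [simp] = strict_on_ob strict_sm_functor.f0_strict[OF H]
  have [simp]: "f2 H X Y = ident C (on_ob H X \<otimes>\<^bsub>C\<^esub> on_ob H Y)" if "wf_wrd A B X" "wf_wrd A B Y" for X Y
    using strict_sm_functor.f2_strict[OF H] that by simp
  show "on_ar H (cl (FId X)) = ident C (on_ob H X)" if "wf_wrd A B X" for X
    using H.on_ident[of X] that by simp
  show "on_ar H (cl (p \<bullet> q)) = on_ar H (cl p) \<cdot>\<^bsub>C\<^esub> on_ar H (cl q)"
    if "wf_farrow A B p" "wf_farrow A B q" "fdom A B p = fcod A B q" for p q
    using H.on_comp[of "cl q" "fdom A B q" "fcod A B q" "cl p" "fcod A B p"] that by (simp add: hom_def cl_comp)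
  show "on_ar H (cl (ften A B p q)) = on_ar H (cl p) \<diamondop>\<^bsub>C\<^esub> on_ar H (cl q)"
    if "wf_farrow A B p" "wf_farrow A B q" for p q
    using H.f2_nat[of "cl p" "fdom A B p" "fcod A B p" "cl q" "fdom A B q" "fcod A B q"] that by (simp add: hom_def cl_ten)
  show "on_ar H (cl (FAss X Y Z)) = ass C (on_ob H X) (on_ob H Y) (on_ob H Z)"
    if "wf_wrd A B X" "wf_wrd A B Y" "wf_wrd A B Z" for X Y Z
    using H.f2_ass[of X Y Z] that by simp
  show "on_ar H (cl (FR X)) = runit C (on_ob H X)" "on_ar H (cl (FL X)) = lunit C (on_ob H X)" if "wf_wrd A B X" for X
    using H.f2_runit[of X] H.f2_lunit[of X] that by simp_all
  show "on_ar H (cl (FS X Y)) = swap C (on_ob H X) (on_ob H Y)" if "wf_wrd A B X" "wf_wrd A B Y" for X Y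
    using H.f2_swap[of X Y] that by simp
qed

lemma strict_on_inv:
  assumes "feq A B (q \<bullet> p) (FId (fdom A B p))" "feq A B (p \<bullet> q) (FId (fcod A B p))"
  shows "on_ar H (cl q) = inv_ar C (on_ar H (cl p))"
proof -
  have [simp]: "wf_farrow A B p" "wf_farrow A B q" "fdom A B q = fcod A B p" "fdom A B p = fcod A B q"
    using feq_parallel[OF assms(1)] feq_parallel[OF assms(2)] by auto
  show ?thesis
    using strict_on_ar(2)[of p q] strict_on_ar(2)[of q p] cl_eqI[OF assms(1)] cl_eqI[OF assms(2)]
    by (intro C.isoI(2)[symmetric]) (simp_all add: strict_on_ar(1))
qed

lemma strict_on_whisk:
  assumes "wf_wrd A B X" "wf_farrow A B p"
  shows "on_ar H (cl (X \<triangleright> p)) = ident C (on_ob H X) \<diamondop>\<^bsub>C\<^esub> on_ar H (cl p)"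
    and "on_ar H (cl (p \<triangleleft> X)) = on_ar H (cl p) \<diamondop>\<^bsub>C\<^esub> ident C (on_ob H X)"
  using assms strict_on_ar(3)[of "FId X" p] strict_on_ar(3)[of p "FId X"] strict_on_ar(1)[of X]
  by (simp_all add: cl_ten[symmetric] cl_whiskL cl_whiskR)

end

end

context functor_to_ihom
begin

text \<open>By the computation of the restriction both sides agree on the carriers. Off the carriers all
  functors and transformations are \<open>undefined\<close>, so agreement there is extensionality.\<close>

lemma restr_bar: "restr (bar A B C F) = F"
proof (rule smf.equality)
  note H = strict_sm_functor_bar
  have ob: "on_ob (restr (bar A B C F)) a = on_ob F a" if [simp]: "a \<in> Obj A" for a
    by (rule smf.equality)
       (auto simp: restr_on_ob[OF H] sm_functor.f2_ext[OF sm_functor_F] intro!: ext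
          extensional_arb[OF sm_functor.on_ob_ext[OF sm_functor_F], symmetric]
          extensional_arb[OF sm_functor.on_ar_ext[OF sm_functor_F], symmetric])
  show "on_ob (restr (bar A B C F)) = on_ob F"
    by (rule extensionalityI[OF restr_ext(1) F.on_ob_ext]) (rule ob)
  show "on_ar (restr (bar A B C F)) = on_ar F"
  proof (rule extensionalityI[OF restr_ext(2) F.on_ar_ext])
    fix f assume [simp]: "f \<in> Arr A"
    note t = two_cell_F_ar[of f]
    show "on_ar (restr (bar A B C F)) f = on_ar F f"
      by (rule nt.equality) (auto simp: restr_on_ar[OF H] ob two_cell.src[OF t] two_cell.tgt[OF t] intro!: ext
          extensional_arb[OF two_cell.at_ext[OF t], symmetric])
  qed
  note t = two_cell_F_f0
  show "f0 (restr (bar A B C F)) = f0 F"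
    by (rule nt.equality) (auto simp: restr_f0[OF H] ob two_cell.src[OF t] two_cell.tgt[OF t] intro!: ext
          extensional_arb[OF two_cell.at_ext[OF t], symmetric])
  show "f2 (restr (bar A B C F)) = f2 F"
  proof (intro ext)
    fix a a'
    show "f2 (restr (bar A B C F)) a a' = f2 F a a'"
    proof (cases "a \<in> Obj A \<and> a' \<in> Obj A")
      case True
      then have [simp]: "a \<in> Obj A" "a' \<in> Obj A" by auto
      note t = two_cell_F_f2[of a a']
      show ?thesis
        by (rule nt.equality) (auto simp: restr_f2[OF H] ob two_cell.src[OF t] two_cell.tgt[OF t] intro!: ext
          extensional_arb[OF two_cell.at_ext[OF t], symmetric])
    next
      case False
      then show ?thesis by (simp add: restr_ext(3) F.f2_ext)
    qed
  qed
qed simp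

text \<open>Comparing \<open>[B, H] \<circ> \<eta>\<close> with \<open>F\<close> component by component gives the values of \<open>H\<close> on the generators.
  Strictness extends the agreement to all words and all formal arrows.\<close>

lemma bar_unique:
  assumes H: "strict_sm_functor T C H" and r: "restr H = F"
  shows "H = bar A B C F"
proof -
  interpret H: strict_sm_functor T C H by fact
  interpret H': strict_sm_functor T C "bar A B C F" by (rule strict_sm_functor_bar)
  have gen_ob: "on_ob H (WGen a b) = on_ob (on_ob F a) b" if "a \<in> Obj A" "b \<in> Obj B" for a b
    using restr_on_ob[OF H that(1)] that(2) by (simp add: r)
  have gen_ar: "on_ar H (cl (FGenR a g)) = on_ar (on_ob F a) g" if "a \<in> Obj A" "g \<in> Arr B" for a g
    using restr_on_ob[OF H that(1)] that(2) by (simp add: r)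
  have gen_beta: "on_ar H (cl (FBeta a)) = f0 (on_ob F a)" if "a \<in> Obj A" for a
    using restr_on_ob[OF H that(1)] by (simp add: r)
  have gen_delta: "on_ar H (cl (FDelta a b b')) = f2 (on_ob F a) b b'" if "a \<in> Obj A" "b \<in> Obj B" "b' \<in> Obj B" for a b b'
    using restr_on_ob[OF H that(1)] that(2,3) by (simp add: r)
  have gen_arL: "on_ar H (cl (FGenL f b)) = at (on_ar F f) b" if "f \<in> Arr A" "b \<in> Obj B" for f b
    using restr_on_ar[OF H that(1)] that(2) by (simp add: r)
  have gen_alpha: "on_ar H (cl (FAlpha b)) = at (f0 F) b" if "b \<in> Obj B" for b
    using restr_f0[OF H] that by (simp add: r)
  have gen_gamma: "on_ar H (cl (FGamma a a' b)) = at (f2 F a a') b" if "a \<in> Obj A" "a' \<in> Obj A" "b \<in> Obj B" for a a' b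
    using restr_f2[OF H that(1,2)] that(3) by (simp add: r)
  have obs: "on_ob H X = ob X" if "wf_wrd A B X" for X
    using that by (induction X) (auto simp: strict_on_ob[OF H] gen_ob)
  have ars: "on_ar H (cl p) = ar p" if "wf_farrow A B p" for p
    using that
  proof (induction p)
    case (FAssInv X Y Z)
    then show ?case
      using strict_on_inv[OF H, of "FAssInv X Y Z" "FAss X Y Z"] ass_inv1[of A B X Y Z] ass_inv2[of A B X Y Z]
      by (simp add: strict_on_ar[OF H] obs)
  next
    case (FRInv X)
    then show ?case
      using strict_on_inv[OF H, of "FRInv X" "FR X"] r_inv1[of A B X] r_inv2[of A B X]
      by (simp add: strict_on_ar[OF H] obs)
  next
    case (FLInv X)
    then show ?case
      using strict_on_inv[OF H, of "FLInv X" "FL X"] l_inv1[of A B X] l_inv2[of A B X]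
      by (simp add: strict_on_ar[OF H] obs)
  qed (simp_all add: strict_on_ar[OF H] strict_on_whisk[OF H] obs gen_ar gen_beta gen_delta gen_arL gen_alpha gen_gamma)
  show ?thesis
  proof (rule smf.equality)
    show "on_ob H = on_ob (bar A B C F)"
      by (rule extensionalityI[OF H.on_ob_ext H'.on_ob_ext]) (simp add: obs)
    show "on_ar H = on_ar (bar A B C F)"
      by (rule extensionalityI[OF H.on_ar_ext H'.on_ar_ext]) (auto simp: ars elim!: cl_cases)
    show "f0 H = f0 (bar A B C F)" by (simp add: H.f0_strict)
    show "f2 H = f2 (bar A B C F)"
    proof (intro ext)
      fix X Y
      show "f2 H X Y = f2 (bar A B C F) X Y"
      proof (cases "wf_wrd A B X \<and> wf_wrd A B Y")
        case True
        then show ?thesis by (simp add: H.f2_strict obs)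
      next
        case False
        then show ?thesis by (simp add: H.f2_ext H'.f2_ext)
      qed
    qed
  qed simp
qed

end

section \<open>The induced 2-cell\<close>

locale two_cell_to_ihom = three_smcs A B C + S: two_cell A "ihom B C" F G \<sigma>
  for A :: "('a, 'f, 'x) smcat_scheme" and B :: "('b, 'g, 'y) smcat_scheme" and C :: "('c, 'k, 'z) smcat_scheme"
    and F G \<sigma>

sublocale two_cell_to_ihom \<subseteq> f: functor_to_ihom A B C F ..
sublocale two_cell_to_ihom \<subseteq> g: functor_to_ihom A B C G ..

context two_cell_to_ihom
begin

abbreviation nt where "nt \<equiv> eval_nt C \<sigma>"

lemma two_cell_at: "a \<in> Obj A \<Longrightarrow> two_cell B C (on_ob F a) (on_ob G a) (at \<sigma> a)"
  using S.at_hom[of a] by (simp add: hom_ihom)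

lemma at_at_type [simp]:
  assumes "a \<in> Obj A" "b \<in> Obj B"
  shows "at (at \<sigma> a) b \<in> Arr C" "Dom C (at (at \<sigma> a) b) = on_ob (on_ob F a) b"
    "Cod C (at (at \<sigma> a) b) = on_ob (on_ob G a) b"
  using two_cell.at_hom[OF two_cell_at[OF assms(1)] assms(2)] by (auto simp: hom_def)

lemma nt_type [simp]:
  assumes "wf_wrd A B X"
  shows "nt X \<in> Arr C" "Dom C (nt X) = f.ob X" "Cod C (nt X) = g.ob X"
proof -
  have "nt X \<in> Arr C \<and> Dom C (nt X) = f.ob X \<and> Cod C (nt X) = g.ob X"
    using assms by (induction X) auto
  then show "nt X \<in> Arr C" "Dom C (nt X) = f.ob X" "Cod C (nt X) = g.ob X" by auto
qed

text \<open>Naturality is proved along the structure of a formal arrow. Composites and whiskerings paste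
  squares, canonical arrows are natural in \<open>C\<close>, and at the generators the squares are the conditions
  on \<open>\<sigma>\<close> and on its components: unit and tensor conditions for \<open>\<alpha>\<close>, \<open>\<beta>\<close>, \<open>\<gamma>\<close>, \<open>\<delta>\<close>, naturality for \<open>f \<otimes> b\<close>
  and \<open>a \<otimes> g\<close>.\<close>

lemma nt_square: "wf_farrow A B p \<Longrightarrow> C.square (g.ar p) (nt (fdom A B p)) (nt (fcod A B p)) (f.ar p)"
proof (induction p)
  case (FComp p q)
  then show ?case using C.square_comp[of "g.ar p"] by simp
next
  case (FWhiskL X p)
  then show ?case using C.square_ten[OF C.square_ident[of "nt X"]] by simp
next
  case (FWhiskR p X)
  then show ?case using C.square_ten[OF _ C.square_ident[of "nt X"]] by simp
next
  case (FAss X Y Z)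
  then show ?case using C.square_ass[of "nt X" "nt Y" "nt Z"] by simp
next
  case (FAssInv X Y Z)
  then show ?case using C.square_inv[OF C.square_ass[of "nt X" "nt Y" "nt Z"]] by simp
next
  case (FR X)
  then show ?case using C.runit_nat[OF C.Arr_hom, of "nt X"] by (simp add: C.square_def)
next
  case (FRInv X)
  then have "C.square (runit C (g.ob X)) (nt (X \<odot> WI)) (nt X) (runit C (f.ob X))"
    using C.runit_nat[OF C.Arr_hom, of "nt X"] by (simp add: C.square_def)
  from C.square_inv[OF this] show ?case using FRInv by simp
next
  case (FL X)
  then show ?case using C.lunit_nat[OF C.Arr_hom, of "nt X"] by (simp add: C.square_def)
next
  case (FLInv X)
  then have "C.square (lunit C (g.ob X)) (nt (WI \<odot> X)) (nt X) (lunit C (f.ob X))"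
    using C.lunit_nat[OF C.Arr_hom, of "nt X"] by (simp add: C.square_def)
  from C.square_inv[OF this] show ?case using FLInv by simp
next
  case (FS X Y)
  then show ?case using C.square_swap[of "nt X" "nt Y"] by simp
next
  case (FAlpha b)
  then show ?case using arg_cong[OF S.at_unit, of "\<lambda>t. at t b"]
    by (simp add: C.square_def) (simp add: ihom_def)
next
  case (FBeta a)
  then show ?case using two_cell.at_unit[OF two_cell_at, of a] by (simp add: C.square_def)
next
  case (FGamma a a' b)
  then show ?case using arg_cong[OF S.at_ten[of a a'], of "\<lambda>t. at t b"]
    by (simp add: C.square_def) (simp add: ihom_def)
next
  case (FDelta a b b')
  then show ?case using two_cell.at_ten[OF two_cell_at, of a b b'] by (simp add: C.square_def)
next
  case (FGenL f b)
  then show ?case using arg_cong[OF S.at_nat[OF A.Arr_hom[of f]], of "\<lambda>t. at t b"]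
    by (simp add: C.square_def) (simp add: ihom_def)
next
  case (FGenR a g)
  then show ?case using two_cell.at_nat[OF two_cell_at B.Arr_hom, of a g] by (simp add: C.square_def)
qed (simp add: C.square_def)

lemma at_bar2 [simp]: "wf_wrd A B X \<Longrightarrow> at (bar2 A B C \<sigma>) X = nt X"
  by (simp add: bar2_def)

lemma two_cell_bar2: "two_cell T C (bar A B C F) (bar A B C G) (bar2 A B C \<sigma>)"
proof (intro two_cell.intro two_cell_axioms.intro)
  show "sm_functor T C (bar A B C F)" "sm_functor T C (bar A B C G)"
    using f.strict_sm_functor_bar g.strict_sm_functor_bar by (simp_all add: strict_sm_functor_def)
  show "src (bar2 A B C \<sigma>) = bar A B C F" "tgt (bar2 A B C \<sigma>) = bar A B C G"
    "at (bar2 A B C \<sigma>) \<in> extensional (Obj T)"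
    by (simp_all add: bar2_def S.src S.tgt)
  show "at (bar2 A B C \<sigma>) \<one>\<^bsub>T\<^esub> \<cdot>\<^bsub>C\<^esub> f0 (bar A B C F) = f0 (bar A B C G)" by simp
  show "at (bar2 A B C \<sigma>) Y \<cdot>\<^bsub>C\<^esub> on_ar (bar A B C F) P = on_ar (bar A B C G) P \<cdot>\<^bsub>C\<^esub> at (bar2 A B C \<sigma>) X"
    if "P \<in> hom T X Y" for P X Y
  proof -
    from that obtain p where p: "p \<in> fhom A B X Y" and [simp]: "P = cl p" by (rule cl_hom_cases)
    then have [simp]: "wf_farrow A B p" "fdom A B p = X" "fcod A B p = Y" by (auto simp: fhom_def)
    then have [simp]: "wf_wrd A B X" "wf_wrd A B Y" using wf_fdom_fcod[of p] by auto
    show ?thesis using nt_square[of p] by (simp add: C.square_def)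
  qed
qed (simp_all add: hom_def)

lemma whisker_bar2: "whisker_right A (ihom B C) (ihom_post2 B T C (bar2 A B C \<sigma>)) (eta A B) = \<sigma>"
proof -
  have e: "whisker_right B C (bar2 A B C \<sigma>) (eta_ob A B a) = at \<sigma> a" if [simp]: "a \<in> Obj A" for a
  proof -
    note t = two_cell_at[OF that]
    have "smf_comp B C (bar A B C F) (eta_ob A B a) = on_ob F a" "smf_comp B C (bar A B C G) (eta_ob A B a) = on_ob G a"
      using smf_comp_eta_ob[OF f.strict_sm_functor_bar that] smf_comp_eta_ob[OF g.strict_sm_functor_bar that]
      by (simp_all add: f.restr_bar g.restr_bar)
    then show ?thesis
      by (intro nt.equality) (auto simp: whisker_right_def two_cell.src[OF t] two_cell.tgt[OF t] S.src S.tgt bar2_def eta_ob_def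
          intro!: ext extensional_arb[OF two_cell.at_ext[OF t], symmetric])
  qed
  show ?thesis
  proof (rule nt.equality)
    show "src (whisker_right A (ihom B C) (ihom_post2 B T C (bar2 A B C \<sigma>)) (eta A B)) = src \<sigma>"
      "tgt (whisker_right A (ihom B C) (ihom_post2 B T C (bar2 A B C \<sigma>)) (eta A B)) = tgt \<sigma>"
      using f.restr_bar g.restr_bar
      by (simp_all add: whisker_right_def ihom_post2_def bar2_def S.src S.tgt restrict_along_eta_def)
    show "at (whisker_right A (ihom B C) (ihom_post2 B T C (bar2 A B C \<sigma>)) (eta A B)) = at \<sigma>"
    proof (rule extensionalityI[OF _ S.at_ext])
      fix a assume a: "a \<in> Obj A"
      then show "at (whisker_right A (ihom B C) (ihom_post2 B T C (bar2 A B C \<sigma>)) (eta A B)) a = at \<sigma> a"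
        using eta_in_ihom(1)[OF a] e[OF a] by (simp add: whisker_right_def[of A] ihom_post2_def eta_def)
    qed (simp add: whisker_right_def)
  qed simp
qed

text \<open>The components of \<open>\<tau>\<close> at the symbols \<open>a \<otimes> b\<close> are those of \<open>\<sigma>\<close>. As the two functors are strict, the
  unit and tensor conditions on \<open>\<tau>\<close> determine its other components.\<close>

lemma bar2_unique:
  assumes t: "two_cell T C (bar A B C F) (bar A B C G) \<tau>"
    and w: "whisker_right A (ihom B C) (ihom_post2 B T C \<tau>) (eta A B) = \<sigma>"
  shows "\<tau> = bar2 A B C \<sigma>"
proof -
  interpret t: two_cell T C "bar A B C F" "bar A B C G" \<tau> by fact
  interpret b: two_cell T C "bar A B C F" "bar A B C G" "bar2 A B C \<sigma>" by (rule two_cell_bar2)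
  have gen: "at \<tau> (WGen a b) = at (at \<sigma> a) b" if "a \<in> Obj A" "b \<in> Obj B" for a b
    using arg_cong[OF w, of "\<lambda>s. at (at s a) b"] that eta_in_ihom(1)[OF that(1)]
    by (simp add: whisker_right_def ihom_post2_def eta_def) (simp add: eta_ob_def)
  have ty: "at \<tau> X \<in> Arr C" "Dom C (at \<tau> X) = f.ob X" "Cod C (at \<tau> X) = g.ob X" if "wf_wrd A B X" for X
    using t.at_hom[of X] that by (auto simp: hom_def)
  have "at \<tau> X = nt X" if "wf_wrd A B X" for X
    using that
  proof (induction X)
    case WI
    then show ?case using t.at_unit ty[of WI] by simp
  next
    case (WGen a b)
    then show ?case by (simp add: gen)
  next
    case (WTen X Y)
    then show ?case using t.at_ten[of X Y] ty[of "X \<odot> Y"] by simp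
  qed
  then have "at \<tau> = at (bar2 A B C \<sigma>)"
    by (intro extensionalityI[OF t.at_ext b.at_ext]) simp
  then show ?thesis by (intro nt.equality) (simp_all add: t.src t.tgt b.src b.tgt)
qed

end

theorem proposition14p2:
  fixes A :: "('a, 'f) smcat" and B :: "('b, 'g) smcat" and C :: "('c, 'k) smcat"
  assumes "sym_mon_cat A" and "sym_mon_cat B" and "sym_mon_cat C"
  shows
    "(\<forall>F. sm_functor A (ihom B C) F \<longrightarrow>
        strict_sm_functor (tensor A B) C (bar A B C F) \<and>
        smf_comp A (ihom B C) (ihom_post B (tensor A B) C (bar A B C F)) (eta A B) = F \<and>
        (\<forall>H. strict_sm_functor (tensor A B) C H \<and>
             smf_comp A (ihom B C) (ihom_post B (tensor A B) C H) (eta A B) = F \<longrightarrow>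
             H = bar A B C F)) \<and>
     (\<forall>F G \<sigma>. two_cell A (ihom B C) F G \<sigma> \<longrightarrow>
        two_cell (tensor A B) C (bar A B C F) (bar A B C G) (bar2 A B C \<sigma>) \<and>
        whisker_right A (ihom B C) (ihom_post2 B (tensor A B) C (bar2 A B C \<sigma>)) (eta A B) = \<sigma> \<and>
        (\<forall>\<tau>. two_cell (tensor A B) C (bar A B C F) (bar A B C G) \<tau> \<and>
             whisker_right A (ihom B C) (ihom_post2 B (tensor A B) C \<tau>) (eta A B) = \<sigma> \<longrightarrow>
             \<tau> = bar2 A B C \<sigma>))"
proof -
  interpret three_smcs A B C using assms by (simp add: three_smcs_def two_smcs_def)
  show ?thesis
  proof (intro conjI allI impI)
    fix F assume "sm_functor A (ihom B C) F"
    then interpret functor_to_ihom A B C F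
      using three_smcs_axioms by (simp add: functor_to_ihom_def)
    show "strict_sm_functor T C (bar A B C F)" by (rule strict_sm_functor_bar)
    show "smf_comp A (ihom B C) (ihom_post B T C (bar A B C F)) (eta A B) = F"
      using restr_bar by (simp add: restrict_along_eta_def)
    show "H = bar A B C F"
      if "strict_sm_functor T C H \<and> smf_comp A (ihom B C) (ihom_post B T C H) (eta A B) = F" for H
      using that bar_unique[of H] by (simp add: restrict_along_eta_def)
  next
    fix F G \<sigma> assume "two_cell A (ihom B C) F G \<sigma>"
    then interpret two_cell_to_ihom A B C F G \<sigma>
      using three_smcs_axioms by (simp add: two_cell_to_ihom_def)
    show "two_cell T C (bar A B C F) (bar A B C G) (bar2 A B C \<sigma>)" by (rule two_cell_bar2)
    show "whisker_right A (ihom B C) (ihom_post2 B T C (bar2 A B C \<sigma>)) (eta A B) = \<sigma>" by (rule whisker_bar2)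
    show "\<tau> = bar2 A B C \<sigma>"
      if "two_cell T C (bar A B C F) (bar A B C G) \<tau> \<and>
        whisker_right A (ihom B C) (ihom_post2 B T C \<tau>) (eta A B) = \<sigma>" for \<tau>
      using that bar2_unique[of \<tau>] by simp
  qed
qed

end
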